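(* Let $n\ge 3$, let $\mu$ be a centred, isotropic measure on $S^{n-1}$, and let $\varepsilon\in[0,1)$. If $$V(Z(\mu))\ge (1-\varepsilon)V(T^n),$$ then there exists a regular simplex $S$ circumscribed about $B^n$ such that $$\delta_H({\rm supp}\,\mu,{\rm supp}\,\mu_S)\le\gamma\,\varepsilon^{1/4},$$ where one may choose $\gamma=n^{70n}$.
   Context: $B^n$ is the Euclidean unit ball in $\mathbb{R}^n$ centred at the origin, $S^{n-1}$ its boundary sphere, and $V$ is volume. A simplex is circumscribed about $B^n$ if it contains $B^n$ and each of its facets is tangent to $B^n$; $T^n$ is a regular simplex circumscribed about $B^n$. A Borel measure $\mu$ on $S^{n-1}$ is isotropic if $\int_{S^{n-1}}u\otimes u\,d\mu(u)={\rm Id}_n$ (the $n\times n$ identity matrix), and centred if $\int_{S^{n-1}}u\,d\mu(u)=0$. For a centred, isotropic measure $\mu$, with support ${\rm supp}\,\mu$, set $$Z(\mu)=\{x\in\mathbb{R}^n:\ \langle x,u\rangle\le 1\text{ for all }u\in{\rm supp}\,\mu\},$$ which is a convex body. For a regular simplex $S$ circumscribed about $B^n$ with contact points $v_0,\dots,v_n\in S^{n-1}$, set $\mu_S=\sum_{i=0}^n\frac{n}{n+1}\delta[v_i]$, where $\delta[v]$ is the Dirac measure at $v$; thus ${\rm supp}\,\mu_S=\{v_0,\dots,v_n\}$. For non-empty compact $X,Y\subset S^{n-1}$, $$\delta_H(X,Y)=\max\left\{\max_{x\in X}\min_{y\in Y}\angle(x,y),\ \max_{y\in Y}\min_{x\in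 X}\angle(x,y)\right\},$$ where $\angle(x,y)$ is the geodesic distance on $S^{n-1}$. *)

theory Defs
  imports "HOL-Probability.Probability"
begin

definition sphere_borel :: "(real ^ 'n) measure"
  where "sphere_borel = restrict_space borel (sphere 0 1)"

definition tensor_square :: "real ^ 'n \<Rightarrow> real ^ 'n ^ 'n"
  where "tensor_square u = (\<chi> i j. u $ i * u $ j)"

definition isotropic :: "(real ^ 'n) measure \<Rightarrow> bool"
  where "isotropic \<mu> \<longleftrightarrow> has_bochner_integral \<mu> tensor_square (mat 1)"

definition centred :: "(real ^ 'n) measure \<Rightarrow> bool"
  where "centred \<mu> \<longleftrightarrow> has_bochner_integral \<mu> (\<lambda>u. u) 0"

text \<open>The support is taken relative to \<open>space \<mu>\<close>, with its subspace topology; here \<open>space \<mu>\<close> is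
  the unit sphere.\<close>

definition supp :: "(real ^ 'n) measure \<Rightarrow> (real ^ 'n) set"
  where "supp \<mu> =
    {u \<in> space \<mu>. \<forall>U. open U \<and> u \<in> U \<longrightarrow> emeasure \<mu> (U \<inter> space \<mu>) > 0}"

definition Z_body :: "(real ^ 'n) measure \<Rightarrow> (real ^ 'n) set"
  where "Z_body \<mu> = {x. \<forall>u\<in>supp \<mu>. inner x u \<le> 1}"

text \<open>Regularity of a simplex means that all its edges have the same length; the vertices are its
  extreme points.\<close>

definition regular_simplex :: "(real ^ 'n) set \<Rightarrow> bool"
  where "regular_simplex S \<longleftrightarrow>
    int CARD('n) simplex S \<and>
    (\<exists>s. \<forall>x y. x extreme_point_of S \<and> y extreme_point_of S \<and> x \<noteq> y \<longrightarrow> dist x y = s)"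

text \<open>A set \<open>F\<close> is tangent to the unit ball if it meets the unit sphere in a point \<open>v\<close> and lies in
  the tangent hyperplane of the sphere at \<open>v\<close>.\<close>

definition tangent_to_unit_ball :: "(real ^ 'n) set \<Rightarrow> bool"
  where "tangent_to_unit_ball F \<longleftrightarrow>
    (\<exists>v \<in> F \<inter> sphere 0 1. \<forall>x\<in>F. inner (x - v) v = 0)"

definition circumscribed :: "(real ^ 'n) set \<Rightarrow> bool"
  where "circumscribed S \<longleftrightarrow>
    cball 0 1 \<subseteq> S \<and> (\<forall>F. F facet_of S \<longrightarrow> tangent_to_unit_ball F)"

definition contact_points :: "(real ^ 'n) set \<Rightarrow> (real ^ 'n) set"
  where "contact_points S = frontier S \<inter> sphere 0 1"

definition simplex_measure :: "(real ^ 'n) set \<Rightarrow> (real ^ 'n) measure"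
  where "simplex_measure S =
    measure_of (space sphere_borel) (sets sphere_borel)
      (\<lambda>A. \<Sum>v\<in>contact_points S.
         ennreal (real CARD('n) / (real CARD('n) + 1)) * emeasure (return sphere_borel v) A)"

lemma sets_simplex_measure: "sets (simplex_measure S) = sets sphere_borel"
  by (simp add: simplex_measure_def sets.sigma_sets_eq sets.space_closed)

lemma space_simplex_measure: "space (simplex_measure S) = sphere 0 1"
  by (simp add: simplex_measure_def sphere_borel_def space_restrict_space space_measure_of_conv)

lemma emeasure_simplex_measure:
  fixes S :: "(real ^ 'n) set"
  assumes A: "A \<in> sets sphere_borel"
  shows "emeasure (simplex_measure S) A =
    (\<Sum>v\<in>contact_points S.
       ennreal (real CARD('n) / (real CARD('n) + 1)) * emeasure (return sphere_borel v) A)"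
proof (rule emeasure_measure_of[OF simplex_measure_def])
  show "sets sphere_borel \<subseteq> Pow (space (sphere_borel :: (real ^ 'n) measure))"
    by (rule sets.space_closed)
  show "A \<in> sets (simplex_measure S)" using A by (simp add: sets_simplex_measure)
  show "positive (sets (simplex_measure S)) (\<lambda>A. \<Sum>v\<in>contact_points S.
       ennreal (real CARD('n) / (real CARD('n) + 1)) * emeasure (return sphere_borel v) A)"
    by (simp add: positive_def)
  show "countably_additive (sets (simplex_measure S)) (\<lambda>A. \<Sum>v\<in>contact_points S.
       ennreal (real CARD('n) / (real CARD('n) + 1)) * emeasure (return sphere_borel v) A)"
  proof (rule countably_additiveI)
    fix B :: "nat \<Rightarrow> (real ^ 'n) set"
    assume B: "range B \<subseteq> sets (simplex_measure S)" "disjoint_family B"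
    have *: "(\<Sum>i. emeasure (return sphere_borel v) (B i))
        = emeasure (return sphere_borel v) (\<Union>i. B i)" for v
      using B by (intro suminf_emeasure) (auto simp: sets_simplex_measure)
    show "(\<Sum>i. \<Sum>v\<in>contact_points S.
       ennreal (real CARD('n) / (real CARD('n) + 1)) * emeasure (return sphere_borel v) (B i)) =
       (\<Sum>v\<in>contact_points S.
       ennreal (real CARD('n) / (real CARD('n) + 1)) * emeasure (return sphere_borel v) (\<Union>i. B i))"
      by (subst suminf_sum) (simp_all add: *)
  qed
qed

lemma finite_contact_points:
  fixes S :: "(real ^ 'n) set"
  assumes "regular_simplex S" "circumscribed S"
  shows "finite (contact_points S)"
proof -
  have pol: "polytope S" "aff_dim S = int CARD('n)"
    using assms(1) by (auto simp: regular_simplex_def simplex_imp_polytope aff_dim_simplex)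
  have "frontier S = rel_frontier S"
    using pol(2) aff_dim_eq_full[of S] by (intro rel_frontier_frontier[symmetric]) simp
  also have "\<dots> = \<Union>{F. F facet_of S}"
    using pol by (simp add: rel_frontier_of_polyhedron polytope_imp_polyhedron)
  finally have fr: "frontier S = \<Union>{F. F facet_of S}" .
  have fin: "finite {F. F facet_of S}"
    using pol by (simp add: finite_polytope_facets)
  have "finite (F \<inter> sphere 0 1)" if F: "F facet_of S" for F
  proof -
    obtain v where v: "v \<in> F" "norm v = 1" "\<And>x. x \<in> F \<Longrightarrow> inner (x - v) v = 0"
      using assms(2) F by (fastforce simp: circumscribed_def tangent_to_unit_ball_def)
    have "x = v" if "x \<in> F" "norm x = 1" for x
    proof -
      have "inner x v = 1"
        using v(3)[OF that(1)] v(2) by (simp add: inner_diff_left dot_square_norm)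
      then have "inner (x - v) (x - v) = 0"
        using v(2) that(2)
        unfolding inner_diff_left inner_diff_right inner_commute[of v x]
        by (simp add: dot_square_norm)
      then show ?thesis by simp
    qed
    then have "F \<inter> sphere 0 1 \<subseteq> {v}" by auto
    then show ?thesis using finite_subset by blast
  qed
  moreover have "contact_points S = (\<Union>F\<in>{F. F facet_of S}. F \<inter> sphere 0 1)"
    by (auto simp: contact_points_def fr)
  ultimately show ?thesis using fin by (simp only:) (rule finite_UN_I, auto)
qed

lemma supp_simplex_measure:
  fixes S :: "(real ^ 'n) set"
  assumes "regular_simplex S" "circumscribed S"
  shows "supp (simplex_measure S) = contact_points S"
proof -
  let ?c = "ennreal (real CARD('n) / (real CARD('n) + 1))"
  have fin: "finite (contact_points S)" by (rule finite_contact_points[OF assms])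
  have sub: "contact_points S \<subseteq> sphere 0 1" by (auto simp: contact_points_def)
  have c0: "?c > 0" by simp
  have meas: "U \<inter> sphere 0 1 \<in> sets sphere_borel" if "open U" for U :: "(real ^ 'n) set"
    using that by (auto simp: sphere_borel_def sets_restrict_space)
  have key: "emeasure (simplex_measure S) (U \<inter> sphere 0 1) > 0
      \<longleftrightarrow> (\<exists>v\<in>contact_points S. v \<in> U)" if "open U" for U
  proof -
    have "emeasure (simplex_measure S) (U \<inter> sphere 0 1) = 0
      \<longleftrightarrow> (\<forall>v\<in>contact_points S. v \<notin> U)"
      using sub c0 fin
      by (fastforce simp: emeasure_simplex_measure[OF meas[OF that]] meas[OF that] indicator_def subset_iff)
    then show ?thesis by (auto simp: zero_less_iff_neq_zero)
  qed
  show ?thesis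
  proof (intro set_eqI iffI)
    fix x assume x: "x \<in> supp (simplex_measure S)"
    have "open (- contact_points S)"
      using fin by (simp add: open_Compl finite_imp_closed)
    then show "x \<in> contact_points S"
      using x key[of "- contact_points S"] by (auto simp: supp_def space_simplex_measure)
  next
    fix x assume "x \<in> contact_points S"
    then show "x \<in> supp (simplex_measure S)"
      using sub key by (auto simp: supp_def space_simplex_measure)
  qed
qed

text \<open>For unit vectors the geodesic distance on the sphere is the angle between them.\<close>

definition geodesic_dist :: "real ^ 'n \<Rightarrow> real ^ 'n \<Rightarrow> real"
  where "geodesic_dist x y = arccos (inner x y)"

text \<open>Only meaningful for non-empty compact subsets of the unit sphere; there all the suprema and
  infima below are attained.\<close>

definition hausdorff_geodesic :: "(real ^ 'n) set \<Rightarrow> (real ^ 'n) set \<Rightarrow> real"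
  where "hausdorff_geodesic X Y =
    max (SUP x\<in>X. INF y\<in>Y. geodesic_dist x y) (SUP y\<in>Y. INF x\<in>X. geodesic_dist x y)"

end

theory Submission
  imports Defs "HOL-Real_Asymp.Real_Asymp"
begin

text \<open>
  A vector \<open>u\<close> of the sphere is lifted to the unit vector \<open>lift_unit u\<close> in one dimension more, so that a centred
  isotropic measure becomes a tight frame of unit vectors, and the contact points of a regular circumscribed simplex
  become an orthonormal basis. The volume of \<open>Z_body \<mu>\<close> is, up to a constant, the integral of an exponential over the
  cone cut out by the lifted vectors, and Ball's bound for it is a Brascamp-Lieb inequality, proved by transporting
  exponential to Gaussian densities as Barthe does. The remainder in the determinant inequality used there shows that,
  when the volume is almost maximal, any two lifted vectors are almost equal or almost orthogonal, after a
  Caratheodory reduction to finitely many vectors of the support. One can then pick an almost orthonormal basis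
  among them, which is close to the basis given by a regular simplex \<open>S\<close>. Finally, a vector \<open>u\<close> of the support far from
  the contact points of \<open>S\<close> would cut off from \<open>S\<close> a cap of volume linear in the distance of \<open>u\<close> from them, and
  the volume of \<open>Z_body \<mu>\<close> leaves no room for that.
\<close>

subsection \<open>Self-adjoint operators\<close>

text \<open>The exponent 1/4 comes from two square roots. The remainder in the volume bound controls
  the square of an inner product, so almost orthogonality is known only to order sqrt \<epsilon>.
  Turning almost regular vectors into an exact simplex costs a second root, because the squared norm
  of their sum is only linear in the errors of the Gram matrix. The cap estimate is linear in the
  distance, so that no further exponent is lost there. The remainder carries the factor
  \<open>c u * c v\<close> and says nothing about vectors of small weight. Bounding the number of
  vectors makes the light ones harmless: together they cannot account for a whole direction. The
  reduction in turn says nothing about the rest of the support, which is why the last step returns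
  to the volume of the whole body. All volumes are multiplied by \<open>slice_const\<close>, which
  gives the regular simplex mass 1; the hypothesis then reads: mass at least 1 - \<epsilon>. Angles
  never exceed 4, so the claim has content only when \<epsilon> is tiny compared with the
  dimensional constants, and these can be estimated very generously.\<close>

text \<open>An index type with one element more than \<open>'a\<close>; it replaces \<open>'a option\<close> because the change of variables
  theorem of HOL-Analysis needs a well-ordered index type.\<close>

typedef 'a lift_index = "{..CARD('a)}" by auto

instance lift_index :: (type) finite
proof
  show "finite (UNIV :: 'a lift_index set)"
    using finite_imageI[of "{..CARD('a)}" "Abs_lift_index :: nat \<Rightarrow> 'a lift_index"]
    by (metis finite_atMost type_definition.Abs_image type_definition_lift_index)
qed

instantiation lift_index :: (type) wellorder
begin
definition less_eq_lift_index :: "'a lift_index \<Rightarrow> 'a lift_index \<Rightarrow> bool"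
  where "less_eq_lift_index x y \<longleftrightarrow> Rep_lift_index x \<le> Rep_lift_index y"
definition less_lift_index :: "'a lift_index \<Rightarrow> 'a lift_index \<Rightarrow> bool"
  where "less_lift_index x y \<longleftrightarrow> Rep_lift_index x < Rep_lift_index y"
instance
proof
  fix P :: "'a lift_index \<Rightarrow> bool" and a :: "'a lift_index"
  assume *: "\<And>x. (\<And>y. y < x \<Longrightarrow> P y) \<Longrightarrow> P x"
  show "P a"
    by (induction a rule: measure_induct_rule[of Rep_lift_index])
       (auto intro: * simp: less_lift_index_def)
qed (auto simp: less_eq_lift_index_def less_lift_index_def Rep_lift_index_inject)
end

lemma card_lift_index: "CARD('a lift_index) = CARD('a) + 1"
  using type_definition.card[OF type_definition_lift_index] by simp

lemma selfadjoint_max_eigenvector: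
  fixes f :: "'a::euclidean_space \<Rightarrow> 'a"
  assumes lin: "linear f" and sym: "\<And>x y. inner (f x) y = inner x (f y)"
    and V: "subspace V" "V \<noteq> {0}" and inv: "f ` V \<subseteq> V"
  obtains v l where "v \<in> V" "norm v = 1" "f v = l *\<^sub>R v"
proof -
  let ?K = "V \<inter> sphere 0 1"
  have "compact ?K"
    using closed_subspace[OF V(1)] by (intro closed_Int_compact) auto
  moreover have "?K \<noteq> {}"
  proof -
    obtain x where "x \<in> V" "x \<noteq> 0" using V subspace_0 by blast
    then have "x /\<^sub>R norm x \<in> ?K" using V(1) by (auto simp: subspace_scale)
    then show ?thesis by blast
  qed
  moreover have "continuous_on ?K (\<lambda>x. inner (f x) x)"
    using lin by (intro continuous_on_inner linear_continuous_on continuous_on_id)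
                 (simp add: linear_conv_bounded_linear)
  ultimately obtain v where v: "v \<in> ?K" and max: "\<And>x. x \<in> ?K \<Longrightarrow> inner (f x) x \<le> inner (f v) v"
    using continuous_attains_sup[of ?K "\<lambda>x. inner (f x) x"] by blast
  define l where "l = inner (f v) v"
  have vV: "v \<in> V" and nv: "norm v = 1" using v by auto
  have le: "inner (f x) x \<le> l * (norm x)\<^sup>2" if "x \<in> V" for x
  proof (cases "x = 0")
    case True then show ?thesis by simp
  next
    case False
    then have "x /\<^sub>R norm x \<in> ?K" using V(1) that by (auto simp: subspace_scale)
    from max[OF this] show ?thesis
      using False lin by (simp add: l_def[symmetric] linear_scale field_simps power2_eq_square)
  qed
  define w where "w = f v - l *\<^sub>R v"
  have fv: "f v = w + l *\<^sub>R v" by (simp add: w_def)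
  have wV: "w \<in> V" using inv vV V(1) by (auto simp: w_def intro!: subspace_diff subspace_scale)
  have wv: "inner w v = 0" using nv by (simp add: w_def l_def inner_diff_left dot_square_norm)
  have wf: "inner (f v) w = inner w w"
    using wv by (simp add: fv inner_add_left inner_commute[of v w])
  \<comment> \<open>first variation of the Rayleigh quotient in the direction of the residual\<close>
  have key: "2 * s * inner w w + s\<^sup>2 * inner (f w) w \<le> l * s\<^sup>2 * inner w w" for s
  proof -
    have "v + s *\<^sub>R w \<in> V" using vV wV V(1) by (auto intro!: subspace_add subspace_scale)
    from le[OF this] have "inner (f (v + s *\<^sub>R w)) (v + s *\<^sub>R w)
        \<le> l * inner (v + s *\<^sub>R w) (v + s *\<^sub>R w)" by (simp add: dot_square_norm)
    moreover have "inner (f (v + s *\<^sub>R w)) (v + s *\<^sub>R w)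
        = l + 2 * s * inner (f v) w + s\<^sup>2 * inner (f w) w"
    proof -
      have "inner (f (v + s *\<^sub>R w)) (v + s *\<^sub>R w)
        = l + 2 * s * inner (f v) w + s\<^sup>2 * inner (f w) w" for w
        using sym[of w v] lin
        by (simp add: linear_add linear_scale inner_add_left inner_add_right power2_eq_square l_def
          inner_commute[of w "f v"] algebra_simps)
      then show ?thesis .
    qed
    moreover have "inner (v + s *\<^sub>R w) (v + s *\<^sub>R w) = 1 + s\<^sup>2 * inner w w"
    proof -
      have "inner (v + s *\<^sub>R w) (v + s *\<^sub>R w) = inner v v + 2 * s * inner w v + s\<^sup>2 * inner w w" for w
        by (simp add: inner_add_left inner_add_right power2_eq_square inner_commute[of v w] algebra_simps)
      then show ?thesis using wv nv by (simp only: dot_square_norm) simp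
    qed
    ultimately have "l + 2 * s * inner (f v) w + s\<^sup>2 * inner (f w) w \<le> l * (1 + s\<^sup>2 * inner w w)"
      by (simp only:)
    then show ?thesis using wf by (simp add: distrib_left mult.assoc)
  qed
  have "inner w w = 0"
  proof (rule ccontr)
    assume "inner w w \<noteq> 0"
    then have a: "inner w w > 0" using inner_ge_zero[of w] by linarith
    define b where "b = \<bar>l * inner w w - inner (f w) w\<bar> + 1"
    have b: "b > 0" by (simp add: b_def)
    define a where "a = inner w w"
    have a0: "a > 0" using a by (simp add: a_def)
    \<comment> \<open>With this \<open>s\<close> the first-order gain \<open>2 * s * a\<close> is
      twice the bound \<open>s\<^sup>2 * b = s * a\<close> on the second-order loss.\<close>
    define s where "s = a / b"
    have s: "s > 0" using a0 b by (simp add: s_def)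
    have "2 * s * a \<le> s\<^sup>2 * (l * a - inner (f w) w)"
      using key[of s] unfolding a_def[symmetric] by (simp add: algebra_simps)
    also have "\<dots> \<le> s\<^sup>2 * b" by (intro mult_left_mono) (auto simp: b_def a_def)
    also have "\<dots> = s * a" using b by (simp add: s_def power2_eq_square)
    finally show False using s a0 by simp
  qed
  then have "f v = l *\<^sub>R v" using fv by simp
  then show ?thesis using that vV nv by blast
qed

text \<open>Symmetry makes the orthogonal complement of an eigenvector inside \<open>V\<close>
  invariant again, so one can induct on the dimension.\<close>

lemma selfadjoint_orthonormal_eigenbasis_subspace:
  fixes f :: "'a::euclidean_space \<Rightarrow> 'a"
  assumes lin: "linear f" and sym: "\<And>x y. inner (f x) y = inner x (f y)"
    and V: "subspace V" and inv: "f ` V \<subseteq> V"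
  shows "\<exists>B\<subseteq>V. pairwise orthogonal B \<and> (\<forall>b\<in>B. norm b = 1 \<and> (\<exists>l. f b = l *\<^sub>R b)) \<and> span B = V"
  using V inv
proof (induction "dim V" arbitrary: V rule: less_induct)
  case less
  show ?case
  proof (cases "V = {0}")
    case True
    then show ?thesis by (intro exI[of _ "{}"]) auto
  next
    case False
    obtain v l where v: "v \<in> V" "norm v = 1" "f v = l *\<^sub>R v"
      using selfadjoint_max_eigenvector[OF lin sym less(2) False less(3)] by blast
    define W where "W = V \<inter> {x. inner v x = 0}"
    have W: "subspace W" unfolding W_def
      by (intro subspace_inter less(2) subspace_hyperplane)
    have "v \<notin> W" using v(2) by (auto simp: W_def)
    moreover have "W \<subseteq> V" by (auto simp: W_def)
    ultimately have "span W \<subset> span V"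
      unfolding span_eq_iff[THEN iffD2, OF W] span_eq_iff[THEN iffD2, OF less(2)] using v(1) by blast
    then have dim: "dim W < dim V" by (rule dim_psubset)
    have "f ` W \<subseteq> W"
    proof
      fix y assume "y \<in> f ` W"
      then obtain x where x: "x \<in> V" "inner v x = 0" "y = f x" by (auto simp: W_def)
      have "inner v (f x) = l * inner v x" using sym[of v x] v(3) by simp
      then show "y \<in> W" using x less(3) by (auto simp: W_def)
    qed
    then obtain B where B: "B \<subseteq> W" "pairwise orthogonal B"
      "\<forall>b\<in>B. norm b = 1 \<and> (\<exists>l. f b = l *\<^sub>R b)" "span B = W"
      using less(1)[OF dim W] by blast
    have "span (insert v B) = V"
    proof
      show "span (insert v B) \<subseteq> V"
        using v(1) B(1) less(2) by (intro span_minimal) (auto simp: W_def)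
      show "V \<subseteq> span (insert v B)"
      proof
        fix x assume "x \<in> V"
        then have "x - inner v x *\<^sub>R v \<in> W"
          using v less(2) by (auto simp: W_def inner_diff_right dot_square_norm intro!: subspace_diff subspace_scale)
        then show "x \<in> span (insert v B)"
          unfolding B(4)[symmetric] span_insert by blast
      qed
    qed
    moreover have "pairwise orthogonal (insert v B)"
      using B(1,2) by (auto simp: pairwise_insert orthogonal_def W_def inner_commute)
    ultimately show ?thesis
      using B v by (intro exI[of _ "insert v B"]) (auto simp: W_def)
  qed
qed

lemma selfadjoint_diagonalization:
  fixes f :: "real ^ 'm \<Rightarrow> real ^ 'm"
  assumes lin: "linear f" and sym: "\<And>x y. inner (f x) y = inner x (f y)"
  obtains e :: "'m \<Rightarrow> real ^ 'm" and l :: "'m \<Rightarrow> real"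
  where "\<And>i j. inner (e i) (e j) = (if i = j then 1 else 0)" "\<And>i. f (e i) = l i *\<^sub>R e i"
proof -
  obtain B where B: "pairwise orthogonal B" "\<forall>b\<in>B. norm b = 1 \<and> (\<exists>l. f b = l *\<^sub>R b)" "span B = UNIV"
    using selfadjoint_orthonormal_eigenbasis_subspace[OF lin sym subspace_UNIV] by blast
  have "0 \<notin> B" using B(2) by force
  then have ind: "independent B" using B(1) pairwise_orthogonal_independent by blast
  have "card B = CARD('m)"
    using dim_eq_card[of B "UNIV :: (real^'m) set"] B(3) ind by (simp add: dim_UNIV)
  moreover have "finite B" using ind by (rule independent_imp_finite)
  ultimately obtain e where e: "bij_betw e (UNIV :: 'm set) B"
    using finite_same_card_bij[OF finite_class.finite_UNIV, of B] by metis
  have eB: "e i \<in> B" for i using e by (auto simp: bij_betw_def)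
  have "inner (e i) (e j) = (if i = j then 1 else 0)" for i j
  proof (cases "i = j")
    case True
    then show ?thesis using B(2) eB[of i] by (simp add: dot_square_norm)
  next
    case False
    then have "e i \<noteq> e j" using e by (auto simp: bij_betw_def inj_def)
    then show ?thesis using B(1) eB False by (auto simp: pairwise_def orthogonal_def)
  qed
  moreover have "\<forall>i. \<exists>l. f (e i) = l *\<^sub>R e i" using B(2) eB by blast
  then have "\<exists>l. \<forall>i. f (e i) = l i *\<^sub>R e i" by (rule choice)
  ultimately show ?thesis using that by blast
qed

subsection \<open>A determinant inequality with remainder\<close>

lemma orthonormal_parseval:
  fixes e :: "'m::finite \<Rightarrow> real ^ 'm"
  assumes "\<And>i j. inner (e i) (e j) = (if i = j then 1 else 0)"
  shows "(\<Sum>k\<in>UNIV. (inner (e k) x)\<^sup>2) = (norm x)\<^sup>2"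
proof -
  let ?P = "\<chi> i. e i"
  have "?P ** transpose ?P = mat 1"
    using assms by (simp add: matrix_matrix_mult_def transpose_def mat_def vec_eq_iff inner_vec_def)
  then have "orthogonal_matrix ?P"
    by (simp add: orthogonal_matrix_def matrix_left_right_inverse)
  then have "norm (?P *v x) = norm x"
    by (metis matrix_of_matrix_vector_mul matrix_vector_mul_linear orthogonal_transformation_matrix
        orthogonal_transformation_norm)
  moreover have "(norm (?P *v x))\<^sup>2 = (\<Sum>k\<in>UNIV. (inner (e k) x)\<^sup>2)"
    unfolding power2_norm_eq_inner by (simp add: inner_vec_def matrix_vector_mult_def power2_eq_square)
  ultimately show ?thesis by simp
qed

lemma det_eq_prod_eigenvalues:
  fixes f :: "real ^ 'm \<Rightarrow> real ^ 'm" and e :: "'m::finite \<Rightarrow> real ^ 'm"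
  assumes lin: "linear f" and e: "\<And>i j. inner (e i) (e j) = (if i = j then 1 else 0)"
    and eig: "\<And>i. f (e i) = l i *\<^sub>R e i"
  shows "det (matrix f) = (\<Prod>i\<in>UNIV. l i)"
proof -
  let ?P = "\<chi> i j. e j $ i" and ?D = "\<chi> i j. if i = j then l j else 0"
  have P: "transpose ?P ** ?P = mat 1"
    using e by (simp add: matrix_matrix_mult_def transpose_def mat_def vec_eq_iff inner_vec_def)
  then have "det (transpose ?P ** ?P) = 1" by simp
  then have d0: "det ?P \<noteq> 0" by (auto simp: det_mul)
  have fe: "matrix f *v e j = l j *\<^sub>R e j" for j
    using lin eig by (simp add: matrix_works)
  have "(\<Sum>k\<in>UNIV. matrix f $ i $ k * e j $ k) = l j * e j $ i" for i j
    using arg_cong[OF fe, of "\<lambda>v. v $ i" j] by (simp add: matrix_vector_mult_def)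
  moreover have "(?P ** ?D) $ i $ j = e j $ i * l j" for i j
    by (simp add: matrix_matrix_mult_def if_distrib[of "(*) _"] cong: if_cong)
  ultimately have "matrix f ** ?P = ?P ** ?D"
    by (simp add: vec_eq_iff) (simp add: matrix_matrix_mult_def mult.commute)
  from arg_cong[OF this, of det] have "det (matrix f) * det ?P = det ?P * det ?D" by (simp only: det_mul)
  then have "det (matrix f) = det ?D" using d0 by simp
  also have "\<dots> = (\<Prod>i\<in>UNIV. l i)" by (subst det_diagonal) auto
  finally show ?thesis .
qed

text \<open>With t / l = r^2, the bound ln r <= r - 1 gives 2 - 2 r, which equals 1 - t / l + (r -
  1)^2. The leftover square is the remainder, and t - l = l (r - 1) (r + 1) compares it with (t -
  l)^2. The linear part 1 - t / l averages to 0 when \<open>l\<close> is the mean of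
  \<open>t\<close>.\<close>

lemma ln_diff_ge_quadratic:
  fixes t l \<tau> :: real
  assumes t: "0 < t" "t \<le> \<tau>" and l: "0 < l" "l \<le> \<tau>"
  shows "ln l - ln t \<ge> 1 - t / l + (t - l)\<^sup>2 / (4 * \<tau>\<^sup>2)"
proof -
  define r where "r = sqrt (t / l)"
  have r: "r > 0" and r2: "r\<^sup>2 = t / l" using t l by (auto simp: r_def)
  have "ln l - ln t = - ln (r\<^sup>2)" using t l by (simp add: r2 ln_div)
  also have "\<dots> = - 2 * ln r" using r by (simp add: ln_realpow)
  also have "\<dots> \<ge> - 2 * (r - 1)" using ln_le_minus_one[OF r] by simp
  finally have 1: "ln l - ln t \<ge> 2 - 2 * r" by simp
  have t_eq: "t = r\<^sup>2 * l" using l r2 by simp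
  have "l * (r - 1)\<^sup>2 * (l * (r + 1)\<^sup>2) \<le> l * (r - 1)\<^sup>2 * (4 * \<tau>)"
  proof (intro mult_left_mono)
    have "l * (r + 1)\<^sup>2 \<le> l * (2 * r\<^sup>2 + 2)"
      using l by (intro mult_left_mono) (use sum_squares_ge_zero[of "r - 1" 0] in \<open>simp_all add: power2_eq_square algebra_simps\<close>)
    also have "\<dots> = 2 * t + 2 * l" by (simp add: t_eq algebra_simps)
    finally show "l * (r + 1)\<^sup>2 \<le> 4 * \<tau>" using t l by simp
  qed (use l in auto)
  also have "\<dots> \<le> \<tau> * (r - 1)\<^sup>2 * (4 * \<tau>)"
    using t l by (intro mult_right_mono) auto
  also have "l * (r - 1)\<^sup>2 * (l * (r + 1)\<^sup>2) = (t - l)\<^sup>2"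
    by (simp add: t_eq power2_eq_square algebra_simps)
  finally have "(t - l)\<^sup>2 \<le> (r - 1)\<^sup>2 * (4 * \<tau>\<^sup>2)" by (simp add: power2_eq_square algebra_simps)
  then have "(t - l)\<^sup>2 / (4 * \<tau>\<^sup>2) \<le> (r - 1)\<^sup>2" using t by (simp add: divide_le_eq)
  moreover have "(r - 1)\<^sup>2 = 1 - 2 * r + t / l" by (simp add: r2[symmetric] power2_eq_square algebra_simps)
  ultimately show ?thesis using 1 by simp
qed

section \<open>Decompositions of the identity into unit vectors, and their weighted
  operators\<close>

locale unit_frame =
  fixes J :: "(real ^ 'm::finite) set" and c :: "real ^ 'm \<Rightarrow> real"
  assumes fin: "finite J"
    and c_pos: "u \<in> J \<Longrightarrow> c u > 0"
    and unit: "u \<in> J \<Longrightarrow> norm u = 1"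
    and frame: "(\<Sum>u\<in>J. (c u * inner u x) *\<^sub>R u) = x"
begin

lemma frame_inner: "(\<Sum>u\<in>J. c u * inner u x * inner u y) = inner x y"
proof -
  have "inner x y = inner (\<Sum>u\<in>J. (c u * inner u x) *\<^sub>R u) y" by (simp only: frame)
  then show ?thesis by (simp add: inner_sum_left)
qed

lemma frame_norm: "(\<Sum>u\<in>J. c u * (inner u x)\<^sup>2) = (norm x)\<^sup>2"
  using frame_inner[of x x] by (simp add: power2_eq_square dot_square_norm mult.assoc)

lemma weight_le_1: "u \<in> J \<Longrightarrow> c u \<le> 1"
proof -
  assume u: "u \<in> J"
  have "c u * (inner u u)\<^sup>2 \<le> (\<Sum>v\<in>J. c v * (inner v u)\<^sup>2)"
    using fin u by (intro member_le_sum) (auto simp: c_pos less_imp_le)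
  then show ?thesis using unit[OF u] by (simp add: frame_norm dot_square_norm)
qed

lemma sum_weights: "(\<Sum>u\<in>J. c u) = CARD('m)"
proof -
  have "(\<Sum>u\<in>J. c u) = (\<Sum>u\<in>J. \<Sum>k\<in>UNIV. c u * (inner u (axis k 1))\<^sup>2)"
  proof (rule sum.cong[OF refl])
    fix u assume u: "u \<in> J"
    have "(\<Sum>k\<in>UNIV. (u $ k)\<^sup>2) = (norm u)\<^sup>2"
      unfolding power2_norm_eq_inner by (simp add: inner_vec_def power2_eq_square)
    then show "c u = (\<Sum>k\<in>UNIV. c u * (inner u (axis k 1))\<^sup>2)"
      using unit[OF u] by (simp add: inner_axis sum_distrib_left[symmetric])
  qed
  also have "\<dots> = (\<Sum>k\<in>UNIV. \<Sum>u\<in>J. c u * (inner u (axis k 1))\<^sup>2)" by (rule sum.swap)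
  also have "\<dots> = CARD('m)" by (simp add: frame_norm)
  finally show ?thesis .
qed

text \<open>The sum of the rank one operators of the frame with weights \<open>c u * t u\<close>.
  With slopes of a one-dimensional map as \<open>t\<close>, it is the derivative of the transport
  map introduced later.\<close>

definition weighted_op :: "(real ^ 'm \<Rightarrow> real) \<Rightarrow> real ^ 'm \<Rightarrow> real ^ 'm"
  where "weighted_op t x = (\<Sum>u\<in>J. (c u * t u * inner u x) *\<^sub>R u)"

lemma linear_weighted_op: "linear (weighted_op t)"
  unfolding weighted_op_def
  by (intro linear_compose_sum ballI linearI) (auto simp: inner_add_right algebra_simps)

lemma inner_weighted_op: "inner (weighted_op t x) y = (\<Sum>u\<in>J. c u * t u * inner u x * inner u y)"
  by (simp add: weighted_op_def inner_sum_left)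

lemma weighted_op_sym: "inner (weighted_op t x) y = inner x (weighted_op t y)"
  by (subst (2) inner_commute) (simp add: inner_weighted_op mult.assoc mult.commute[of "inner _ x"])

text \<open>In an orthonormal eigenbasis \<open>e\<close> of the weighted operator, the numbers \<open>c u * (inner u (e k))\<^sup>2\<close>
  form a doubly stochastic array with marginals \<open>1\<close> and \<open>c u\<close>; the inequality is Jensen's for each
  eigenvalue, with the defect kept.\<close>

lemma ln_det_weighted_op:
  assumes t: "\<And>u. u \<in> J \<Longrightarrow> 0 < t u" "\<And>u. u \<in> J \<Longrightarrow> t u \<le> \<tau>"
  shows "det (matrix (weighted_op t)) > 0"
    and "ln (det (matrix (weighted_op t))) \<ge> (\<Sum>u\<in>J. c u * ln (t u))
      + (\<Sum>u\<in>J. c u * (norm (weighted_op t u - t u *\<^sub>R u))\<^sup>2) / (4 * \<tau>\<^sup>2)"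
proof -
  let ?f = "weighted_op t"
  obtain e l where e: "\<And>i j :: 'm. inner (e i) (e j) = (if i = j then 1 else 0 :: real)"
    and eig: "\<And>i. ?f (e i) = l i *\<^sub>R e i"
    using selfadjoint_diagonalization[OF linear_weighted_op weighted_op_sym] by metis
  define p where "p u k = c u * (inner u (e k))\<^sup>2" for u k
  have p0: "p u k \<ge> 0" if "u \<in> J" for u k using c_pos[OF that] by (simp add: p_def)
  have p1: "(\<Sum>u\<in>J. p u k) = 1" for k
    using e[of k k] by (simp add: p_def frame_norm dot_square_norm)
  have p2: "(\<Sum>k\<in>UNIV. p u k) = c u" if "u \<in> J" for u
    using orthonormal_parseval[OF e, of u] unit[OF that]
    by (simp add: p_def sum_distrib_left[symmetric] inner_commute)
  have l_eq: "l k = (\<Sum>u\<in>J. p u k * t u)" for k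
  proof -
    have "l k = inner (?f (e k)) (e k)" using e[of k k] by (simp add: eig)
    then show ?thesis by (simp add: inner_weighted_op p_def power2_eq_square mult_ac)
  qed
  have l_pos: "l k > 0" for k
  proof (rule ccontr)
    assume "\<not> l k > 0"
    then have "(\<Sum>u\<in>J. p u k * t u) = 0"
      using p0 t(1) by (intro antisym sum_nonneg) (auto simp: l_eq less_imp_le not_less)
    then have "p u k = 0" if "u \<in> J" for u
      using that p0 t(1) fin by (subst (asm) sum_nonneg_eq_0_iff) (force simp: less_imp_le)+
    then show False using p1[of k] by simp
  qed
  have l_le: "l k \<le> \<tau>" for k
  proof -
    have "l k \<le> (\<Sum>u\<in>J. p u k * \<tau>)" unfolding l_eq
      using p0 t(2) by (intro sum_mono mult_left_mono) auto
    then show ?thesis using p1[of k] by (simp add: sum_distrib_right[symmetric])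
  qed
  have det: "det (matrix ?f) = (\<Prod>k\<in>UNIV. l k)"
    by (rule det_eq_prod_eigenvalues[OF linear_weighted_op e eig])
  then show "det (matrix ?f) > 0" using l_pos by (simp add: prod_pos)
  have step: "ln (l k) - (\<Sum>u\<in>J. p u k * ln (t u)) \<ge> (\<Sum>u\<in>J. p u k * ((t u - l k)\<^sup>2 / (4 * \<tau>\<^sup>2)))" for k
  proof -
    have "(\<Sum>u\<in>J. p u k * (1 - t u / l k)) = 0"
      using l_eq[of k] l_pos[of k] p1[of k]
      by (simp add: right_diff_distrib sum_subtractf sum_divide_distrib[symmetric])
    then have "(\<Sum>u\<in>J. p u k * ((t u - l k)\<^sup>2 / (4 * \<tau>\<^sup>2)))
        = (\<Sum>u\<in>J. p u k * (1 - t u / l k + (t u - l k)\<^sup>2 / (4 * \<tau>\<^sup>2)))"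
      by (simp add: distrib_left sum.distrib)
    also have "\<dots> \<le> (\<Sum>u\<in>J. p u k * (ln (l k) - ln (t u)))"
      using p0 t l_pos l_le by (intro sum_mono mult_left_mono ln_diff_ge_quadratic) auto
    also have "\<dots> = ln (l k) - (\<Sum>u\<in>J. p u k * ln (t u))"
      using p1[of k] by (simp add: right_diff_distrib sum_subtractf sum_distrib_right[symmetric])
    finally show ?thesis .
  qed
  have "(\<Sum>u\<in>J. c u * ln (t u)) = (\<Sum>k\<in>UNIV. \<Sum>u\<in>J. p u k * ln (t u))"
    by (subst sum.swap) (simp add: sum_distrib_right[symmetric] p2)
  moreover have "ln (det (matrix ?f)) = (\<Sum>k\<in>UNIV. ln (l k))"
    using l_pos by (simp add: det ln_prod less_imp_neq[symmetric])
  \<comment> \<open>Parseval expresses the variance of the weights about the eigenvalues without the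
    eigenbasis: it measures how far each frame vector is from being an eigenvector with eigenvalue
    \<open>t u\<close>.\<close>
  moreover have "(\<Sum>u\<in>J. c u * (norm (?f u - t u *\<^sub>R u))\<^sup>2)
      = (\<Sum>k\<in>UNIV. \<Sum>u\<in>J. p u k * (t u - l k)\<^sup>2)"
  proof -
    have "c u * (norm (?f u - t u *\<^sub>R u))\<^sup>2 = (\<Sum>k\<in>UNIV. p u k * (t u - l k)\<^sup>2)" for u
    proof -
      have "inner (e k) (?f u - t u *\<^sub>R u) = (l k - t u) * inner u (e k)" for k
        using weighted_op_sym[of t "e k" u]
        by (simp add: inner_diff_right eig inner_commute algebra_simps)
      then have "(norm (?f u - t u *\<^sub>R u))\<^sup>2 = (\<Sum>k\<in>UNIV. ((l k - t u) * inner u (e k))\<^sup>2)"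
        by (simp add: orthonormal_parseval[OF e, symmetric])
      then show ?thesis
        by (simp add: p_def sum_distrib_left power_mult_distrib power2_commute mult_ac)
    qed
    then show ?thesis by (subst sum.swap) simp
  qed
  moreover have "(\<Sum>k\<in>UNIV. ln (l k) - (\<Sum>u\<in>J. p u k * ln (t u)))
      \<ge> (\<Sum>k\<in>UNIV. \<Sum>u\<in>J. p u k * ((t u - l k)\<^sup>2 / (4 * \<tau>\<^sup>2)))"
    by (intro sum_mono step)
  ultimately show "ln (det (matrix ?f)) \<ge> (\<Sum>u\<in>J. c u * ln (t u))
      + (\<Sum>u\<in>J. c u * (norm (?f u - t u *\<^sub>R u))\<^sup>2) / (4 * \<tau>\<^sup>2)"
    by (simp add: sum_subtractf sum_divide_distrib)
qed

text \<open>Approximate eigenvectors of a symmetric operator with different eigenvalues are almost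
  orthogonal: by symmetry, \<open>(t v - t u) * inner u v\<close> involves only the two defects. As
  no weight exceeds 1, the product of the weights is at most either of them.\<close>

lemma weighted_op_defect_ge:
  assumes uv: "u \<in> J" "v \<in> J"
  shows "c u * c v * (t u - t v)\<^sup>2 * (inner u v)\<^sup>2
    \<le> 2 * (\<Sum>w\<in>J. c w * (norm (weighted_op t w - t w *\<^sub>R w))\<^sup>2)"
proof (cases "u = v")
  case True
  have "0 \<le> (\<Sum>w\<in>J. c w * (norm (weighted_op t w - t w *\<^sub>R w))\<^sup>2)"
    by (intro sum_nonneg mult_nonneg_nonneg less_imp_le[OF c_pos]) auto
  then show ?thesis using True by simp
next
  case False
  let ?a = "\<lambda>w. norm (weighted_op t w - t w *\<^sub>R w)"
  have "(t v - t u) * inner u v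
      = inner (weighted_op t u - t u *\<^sub>R u) v - inner u (weighted_op t v - t v *\<^sub>R v)"
    by (simp add: inner_diff_left inner_diff_right weighted_op_sym[of t u v] left_diff_distrib)
  also have "\<bar>\<dots>\<bar> \<le> ?a u + ?a v"
    using Cauchy_Schwarz_ineq2[of "weighted_op t u - t u *\<^sub>R u" v]
      Cauchy_Schwarz_ineq2[of u "weighted_op t v - t v *\<^sub>R v"] unit uv by simp
  finally have "((t v - t u) * inner u v)\<^sup>2 \<le> (?a u + ?a v)\<^sup>2"
    by (metis abs_le_square_iff abs_of_nonneg add_nonneg_nonneg norm_ge_zero)
  also have "\<dots> \<le> 2 * ((?a u)\<^sup>2 + (?a v)\<^sup>2)"
    using zero_le_power2[of "?a u - ?a v"] by (simp add: power2_eq_square algebra_simps)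
  finally have 1: "(t u - t v)\<^sup>2 * (inner u v)\<^sup>2 \<le> 2 * ((?a u)\<^sup>2 + (?a v)\<^sup>2)"
    by (simp add: power_mult_distrib power2_commute)
  have cu: "0 < c u" "c u \<le> 1" "0 < c v" "c v \<le> 1" using uv c_pos weight_le_1 by auto
  have "c u * c v * ((t u - t v)\<^sup>2 * (inner u v)\<^sup>2) \<le> c u * c v * (2 * ((?a u)\<^sup>2 + (?a v)\<^sup>2))"
    using cu by (intro mult_left_mono 1) auto
  also have "\<dots> = 2 * (c v * (c u * (?a u)\<^sup>2) + c u * (c v * (?a v)\<^sup>2))" by (simp add: algebra_simps)
  also have "\<dots> \<le> 2 * (c u * (?a u)\<^sup>2 + c v * (?a v)\<^sup>2)"
    using cu by (intro mult_left_mono add_mono mult_left_le_one_le) auto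
  also have "c u * (?a u)\<^sup>2 + c v * (?a v)\<^sup>2 = (\<Sum>w\<in>{u, v}. c w * (?a w)\<^sup>2)" using False by simp
  also have "2 * \<dots> \<le> 2 * (\<Sum>w\<in>J. c w * (?a w)\<^sup>2)"
    using uv fin c_pos by (intro mult_left_mono sum_mono2) (auto simp: less_imp_le)
  finally show ?thesis by (simp add: mult.assoc)
qed

text \<open>The remainder is reduced to one pair and exponentiated with exp x >= 1 + x. For
  \<open>u = v\<close> it vanishes, which leaves the plain determinant inequality.\<close>

lemma det_weighted_op_ge:
  assumes t: "\<And>u. u \<in> J \<Longrightarrow> 0 < t u" "\<And>u. u \<in> J \<Longrightarrow> t u \<le> \<tau>" and uv: "u \<in> J" "v \<in> J"
  shows "det (matrix (weighted_op t)) \<ge> exp (\<Sum>u\<in>J. c u * ln (t u))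
      * (1 + c u * c v * (t u - t v)\<^sup>2 * (inner u v)\<^sup>2 / (8 * \<tau>\<^sup>2))"
proof -
  let ?S = "\<Sum>u\<in>J. c u * ln (t u)"
  let ?g = "c u * c v * (t u - t v)\<^sup>2 * (inner u v)\<^sup>2 / (8 * \<tau>\<^sup>2)"
  note d = ln_det_weighted_op[where t=t and \<tau>=\<tau>, OF t]
  have "?g \<le> (\<Sum>w\<in>J. c w * (norm (weighted_op t w - t w *\<^sub>R w))\<^sup>2) / (4 * \<tau>\<^sup>2)"
    using divide_right_mono[OF weighted_op_defect_ge[OF uv, of t], of "8 * \<tau>\<^sup>2"] by simp
  then have "?S + ?g \<le> ln (det (matrix (weighted_op t)))" using d(2) by linarith
  then have "exp (?S + ?g) \<le> det (matrix (weighted_op t))" using d(1) by (simp only: ln_ge_iff)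
  moreover have "exp ?S * (1 + ?g) \<le> exp (?S + ?g)"
    by (simp add: exp_add exp_ge_add_one_self)
  ultimately show ?thesis by linarith
qed

end

subsection \<open>Transport of the exponential to the normal distribution\<close>

abbreviation gauss_cdf :: "real \<Rightarrow> real"
  where "gauss_cdf \<equiv> cdf std_normal_distribution"

lemma std_normal_density_pos: "std_normal_density x > 0"
  by (simp add: normal_density_pos)

lemma std_normal_density_0: "std_normal_density 0 = 1 / sqrt (2 * pi)"
  by (simp add: std_normal_density_def)

lemma std_normal_density_uminus: "std_normal_density (- x) = std_normal_density x"
  by (simp add: std_normal_density_def)

lemma std_normal_density_deriv:
  "(std_normal_density has_real_derivative - x * std_normal_density x) (at x)"
proof -
  have "((\<lambda>x. K * exp (- x\<^sup>2 / 2)) has_real_derivative - x * (K * exp (- x\<^sup>2 / 2))) (at x)" for K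
    by (auto intro!: derivative_eq_intros)
  from this[of "1 / sqrt (2 * pi)"] show ?thesis by (simp only: std_normal_density_def[abs_def])
qed

interpretation std_normal: real_distribution std_normal_distribution
  by (rule real_dist_normal_dist)

lemma integrable_std_normal_density: "integrable lborel std_normal_density"
  using integrable_std_normal_moment[of 0] by simp

lemma gauss_cdf_eq_integral:
  "gauss_cdf x = (LINT y:{..x}|lborel. std_normal_density y)"
proof -
  have "measure std_normal_distribution {..x} = (\<integral>y. indicator {..x} y \<partial>std_normal_distribution)"
    by simp
  also have "\<dots> = (\<integral>y. std_normal_density y *\<^sub>R indicator {..x} y \<partial>lborel)"
    by (subst integral_density) auto
  finally show ?thesis by (simp add: cdf_def set_lebesgue_integral_def mult.commute)
qed

lemma gauss_cdf_deriv: "(gauss_cdf has_real_derivative std_normal_density x) (at x)"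
proof -
  have cont: "continuous_on {x-1..x+1} std_normal_density"
    by (intro DERIV_continuous_on[OF DERIV_subset[OF std_normal_density_deriv]]) auto
  have "((\<lambda>u. LBINT y=x-1..u. std_normal_density y) has_vector_derivative std_normal_density x)
      (at x within {x-1..x+1})"
    by (rule interval_integral_FTC2[OF _ _ cont]) auto
  then have "((\<lambda>u. gauss_cdf (x-1) + (LBINT y=x-1..u. std_normal_density y))
      has_real_derivative std_normal_density x) (at x within {x-1..x+1})"
    by (auto simp: has_real_derivative_iff_has_vector_derivative intro!: derivative_eq_intros)
  then have "(gauss_cdf has_real_derivative std_normal_density x) (at x within {x-1..x+1})"
    unfolding has_real_derivative_iff_has_vector_derivative
  proof (rule has_vector_derivative_transform[rotated 2])
    fix u assume u: "u \<in> {x-1..x+1}"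
    have int: "set_integrable lborel A std_normal_density" if "A \<in> sets borel" for A
      unfolding set_integrable_def using that
      by (intro integrable_mult_indicator integrable_std_normal_density) simp
    have "gauss_cdf u = (LINT y:{..x-1} \<union> {x-1<..u}|lborel. std_normal_density y)"
      using u by (simp add: gauss_cdf_eq_integral ivl_disj_un)
    also have "\<dots> = gauss_cdf (x-1) + (LINT y:{x-1<..u}|lborel. std_normal_density y)"
      unfolding gauss_cdf_eq_integral by (intro set_integral_Un int) auto
    also have "(LINT y:{x-1<..u}|lborel. std_normal_density y) = (LBINT y=x-1..u. std_normal_density y)"
      using u by (subst interval_integral_Ioc) auto
    finally show "gauss_cdf u = gauss_cdf (x-1) + (LBINT y=x-1..u. std_normal_density y)" .
  qed auto
  then show ?thesis
    by (subst (asm) at_within_interior) (auto simp: interior_atLeastAtMost_real)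
qed

lemma gauss_cdf_strict_mono: "strict_mono gauss_cdf"
proof (rule strict_monoI)
  fix x y :: real assume "x < y"
  then show "gauss_cdf x < gauss_cdf y"
    by (rule DERIV_pos_imp_increasing) (blast intro: gauss_cdf_deriv std_normal_density_pos)
qed

lemma gauss_cdf_pos: "gauss_cdf x > 0"
proof -
  have "0 \<le> gauss_cdf (x - 1)" by (rule std_normal.cdf_nonneg)
  also have "\<dots> < gauss_cdf x" by (rule strict_monoD[OF gauss_cdf_strict_mono]) simp
  finally show ?thesis .
qed

lemma gauss_cdf_less_1: "gauss_cdf x < 1"
proof -
  have "gauss_cdf x < gauss_cdf (x + 1)" by (rule strict_monoD[OF gauss_cdf_strict_mono]) simp
  also have "\<dots> \<le> 1" by (rule std_normal.cdf_bounded_prob)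
  finally show ?thesis .
qed

lemma isCont_gauss_cdf: "isCont gauss_cdf x"
  using gauss_cdf_deriv by (rule DERIV_isCont)

lemma gauss_cdf_surj: "0 < t \<Longrightarrow> t < 1 \<Longrightarrow> \<exists>x. gauss_cdf x = t"
proof -
  assume t: "0 < t" "t < 1"
  obtain a where a: "gauss_cdf a < t"
    using order_tendstoD(2)[OF std_normal.cdf_lim_at_bot t(1)]
    by (auto simp: eventually_at_bot_linorder)
  obtain b where b: "gauss_cdf b > t"
    using order_tendstoD(1)[OF std_normal.cdf_lim_at_top_prob t(2)]
    by (auto simp: eventually_at_top_linorder)
  have "a \<le> b"
    using a b strict_mono_less[OF gauss_cdf_strict_mono, of b a] by linarith
  then show ?thesis
    using IVT[of gauss_cdf a t b] a b isCont_gauss_cdf by force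
qed

lemma gauss_cdf_uminus: "gauss_cdf (- x) = 1 - gauss_cdf x"
proof -
  define h where "h x = gauss_cdf (- x) + gauss_cdf x" for x
  have "(h has_real_derivative std_normal_density (- x) * (- 1) + std_normal_density x) (at x)" for x
    unfolding h_def
    by (auto intro!: derivative_eq_intros DERIV_chain2[OF gauss_cdf_deriv] gauss_cdf_deriv)
  then have "\<forall>x. (h has_real_derivative 0) (at x)"
    by (simp add: std_normal_density_uminus)
  then have const: "h y = h x" for y
    by (rule DERIV_isconst_all)
  have "(h \<longlongrightarrow> 0 + 1) at_top" unfolding h_def
    by (intro tendsto_add std_normal.cdf_lim_at_top_prob
        filterlim_compose[OF std_normal.cdf_lim_at_bot filterlim_uminus_at_bot_at_top])
  moreover have "(h \<longlongrightarrow> h x) at_top"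
    using const by (intro tendsto_eventually) simp
  ultimately have "h x = 1"
    using tendsto_unique[of at_top h "h x" 1] by simp
  then show ?thesis by (simp add: h_def)
qed

lemma gauss_cdf_0: "gauss_cdf 0 = 1 / 2"
  using gauss_cdf_uminus[of 0] by simp

text \<open>By symmetry this is the Mills ratio (tail over density) of the normal law at
  \<open>- x\<close>. It occurs here as the slope of the transport of the exponential law to the
  normal law.\<close>

definition mills :: "real \<Rightarrow> real"
  where "mills x = gauss_cdf x / std_normal_density x"

lemma mills_pos: "mills x > 0"
  using gauss_cdf_pos std_normal_density_pos by (simp add: mills_def)

lemma mills_deriv: "(mills has_real_derivative 1 + x * mills x) (at x)"
proof -
  have "((\<lambda>x. gauss_cdf x / std_normal_density x) has_real_derivative
      (std_normal_density x * std_normal_density x - gauss_cdf x * (- x * std_normal_density x))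
        / (std_normal_density x * std_normal_density x)) (at x)"
    using std_normal_density_pos[of x]
    by (intro DERIV_divide gauss_cdf_deriv std_normal_density_deriv) auto
  then show ?thesis
    using std_normal_density_pos[of x] by (simp add: mills_def[abs_def] add_divide_distrib mult.commute)
qed

lemma mills_0: "mills 0 \<ge> 1"
proof -
  have "2 \<le> sqrt (2 * pi)" using pi_gt3 by (intro real_le_rsqrt) simp
  then show ?thesis by (simp add: mills_def gauss_cdf_0 std_normal_density_0)
qed

lemma mills_increase: 
  assumes "0 \<le> x" "x \<le> y"
  shows "mills y - mills x \<ge> y - x"
proof -
  have "mills x - x \<le> mills y - y"
  proof (rule DERIV_nonneg_imp_nondecreasing[OF assms(2)])
    fix z assume z: "x \<le> z" "z \<le> y"
    have "((\<lambda>z. mills z - z) has_real_derivative (1 + z * mills z) - 1) (at z)"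
      by (intro DERIV_diff mills_deriv DERIV_ident)
    moreover have "0 \<le> (1 + z * mills z) - 1"
      using z assms mills_pos[of z] by simp
    ultimately show "\<exists>d. ((\<lambda>z. mills z - z) has_real_derivative d) (at z) \<and> 0 \<le> d" by blast
  qed
  then show ?thesis by simp
qed

text \<open>For \<open>x \<ge> 0\<close> the function \<open>3 * std_normal_density - (1 - gauss_cdf)\<close> increases up to \<open>1/3\<close> and decreases
  to its limit \<open>0\<close> afterwards.\<close>

lemma gauss_tail_le:
  assumes "x \<ge> 0"
  shows "1 - gauss_cdf x \<le> 3 * std_normal_density x"
proof -
  define h where "h x = 3 * std_normal_density x - (1 - gauss_cdf x)" for x
  have h: "(h has_real_derivative std_normal_density x * (1 - 3 * x)) (at x)" for x
    unfolding h_def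
    by (auto intro!: derivative_eq_intros std_normal_density_deriv gauss_cdf_deriv simp: algebra_simps)
  have "sqrt (2 * pi) \<le> 6" using pi_less_4 by (intro real_le_lsqrt) auto
  then have h0: "h 0 \<ge> 0" by (simp add: h_def gauss_cdf_0 std_normal_density_0 field_simps)
  have lim: "(h \<longlongrightarrow> 3 * 0 - (1 - 1)) at_top"
    unfolding h_def
  proof (intro tendsto_intros std_normal.cdf_lim_at_top_prob)
    show "(std_normal_density \<longlongrightarrow> 0) at_top"
      unfolding std_normal_density_def[abs_def] by real_asymp
  qed
  have "h x \<ge> 0"
  proof (cases "x \<le> 1 / 3")
    case True
    have "h 0 \<le> h x"
    proof (rule DERIV_nonneg_imp_nondecreasing[OF assms])
      fix z assume "0 \<le> z" "z \<le> x"
      then have "0 \<le> std_normal_density z * (1 - 3 * z)"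
        using True less_imp_le[OF std_normal_density_pos[of z]] by (intro mult_nonneg_nonneg) auto
      with h show "\<exists>d. (h has_real_derivative d) (at z) \<and> 0 \<le> d" by blast
    qed
    then show ?thesis using h0 by simp
  next
    case False
    have "h y \<le> h x" if "x \<le> y" for y
    proof (rule DERIV_nonpos_imp_nonincreasing[OF that])
      fix z assume "x \<le> z" "z \<le> y"
      then have "std_normal_density z * (1 - 3 * z) \<le> 0"
        using False less_imp_le[OF std_normal_density_pos[of z]] by (intro mult_nonneg_nonpos) auto
      with h show "\<exists>d. (h has_real_derivative d) (at z) \<and> d \<le> 0" by blast
    qed
    then have "\<forall>\<^sub>F y in at_top. h y \<le> h x" by (auto simp: eventually_at_top_linorder)
    from tendsto_upperbound[OF lim this] show ?thesis by simp
  qed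
  then show ?thesis by (simp add: h_def)
qed

text \<open>The increasing map that transports the exponential density \<open>exp (- t)\<close> on \<open>(0, \<infinity>)\<close> to the standard
  normal density.\<close>

definition exp_to_gauss :: "real \<Rightarrow> real"
  where "exp_to_gauss t = - (THE x. gauss_cdf x = exp (- t))"

text \<open>Upper tails are matched: \<open>exp (- t)\<close> is the mass of the exponential law
  beyond \<open>t\<close>, and \<open>gauss_cdf (- x)\<close> is, by symmetry, that of the normal
  law beyond \<open>x\<close>.\<close>

lemma gauss_cdf_exp_to_gauss: "t > 0 \<Longrightarrow> gauss_cdf (- exp_to_gauss t) = exp (- t)"
  unfolding exp_to_gauss_def minus_minus
proof (rule theI')
  assume "t > 0"
  then have "\<exists>x. gauss_cdf x = exp (- t)" by (intro gauss_cdf_surj) auto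
  moreover have "inj gauss_cdf" using gauss_cdf_strict_mono by (rule strict_mono_imp_inj_on)
  ultimately show "\<exists>!x. gauss_cdf x = exp (- t)" by (metis injD)
qed

lemma exp_to_gauss_unique: "t > 0 \<Longrightarrow> gauss_cdf (- x) = exp (- t) \<Longrightarrow> exp_to_gauss t = x"
  using gauss_cdf_exp_to_gauss strict_mono_eq[OF gauss_cdf_strict_mono] by (metis neg_equal_iff_equal)

lemma exp_to_gauss_strict_mono: "0 < s \<Longrightarrow> s < t \<Longrightarrow> exp_to_gauss s < exp_to_gauss t"
proof -
  assume "0 < s" "s < t"
  then have "gauss_cdf (- exp_to_gauss t) < gauss_cdf (- exp_to_gauss s)"
    by (simp add: gauss_cdf_exp_to_gauss)
  then show ?thesis using strict_mono_less[OF gauss_cdf_strict_mono] by simp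
qed

text \<open>The map inverts \<open>- ln (gauss_cdf (- x))\<close>, whose derivative is the
  reciprocal of the Mills ratio.\<close>

lemma exp_to_gauss_deriv:
  assumes "t > 0"
  shows "(exp_to_gauss has_real_derivative mills (- exp_to_gauss t)) (at t)"
proof -
  let ?G = "\<lambda>x. - ln (gauss_cdf (- x))"
  have G: "(?G has_real_derivative 1 / mills (- x)) (at x)" for x
  proof -
    have "(?G has_real_derivative - (1 / gauss_cdf (- x) * (std_normal_density (- x) * (- 1)))) (at x)"
      using gauss_cdf_pos[of "- x"]
      by (auto intro!: derivative_eq_intros DERIV_chain2[OF gauss_cdf_deriv] DERIV_chain2[OF DERIV_ln_divide])
    then show ?thesis by (simp add: mills_def)
  qed
  have GE: "?G (exp_to_gauss s) = s" if "s > 0" for s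
    using that by (simp add: gauss_cdf_exp_to_gauss)
  have EG: "exp_to_gauss (?G x) = x" for x
  proof (rule exp_to_gauss_unique)
    show "?G x > 0" using gauss_cdf_pos gauss_cdf_less_1 by simp
  qed (simp add: gauss_cdf_pos)
  have "(exp_to_gauss has_real_derivative inverse (1 / mills (- exp_to_gauss t))) (at t)"
  proof (rule DERIV_inverse_function[where f = ?G and a = 0 and b = "t + 1"])
    show "isCont exp_to_gauss t"
    proof -
      have "isCont exp_to_gauss (?G (exp_to_gauss t))"
        by (rule isCont_inverse_function[where d = 1])
           (auto simp: EG intro!: DERIV_isCont G)
      then show ?thesis using GE[OF assms] by simp
    qed
  qed (use assms GE mills_pos[of "- exp_to_gauss t"] in \<open>auto intro!: G\<close>)
  then show ?thesis by simp
qed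

text \<open>The transport equation in dimension one: target density at the image times slope is the
  source density.\<close>

lemma std_normal_density_exp_to_gauss:
  "t > 0 \<Longrightarrow> std_normal_density (exp_to_gauss t) * mills (- exp_to_gauss t) = exp (- t)"
  using std_normal_density_pos[of "- exp_to_gauss t"]
  by (simp add: mills_def gauss_cdf_exp_to_gauss std_normal_density_uminus)

lemma exp_to_gauss_nonpos:
  assumes "0 < t" "t \<le> 1 / 2"
  shows "exp_to_gauss t \<le> 0"
proof -
  have "1 - t \<le> exp (- t)" using exp_ge_add_one_self[of "- t"] by simp
  then have "gauss_cdf 0 \<le> gauss_cdf (- exp_to_gauss t)"
    using assms by (simp add: gauss_cdf_0 gauss_cdf_exp_to_gauss)
  then show ?thesis using strict_mono_less_eq[OF gauss_cdf_strict_mono] by simp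
qed

text \<open>The slope is a quotient with numerator \<open>exp (- t)\<close>. Its denominator is at
  least a third of the tail \<open>1 - exp (- t)\<close>, and this tail is at least
  \<open>t * exp (- t)\<close>.\<close>

lemma mills_exp_to_gauss_le:
  assumes "0 < t" "t \<le> 1 / 2"
  shows "mills (- exp_to_gauss t) \<le> 3 / t"
proof -
  let ?x = "- exp_to_gauss t"
  have x: "?x \<ge> 0" using exp_to_gauss_nonpos[OF assms] by simp
  have g: "std_normal_density ?x > 0" by (rule std_normal_density_pos)
  have "(1 - exp (- t)) \<le> 3 * std_normal_density ?x"
    using gauss_tail_le[OF x] assms by (simp add: gauss_cdf_exp_to_gauss)
  moreover have "t * exp (- t) \<le> 1 - exp (- t)"
  proof -
    have "(1 + t) * exp (- t) \<le> exp t * exp (- t)"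
      by (intro mult_right_mono exp_ge_add_one_self) auto
    then show ?thesis by (simp add: exp_minus algebra_simps)
  qed
  ultimately have "t * exp (- t) \<le> 3 * std_normal_density ?x" by linarith
  then show ?thesis
    using g assms by (simp add: mills_def gauss_cdf_exp_to_gauss field_simps)
qed

text \<open>Two expansions are composed: up to 1/2 the map \<open>exp_to_gauss\<close> has slope at
  least \<open>mills 0\<close>, hence at least 1, and \<open>mills\<close> has slope at least 1 on
  the nonnegative axis. This is how different inner products lead to different slopes, and so to a
  gain in the determinant.\<close>

lemma mills_exp_to_gauss_decrease:
  assumes "0 < s" "s \<le> t" "t \<le> 1 / 2"
  shows "mills (- exp_to_gauss s) - mills (- exp_to_gauss t) \<ge> t - s"
proof -
  have "exp_to_gauss s - s \<le> exp_to_gauss t - t"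
  proof (rule DERIV_nonneg_imp_nondecreasing[OF assms(2)])
    fix z assume z: "s \<le> z" "z \<le> t"
    have "((\<lambda>z. exp_to_gauss z - z) has_real_derivative mills (- exp_to_gauss z) - 1) (at z)"
      using z assms by (intro DERIV_diff exp_to_gauss_deriv DERIV_ident) auto
    moreover have "0 \<le> mills (- exp_to_gauss z) - 1"
    proof -
      have nonpos: "exp_to_gauss z \<le> 0" using z assms by (intro exp_to_gauss_nonpos) auto
      then have "- exp_to_gauss z - 0 \<le> mills (- exp_to_gauss z) - mills 0"
        by (intro mills_increase) auto
      then show ?thesis using mills_0 nonpos by linarith
    qed
    ultimately show "\<exists>d. ((\<lambda>z. exp_to_gauss z - z) has_real_derivative d) (at z) \<and> 0 \<le> d" by blast
  qed
  moreover have "mills (- exp_to_gauss s) - mills (- exp_to_gauss t) \<ge> exp_to_gauss t - exp_to_gauss s"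
  proof -
    have "exp_to_gauss t \<le> 0" using assms by (intro exp_to_gauss_nonpos) auto
    moreover have "exp_to_gauss s \<le> exp_to_gauss t"
      using exp_to_gauss_strict_mono[OF assms(1), of t] assms(2) by (cases "s = t") auto
    ultimately show ?thesis
      using mills_increase[of "- exp_to_gauss t" "- exp_to_gauss s"] by linarith
  qed
  ultimately show ?thesis by linarith
qed

subsection \<open>The Brascamp-Lieb estimate with remainder\<close>

lemma nn_integral_lborel_prod_cart:
  fixes f :: "'m::finite \<Rightarrow> real \<Rightarrow> ennreal"
  assumes [measurable]: "\<And>i. f i \<in> borel_measurable borel"
  shows "(\<integral>\<^sup>+x. (\<Prod>i\<in>UNIV. f i (x $ i)) \<partial>(lborel :: (real ^ 'm) measure)) = (\<Prod>i\<in>UNIV. \<integral>\<^sup>+t. f i t \<partial>lborel)"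
proof -
  define ix where "ix b = (THE i. axis i (1::real) = b)" for b :: "real ^ 'm"
  have ix: "ix (axis i 1) = i" for i by (auto simp: ix_def axis_eq_axis)
  have B: "Basis = range (\<lambda>i. axis i 1 :: real ^ 'm)" by (auto simp: Basis_vec_def)
  have inj: "inj (\<lambda>i. axis i 1 :: real ^ 'm)" by (auto simp: inj_def axis_eq_axis)
  have "(\<integral>\<^sup>+x. (\<Prod>b\<in>Basis. f (ix b) (x \<bullet> b)) \<partial>(lborel :: (real ^ 'm) measure))
      = (\<Prod>b\<in>(Basis :: (real ^ 'm) set). \<integral>\<^sup>+t. f (ix b) t \<partial>lborel)"
    by (rule nn_integral_lborel_prod) auto
  then show ?thesis by (simp add: B prod.reindex[OF inj] ix inner_axis)
qed

section \<open>Gaussian product densities and the change of variables\<close>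

definition gauss_vec :: "real ^ 'm::finite \<Rightarrow> real"
  where "gauss_vec z = (\<Prod>i\<in>UNIV. std_normal_density (z $ i))"

lemma gauss_vec_pos: "gauss_vec z > 0"
  by (auto simp: gauss_vec_def intro!: prod_pos std_normal_density_pos)

lemma gauss_vec_eq_exp:
  "gauss_vec (z :: real ^ 'm::finite) = exp (- real CARD('m) * ln (sqrt (2 * pi)) - (norm z)\<^sup>2 / 2)"
proof -
  have "std_normal_density x = exp (- ln (sqrt (2 * pi)) - x\<^sup>2 / 2)" for x
  proof -
    have "exp (- ln (sqrt (2 * pi)) + - x\<^sup>2 / 2) = exp (- ln (sqrt (2 * pi))) * exp (- x\<^sup>2 / 2)"
      by (rule exp_add)
    moreover have "exp (- ln (sqrt (2 * pi))) = 1 / sqrt (2 * pi)"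
      by (simp add: exp_minus inverse_eq_divide)
    ultimately show ?thesis by (simp add: std_normal_density_def)
  qed
  then have "gauss_vec z = exp (\<Sum>i\<in>UNIV. - ln (sqrt (2 * pi)) - (z $ i)\<^sup>2 / 2)"
    unfolding gauss_vec_def by (simp only: exp_sum finite_class.finite_UNIV)
  also have "(\<Sum>i\<in>UNIV. - ln (sqrt (2 * pi)) - (z $ i)\<^sup>2 / 2)
      = - real CARD('m) * ln (sqrt (2 * pi)) - (norm z)\<^sup>2 / 2"
    unfolding power2_norm_eq_inner
    by (simp add: sum_subtractf sum_divide_distrib[symmetric] inner_vec_def power2_eq_square sum_negf)
  finally show ?thesis .
qed

lemma borel_measurable_gauss_vec [measurable]: "gauss_vec \<in> borel_measurable borel"
  unfolding gauss_vec_eq_exp[abs_def] by measurable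

lemma nn_integral_gauss_vec: "(\<integral>\<^sup>+z. gauss_vec z \<partial>(lborel :: (real ^ 'm::finite) measure)) = 1"
proof -
  have "(\<integral>\<^sup>+t. std_normal_density t \<partial>lborel) = 1"
    using std_normal.emeasure_space_1 by (simp add: emeasure_density)
  moreover have "(\<integral>\<^sup>+z. gauss_vec z \<partial>(lborel :: (real ^ 'm) measure))
      = (\<integral>\<^sup>+z. (\<Prod>i\<in>UNIV. ennreal (std_normal_density (z $ i))) \<partial>(lborel :: (real ^ 'm) measure))"
    by (simp add: gauss_vec_def prod_ennreal)
  ultimately show ?thesis by (subst (asm) nn_integral_lborel_prod_cart) auto
qed

lemma nn_integral_pullback_le:
  fixes g :: "real ^ 'm::{finite,wellorder} \<Rightarrow> real ^ 'm::_" and f :: "real ^ 'm::_ \<Rightarrow> real"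
  assumes K: "open K" and der: "\<And>y. y \<in> K \<Longrightarrow> (g has_derivative g' y) (at y)" and inj: "inj_on g K"
    and f [measurable]: "f \<in> borel_measurable borel" and f0: "\<And>z. f z \<ge> 0"
    and fin: "(\<integral>\<^sup>+z. f z \<partial>lborel) < \<infinity>"
  shows "(\<integral>\<^sup>+y. ennreal (\<bar>det (matrix (g' y))\<bar> * f (g y)) * indicator K y \<partial>lborel) \<le> (\<integral>\<^sup>+z. f z \<partial>lborel)"
proof -
  let ?h = "\<lambda>y. \<bar>det (matrix (g' y))\<bar> * f (g y)"
  have "continuous_on K g"
    using der by (meson continuous_at_imp_continuous_on has_derivative_continuous)
  then have gK: "open (g ` K)" using K inj by (rule invariance_of_domain)
  have int: "integrable lborel f"
    using f0 fin by (intro integrableI_nonneg) auto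
  then have "integrable lebesgue f" by (intro integrable_completion[THEN iffD2]) auto
  then have ai: "f absolutely_integrable_on g ` K"
    using gK integrable_mult_indicator[of "g ` K" lebesgue f] by (auto simp: set_integrable_def)
  \<comment> \<open>The change of variables theorem speaks of vector-valued functions, so
    \<open>f\<close> is read as a map into \<open>real ^ 1\<close>.\<close>
  have "(\<lambda>y. \<bar>det (matrix (g' y))\<bar> *\<^sub>R (vec (f (g y)) :: real ^ 1)) absolutely_integrable_on K \<and>
      integral K (\<lambda>y. \<bar>det (matrix (g' y))\<bar> *\<^sub>R (vec (f (g y)) :: real ^ 1)) = vec (integral (g ` K) f)"
    using ai by (subst has_absolute_integral_change_of_variables)
      (use K inj der in \<open>auto simp: absolutely_integrable_on_1_iff integral_on_1_eq has_derivative_at_withinI\<close>)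
  then have h: "?h absolutely_integrable_on K" and hI: "integral K ?h = integral (g ` K) f"
    by (auto simp: absolutely_integrable_on_1_iff integral_on_1_eq vec_eq_iff)
  have "(\<integral>\<^sup>+y. ennreal (?h y) * indicator K y \<partial>lborel) = (\<integral>\<^sup>+y. ennreal (indicator K y *\<^sub>R ?h y) \<partial>lebesgue)"
    unfolding nn_integral_completion by (intro nn_integral_cong) (auto simp: indicator_def)
  also have "\<dots> = ennreal (LINT y:K|lebesgue. ?h y)"
    unfolding set_lebesgue_integral_def using h f0
    by (intro nn_integral_eq_integral) (auto simp: set_integrable_def)
  also have "(LINT y:K|lebesgue. ?h y) = integral (g ` K) f"
    using set_lebesgue_integral_eq_integral(2)[OF h] hI by simp
  also have "\<dots> = (LINT z:g ` K|lebesgue. f z)"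
    using set_lebesgue_integral_eq_integral(2)[OF ai] by simp
  also have "ennreal \<dots> = (\<integral>\<^sup>+z. ennreal (indicator (g ` K) z *\<^sub>R f z) \<partial>lebesgue)"
    unfolding set_lebesgue_integral_def using ai f0
    by (intro nn_integral_eq_integral[symmetric]) (auto simp: set_integrable_def)
  also have "\<dots> \<le> (\<integral>\<^sup>+z. f z \<partial>lebesgue)"
    using f0 by (intro nn_integral_mono) (auto simp: indicator_def)
  finally show ?thesis by (simp only: nn_integral_completion)
qed

section \<open>Barthe's transport on the cone of a frame of constant height over an axis\<close>

locale unit_frame_axis = unit_frame J c
  for J :: "(real ^ 'm::{finite,wellorder}) set" and c +
  fixes e :: "real ^ 'm::{finite,wellorder}"
  assumes norm_e: "norm e = 1"
    and inner_e: "u \<in> J \<Longrightarrow> inner u e = 1 / sqrt (real CARD('m))"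
begin

definition open_cone :: "(real ^ 'm::_) set"
  where "open_cone = {y. \<forall>u\<in>J. inner u y > 0}"

lemma open_open_cone: "open open_cone"
proof -
  have "open_cone = (\<Inter>u\<in>J. {y. inner u y > 0})" by (auto simp: open_cone_def)
  then show ?thesis using fin by (auto intro!: open_INT open_halfspace_gt)
qed

text \<open>Constant height makes the weighted sum of the frame vectors a multiple of the axis. The
  product of the exponentials \<open>exp (- inner u y)\<close>, with exponents \<open>c u\<close>,
  thereby becomes the single exponential \<open>cone_exp y\<close>.\<close>

lemma sum_weights_inner: "(\<Sum>u\<in>J. c u * inner u y) = sqrt (real CARD('m)) * inner e y"
proof -
  have "inner e y = (\<Sum>u\<in>J. c u * inner u e * inner u y)" by (rule frame_inner[symmetric])
  also have "\<dots> = (\<Sum>u\<in>J. c u * inner u y) / sqrt (real CARD('m))"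
    by (simp add: inner_e sum_divide_distrib)
  finally show ?thesis by simp
qed

definition transport :: "real ^ 'm::_ \<Rightarrow> real ^ 'm::_"
  where "transport y = (\<Sum>u\<in>J. (c u * exp_to_gauss (inner u y)) *\<^sub>R u)"

definition transport_slope :: "real ^ 'm::_ \<Rightarrow> real ^ 'm::_ \<Rightarrow> real"
  where "transport_slope y u = mills (- exp_to_gauss (inner u y))"

lemma transport_slope_pos: "transport_slope y u > 0"
  by (simp add: transport_slope_def mills_pos)

lemma transport_has_derivative:
  assumes "y \<in> open_cone"
  shows "(transport has_derivative weighted_op (transport_slope y)) (at y)"
  unfolding transport_def weighted_op_def
proof (rule has_derivative_sum)
  fix u assume "u \<in> J"
  then have pos: "inner u y > 0" using assms by (simp add: open_cone_def)
  have "((\<lambda>y. exp_to_gauss (inner u y)) has_derivative (\<lambda>x. transport_slope y u * inner u x)) (at y)"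
  proof -
    have "((\<lambda>y. inner u y) has_derivative (\<lambda>x. inner u x)) (at y)"
      by (auto intro!: derivative_eq_intros)
    from has_derivative_compose[OF this, of exp_to_gauss] exp_to_gauss_deriv[OF pos] show ?thesis
      by (simp add: has_field_derivative_def transport_slope_def)
  qed
  then show "((\<lambda>y. (c u * exp_to_gauss (inner u y)) *\<^sub>R u) has_derivative
      (\<lambda>x. (c u * transport_slope y u * inner u x) *\<^sub>R u)) (at y)"
    by (auto intro!: derivative_eq_intros simp: mult_ac)
qed

text \<open>The map is monotone: pairing the difference of two values with the difference of the
  arguments gives a sum of nonnegative terms, which vanishes only if all \<open>inner u y\<close>
  and \<open>inner u z\<close> agree.\<close>

lemma inj_on_transport: "inj_on transport open_cone"
proof (rule inj_onI)
  fix y z assume y: "y \<in> open_cone" and z: "z \<in> open_cone" and eq: "transport y = transport z"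
  let ?E = "\<lambda>u. (exp_to_gauss (inner u y) - exp_to_gauss (inner u z)) * (inner u y - inner u z)"
  have "(\<Sum>u\<in>J. c u * ?E u) = inner (transport y - transport z) (y - z)"
    unfolding transport_def sum_subtractf[symmetric] inner_sum_left
    by (intro sum.cong) (auto simp: inner_diff_left inner_diff_right algebra_simps)
  then have 0: "(\<Sum>u\<in>J. c u * ?E u) = 0" using eq by simp
  have pos: "?E u > 0" if "u \<in> J" "inner u y \<noteq> inner u z" for u
    using that y z exp_to_gauss_strict_mono[of "inner u y" "inner u z"]
      exp_to_gauss_strict_mono[of "inner u z" "inner u y"]
    by (auto simp: open_cone_def neq_iff intro: mult_pos_pos mult_neg_neg)
  have nonneg: "0 \<le> c u * ?E u" if "u \<in> J" for u
    using pos[OF that] c_pos[OF that] by (cases "inner u y = inner u z") (auto simp: less_imp_le)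
  have "c u * ?E u = 0" if "u \<in> J" for u
    using 0 nonneg that fin by (subst (asm) sum_nonneg_eq_0_iff) auto
  then have "inner u (y - z) = 0" if "u \<in> J" for u
    using pos[OF that] c_pos[OF that] that by (fastforce simp: inner_diff_right)
  then have "(norm (y - z))\<^sup>2 = 0" using frame_norm[of "y - z"] by simp
  then show "y = z" by simp
qed

text \<open>Among all coefficients that represent a vector \<open>z\<close> in the frame, the
  numbers \<open>inner u z\<close> have the least weighted sum of squares.\<close>

lemma norm_transport_le: "(norm (transport y))\<^sup>2 \<le> (\<Sum>u\<in>J. c u * (exp_to_gauss (inner u y))\<^sup>2)"
proof -
  let ?z = "transport y" and ?t = "\<lambda>u. exp_to_gauss (inner u y)"
  have z: "(\<Sum>u\<in>J. c u * ?t u * inner u ?z) = (norm ?z)\<^sup>2"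
    unfolding power2_norm_eq_inner by (subst (2) transport_def) (simp add: inner_sum_left)
  have "0 \<le> (\<Sum>u\<in>J. c u * (?t u - inner u ?z)\<^sup>2)"
    by (intro sum_nonneg mult_nonneg_nonneg less_imp_le[OF c_pos]) auto
  also have "\<dots> = (\<Sum>u\<in>J. c u * (?t u)\<^sup>2) - 2 * (\<Sum>u\<in>J. c u * ?t u * inner u ?z) + (\<Sum>u\<in>J. c u * (inner u ?z)\<^sup>2)"
    by (simp add: power2_diff algebra_simps sum.distrib sum_subtractf sum_distrib_left)
  finally show ?thesis by (simp add: z frame_norm)
qed

text \<open>The one-dimensional transport equations are multiplied with exponents
  \<open>c u\<close>. The normalizing factors combine since the weights sum to the dimension, and
  \<open>norm_transport_le\<close> lets the Gaussian exponents combine in the right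
  direction.\<close>

lemma exp_le_gauss_vec_transport:
  assumes "y \<in> open_cone"
  shows "exp (- sqrt (real CARD('m)) * inner e y)
    \<le> exp (\<Sum>u\<in>J. c u * ln (transport_slope y u)) * gauss_vec (transport y)"
proof -
  let ?L = "ln (sqrt (2 * pi))"
  have "- inner u y = - ?L - (exp_to_gauss (inner u y))\<^sup>2 / 2 + ln (transport_slope y u)" if "u \<in> J" for u
  proof -
    have pos: "inner u y > 0" using assms that by (simp add: open_cone_def)
    have "- inner u y = ln (std_normal_density (exp_to_gauss (inner u y)) * transport_slope y u)"
      using std_normal_density_exp_to_gauss[OF pos] by (simp add: transport_slope_def)
    also have "\<dots> = ln (std_normal_density (exp_to_gauss (inner u y))) + ln (transport_slope y u)"
      by (rule ln_mult_pos[OF std_normal_density_pos transport_slope_pos])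
    also have "ln (std_normal_density x) = - ?L - x\<^sup>2 / 2" for x
      by (simp add: std_normal_density_def ln_mult ln_div)
    finally show ?thesis .
  qed
  then have "(\<Sum>u\<in>J. c u * (- inner u y))
      = (\<Sum>u\<in>J. c u * (- ?L - (exp_to_gauss (inner u y))\<^sup>2 / 2 + ln (transport_slope y u)))"
    by (intro sum.cong) auto
  also have "\<dots> = - (\<Sum>u\<in>J. c u) * ?L - (\<Sum>u\<in>J. c u * (exp_to_gauss (inner u y))\<^sup>2) / 2
      + (\<Sum>u\<in>J. c u * ln (transport_slope y u))"
    by (simp add: sum_subtractf sum.distrib distrib_left right_diff_distrib sum_divide_distrib
        sum_distrib_right sum_negf)
  also have "\<dots> \<le> (\<Sum>u\<in>J. c u * ln (transport_slope y u)) + (- real CARD('m) * ?L - (norm (transport y))\<^sup>2 / 2)"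
    using norm_transport_le[of y] by (simp add: sum_weights)
  finally have "- sqrt (real CARD('m)) * inner e y
      \<le> (\<Sum>u\<in>J. c u * ln (transport_slope y u)) + (- real CARD('m) * ?L - (norm (transport y))\<^sup>2 / 2)"
    by (simp add: sum_negf sum_weights_inner)
  then show ?thesis
    unfolding gauss_vec_eq_exp exp_add[symmetric] by simp
qed

definition cone_exp :: "real ^ 'm::_ \<Rightarrow> real"
  where "cone_exp y = exp (- sqrt (real CARD('m)) * inner e y)"

lemma borel_measurable_cone_exp [measurable]: "cone_exp \<in> borel_measurable borel"
  unfolding cone_exp_def by measurable

text \<open>Pointwise, the exponential is at most the Jacobian of the transport times the Gaussian
  density at the image, and the right-hand side integrates to at most 1. On \<open>B\<close>, where
  the slopes of \<open>u\<close> and \<open>v\<close> differ by at least \<rho>, the determinant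
  inequality leaves room for the additional term.\<close>

lemma cone_integral_with_gain:
  assumes uv: "u \<in> J" "v \<in> J" and B: "B \<subseteq> open_cone" "B \<in> sets borel"
    and slope: "\<And>y w. y \<in> B \<Longrightarrow> w \<in> J \<Longrightarrow> transport_slope y w \<le> \<tau>"
    and gap: "\<And>y. y \<in> B \<Longrightarrow> \<rho> \<le> \<bar>transport_slope y u - transport_slope y v\<bar>"
    and "\<rho> \<ge> 0" "\<tau> > 0"
  shows "(\<integral>\<^sup>+y. ennreal (cone_exp y) * indicator open_cone y \<partial>lborel)
    + ennreal (c u * c v * \<rho>\<^sup>2 * (inner u v)\<^sup>2 / (8 * \<tau>\<^sup>2)) * (\<integral>\<^sup>+y. ennreal (cone_exp y) * indicator B y \<partial>lborel) \<le> 1"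
proof -
  define g where "g = c u * c v * \<rho>\<^sup>2 * (inner u v)\<^sup>2 / (8 * \<tau>\<^sup>2)"
  have g0: "g \<ge> 0" using c_pos uv by (auto simp: g_def less_imp_le)
  let ?D = "\<lambda>y. det (matrix (weighted_op (transport_slope y)))"
  have pos: "?D y > 0" for y
  proof -
    obtain \<tau>' where "\<And>w. w \<in> J \<Longrightarrow> transport_slope y w \<le> \<tau>'"
      using fin bdd_above_finite[of "transport_slope y ` J"] by (auto simp: bdd_above_def)
    then show ?thesis by (intro ln_det_weighted_op(1) transport_slope_pos)
  qed
  have main: "cone_exp y * (1 + g * indicator B y) \<le> ?D y * gauss_vec (transport y)"
    if y: "y \<in> open_cone" for y
  proof -
    let ?S = "exp (\<Sum>u\<in>J. c u * ln (transport_slope y u))"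
    have "?S * (1 + g * indicator B y) \<le> ?D y"
    proof (cases "y \<in> B")
      case True
      have "\<rho>\<^sup>2 \<le> (transport_slope y u - transport_slope y v)\<^sup>2"
        using gap[OF True] \<open>\<rho> \<ge> 0\<close> by (metis abs_le_square_iff abs_of_nonneg)
      then have "g \<le> c u * c v * (transport_slope y u - transport_slope y v)\<^sup>2 * (inner u v)\<^sup>2 / (8 * \<tau>\<^sup>2)"
        unfolding g_def using uv c_pos
        by (intro divide_right_mono mult_right_mono mult_left_mono) (auto simp: less_imp_le)
      then have "?S * (1 + g) \<le> ?S * (1 + c u * c v * (transport_slope y u - transport_slope y v)\<^sup>2
          * (inner u v)\<^sup>2 / (8 * \<tau>\<^sup>2))" by simp
      also have "\<dots> \<le> ?D y"
        by (rule det_weighted_op_ge[OF transport_slope_pos slope[OF True] uv])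
      finally show ?thesis using True by simp
    next
      case False
      \<comment> \<open>Off \<open>B\<close> any bound will do, here one for the finitely many
        slopes at \<open>y\<close>; the pair \<open>u\<close>, \<open>u\<close> removes the
        remainder in which it occurs.\<close>
      obtain \<tau>' where t': "\<And>w. w \<in> J \<Longrightarrow> transport_slope y w \<le> \<tau>'"
        using fin bdd_above_finite[of "transport_slope y ` J"] by (auto simp: bdd_above_def)
      have "?S * (1 + 0) \<le> ?D y"
        using det_weighted_op_ge[OF transport_slope_pos t' uv(1) uv(1)] by simp
      then show ?thesis using False by simp
    qed
    from mult_right_mono[OF this less_imp_le[OF gauss_vec_pos[of "transport y"]]]
    have "(?S * gauss_vec (transport y)) * (1 + g * indicator B y) \<le> ?D y * gauss_vec (transport y)"
      by (simp only: mult_ac)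
    moreover have "cone_exp y * (1 + g * indicator B y) \<le> (?S * gauss_vec (transport y)) * (1 + g * indicator B y)"
      unfolding cone_exp_def using exp_le_gauss_vec_transport[OF y] g0
      by (intro mult_right_mono) (auto simp: indicator_def)
    ultimately show ?thesis by linarith
  qed
  have "(\<integral>\<^sup>+y. ennreal (cone_exp y) * indicator open_cone y \<partial>lborel)
      + ennreal g * (\<integral>\<^sup>+y. ennreal (cone_exp y) * indicator B y \<partial>lborel)
    = (\<integral>\<^sup>+y. ennreal (cone_exp y) * indicator open_cone y + ennreal g * (ennreal (cone_exp y) * indicator B y) \<partial>lborel)"
    using B open_open_cone by (subst nn_integral_add) (auto simp: nn_integral_cmult)
  also have "\<dots> \<le> (\<integral>\<^sup>+y. ennreal (\<bar>?D y\<bar> * gauss_vec (transport y)) * indicator open_cone y \<partial>lborel)"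
  proof (intro nn_integral_mono)
    fix y
    show "ennreal (cone_exp y) * indicator open_cone y + ennreal g * (ennreal (cone_exp y) * indicator B y)
      \<le> ennreal (\<bar>?D y\<bar> * gauss_vec (transport y)) * indicator open_cone y"
    proof (cases "y \<in> open_cone")
      case True
      have ce: "cone_exp y \<ge> 0" by (simp add: cone_exp_def)
      have "ennreal (cone_exp y) + ennreal g * (ennreal (cone_exp y) * indicator B y)
          = ennreal (cone_exp y * (1 + g * indicator B y))"
        using ce g0 by (cases "y \<in> B")
          (auto simp: ennreal_mult[symmetric] ennreal_plus[symmetric] algebra_simps simp del: ennreal_plus)
      also have "\<dots> \<le> ennreal (\<bar>?D y\<bar> * gauss_vec (transport y))"
        using main[OF True] pos[of y] by (intro ennreal_leI) simp
      finally show ?thesis using True by simp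
    next
      case False
      then have "y \<notin> B" using B(1) by blast
      then show ?thesis using False by simp
    qed
  qed
  also have "\<dots> \<le> (\<integral>\<^sup>+z. gauss_vec z \<partial>(lborel :: (real ^ 'm::_) measure))"
    by (rule nn_integral_pullback_le[where K = open_cone and g = transport and f = gauss_vec
          and g' = "\<lambda>y. weighted_op (transport_slope y)",
          OF open_open_cone transport_has_derivative inj_on_transport])
       (auto simp: nn_integral_gauss_vec less_imp_le[OF gauss_vec_pos])
  finally show ?thesis by (simp add: nn_integral_gauss_vec g_def)
qed

text \<open>The gain is tested on a small cube around a point tilted from the axis towards
  \<open>u - v\<close>. There \<open>u\<close> and \<open>v\<close> have different inner products
  with \<open>y\<close>, hence different slopes.\<close>

lemma pairs_equal_or_orthogonal:
  assumes uv: "u \<in> J" "v \<in> J" and dim: "CARD('m) \<ge> 4"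
    and vol: "(\<integral>\<^sup>+y. ennreal (cone_exp y) * indicator open_cone y \<partial>lborel) \<ge> ennreal (1 - \<epsilon>)" and "\<epsilon> \<le> 1"
  shows "c u * c v * (norm (u - v))\<^sup>2 * (inner u v)\<^sup>2
    \<le> 294912 * (real CARD('m))\<^sup>2 * (24 * real CARD('m)) ^ CARD('m) * \<epsilon>"
proof (cases "u = v")
  case True
  have "(\<integral>\<^sup>+y. ennreal (cone_exp y) * indicator open_cone y \<partial>lborel) \<le> 1"
    using cone_integral_with_gain[OF uv, of "{}" 1 0] by simp
  from order_trans[OF vol this] have "\<epsilon> \<ge> 0" by simp
  then show ?thesis using True by simp
next
  case False
  define N where "N = real CARD('m)"
  have N: "N \<ge> 4" using dim by (simp add: N_def)
  have sN: "sqrt N \<ge> 2" using N by (intro real_le_rsqrt) simp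
  have sNN: "sqrt N * sqrt N = N" using N by simp
  define d where "d = u - v"
  have d: "norm d > 0" using False by (simp add: d_def)
  have ed: "inner e d = 0" using inner_e uv by (simp add: d_def inner_diff_right inner_commute[of e])
  \<comment> \<open>The axis part gives every frame vector the inner product 1 / (2 sqrt N). The
    tilt changes it by at most 1 / (8 sqrt N), and the cube by at most 1 / (16 sqrt N), since its
    half diagonal is \<open>r * sqrt N\<close>. All values stay positive and below 1/2, where the
    slope estimates apply, while half of the difference produced by the tilt survives.\<close>
  define a where "a = (1/2) *\<^sub>R e + (1 / (8 * sqrt N * norm d)) *\<^sub>R d"
  define r where "r = 1 / (16 * N)"
  define B where "B = box (a - (\<chi> i. r)) (a + (\<chi> i. r))"
  have r: "r > 0" using N by (simp add: r_def)
  have near: "norm (y - a) \<le> 1 / (16 * sqrt N)" if "y \<in> B" for y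
  proof -
    have "\<bar>(y - a) $ i\<bar> \<le> r" for i
      using that by (simp add: B_def mem_box_cart abs_le_iff) (smt (verit))
    then have "(\<Sum>i\<in>UNIV. ((y - a) $ i)\<^sup>2) \<le> (\<Sum>i\<in>(UNIV :: 'm set). r\<^sup>2)"
      by (intro sum_mono) (metis abs_ge_zero power2_abs power_mono)
    also have "\<dots> = (1 / (16 * sqrt N))\<^sup>2" using N by (simp add: r_def N_def power2_eq_square field_simps)
    finally have "(norm (y - a))\<^sup>2 \<le> (1 / (16 * sqrt N))\<^sup>2"
      unfolding power2_norm_eq_inner by (simp add: inner_vec_def power2_eq_square)
    then show ?thesis using N by (subst (asm) power2_le_iff_abs_le) auto
  qed
  have inner_near: "\<bar>inner w y - inner w a\<bar> \<le> norm w / (16 * sqrt N)" if "y \<in> B" for y w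
  proof -
    have "\<bar>inner w y - inner w a\<bar> \<le> norm w * norm (y - a)"
      using Cauchy_Schwarz_ineq2[of w "y - a"] by (simp add: inner_diff_right)
    also have "\<dots> \<le> norm w * (1 / (16 * sqrt N))" using near[OF that] by (intro mult_left_mono) auto
    finally show ?thesis by simp
  qed
  have range: "1 / (4 * sqrt N) \<le> inner w y \<and> inner w y \<le> 1 / 2" if y: "y \<in> B" and w: "w \<in> J" for y w
  proof -
    have "inner w a = 1 / (2 * sqrt N) + inner w d / norm d * (1 / (8 * sqrt N))"
      using inner_e[OF w] by (simp add: a_def N_def inner_add_right)
    moreover have "\<bar>inner w d / norm d\<bar> \<le> 1"
      using Cauchy_Schwarz_ineq2[of w d] unit[OF w] d by (simp add: divide_le_eq)
    then have "\<bar>inner w d / norm d * (1 / (8 * sqrt N))\<bar> \<le> 1 * (1 / (8 * sqrt N))"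
      unfolding abs_mult using sN by (intro mult_mono) auto
    moreover have "\<bar>inner w y - inner w a\<bar> \<le> 1 / (16 * sqrt N)"
      using inner_near[OF y, of w] unit[OF w] by simp
    moreover have "1 / (16 * sqrt N) \<le> 1 / (16 * 2)" using sN N by (intro divide_left_mono) auto
    moreover have "1 / (2 * sqrt N) = 8 * (1 / (16 * sqrt N))" "1 / (8 * sqrt N) = 2 * (1 / (16 * sqrt N))"
      "1 / (4 * sqrt N) = 4 * (1 / (16 * sqrt N))" using sN by (auto simp: field_simps)
    ultimately show ?thesis by linarith
  qed
  have B: "B \<subseteq> open_cone" "B \<in> sets borel"
  proof -
    have "0 < 1 / (4 * sqrt N)" using N by simp
    then have "0 < inner w y" if "y \<in> B" "w \<in> J" for y w
      using range[OF that] by linarith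
    then show "B \<subseteq> open_cone" by (auto simp: open_cone_def)
  qed (simp add: B_def)
  have slope: "transport_slope y w \<le> 12 * sqrt N" if y: "y \<in> B" and w: "w \<in> J" for y w
  proof -
    have pos: "0 < 1 / (4 * sqrt N)" using N by simp
    have "transport_slope y w \<le> 3 / inner w y"
      unfolding transport_slope_def using range[OF y w] pos by (intro mills_exp_to_gauss_le) linarith+
    also have "\<dots> \<le> 3 / (1 / (4 * sqrt N))"
      using range[OF y w] pos by (intro divide_left_mono mult_pos_pos) linarith+
    finally show ?thesis by simp
  qed
  have gap: "norm d / (16 * sqrt N) \<le> \<bar>transport_slope y u - transport_slope y v\<bar>" if y: "y \<in> B" for y
  proof -
    have pos: "0 < 1 / (4 * sqrt N)" using N by simp
    have "inner d a = norm d * (1 / (8 * sqrt N))"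
      using ed d by (simp add: a_def inner_add_right inner_commute[of d e] dot_square_norm power2_eq_square)
    then have "inner d y \<ge> norm d * (1 / (8 * sqrt N)) - norm d / (16 * sqrt N)"
      using inner_near[OF y, of d] by linarith
    also have "norm d * (1 / (8 * sqrt N)) - norm d / (16 * sqrt N) = norm d / (16 * sqrt N)" by simp
    finally have d1: "norm d / (16 * sqrt N) \<le> inner u y - inner v y" by (simp add: d_def inner_diff_left)
    moreover have "0 \<le> norm d / (16 * sqrt N)" using N by simp
    ultimately have "inner u y - inner v y \<le> transport_slope y v - transport_slope y u"
      unfolding transport_slope_def
      using range[OF y uv(1)] range[OF y uv(2)] pos by (intro mills_exp_to_gauss_decrease) linarith+
    then show ?thesis using d1 by linarith
  qed
  let ?G = "c u * c v * (norm d / (16 * sqrt N))\<^sup>2 * (inner u v)\<^sup>2 / (8 * (12 * sqrt N)\<^sup>2)"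
  have G0: "?G \<ge> 0" using uv c_pos by (auto simp: less_imp_le)
  have volB: "emeasure lborel B = ennreal ((1 / (8 * N)) ^ CARD('m))"
  proof -
    have "emeasure lborel B = ennreal (\<Prod>b\<in>(Basis :: (real^'m::_) set). ((a + (\<chi> i. r)) - (a - (\<chi> i. r))) \<bullet> b)"
      unfolding B_def using r by (intro emeasure_lborel_box) (auto simp: Basis_vec_def inner_axis inner_add_left inner_diff_left)
    also have "(\<Prod>b\<in>(Basis :: (real^'m::_) set). ((a + (\<chi> i. r)) - (a - (\<chi> i. r))) \<bullet> b) = (\<Prod>b\<in>(Basis :: (real^'m::_) set). 2 * r)"
      by (intro prod.cong) (auto simp: Basis_vec_def inner_axis)
    also have "\<dots> = (1 / (8 * N)) ^ CARD('m)" by (simp add: r_def)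
    finally show ?thesis .
  qed
  have expB: "cone_exp y \<ge> exp (- N)" if y: "y \<in> B" for y
  proof -
    have "inner e a = 1 / 2" using ed norm_e by (simp add: a_def inner_add_right dot_square_norm)
    then have "inner e y \<le> 1 / 2 + 1 / (16 * sqrt N)"
      using inner_near[OF y, of e] norm_e by simp
    also have "1 / (16 * sqrt N) \<le> 1 / (16 * 2)" using sN N by (intro divide_left_mono) auto
    finally have "inner e y \<le> 1" by simp
    then have "sqrt N * inner e y \<le> sqrt N * 1" using sN N by (intro mult_left_mono) auto
    also have "sqrt N * 1 \<le> sqrt N * sqrt N" using sN N by (intro mult_left_mono) auto
    finally show ?thesis using N by (simp add: cone_exp_def N_def[symmetric] sNN)
  qed
  have "ennreal (exp (- N)) * emeasure lborel B = (\<integral>\<^sup>+y. ennreal (exp (- N)) * indicator B y \<partial>lborel)"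
    using B by (simp add: nn_integral_cmult_indicator)
  also have "\<dots> \<le> (\<integral>\<^sup>+y. ennreal (cone_exp y) * indicator B y \<partial>lborel)"
    using expB by (intro nn_integral_mono) (auto simp: indicator_def ennreal_leI)
  finally have low: "ennreal (exp (- N) * (1 / (8 * N)) ^ CARD('m)) \<le> (\<integral>\<^sup>+y. ennreal (cone_exp y) * indicator B y \<partial>lborel)"
    using N by (simp add: volB ennreal_mult[symmetric])
  have "ennreal (1 - \<epsilon>) + ennreal ?G * ennreal (exp (- N) * (1 / (8 * N)) ^ CARD('m))
      \<le> (\<integral>\<^sup>+y. ennreal (cone_exp y) * indicator open_cone y \<partial>lborel)
        + ennreal ?G * (\<integral>\<^sup>+y. ennreal (cone_exp y) * indicator B y \<partial>lborel)"
    by (intro add_mono vol mult_left_mono low) auto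
  also have "\<dots> \<le> 1"
    using slope gap B sN N by (intro cone_integral_with_gain uv) auto
  finally have le1: "ennreal (1 - \<epsilon>) + ennreal ?G * ennreal (exp (- N) * (1 / (8 * N)) ^ CARD('m)) \<le> 1" .
  have add: "ennreal p + ennreal q * ennreal k = ennreal (p + q * k)" if "p \<ge> 0" "q \<ge> 0" "k \<ge> 0" for p q k
    using that by (simp add: ennreal_mult)
  have "(1 - \<epsilon>) + ?G * (exp (- N) * (1 / (8 * N)) ^ CARD('m)) \<le> 1"
    using le1 unfolding ennreal_1[symmetric]
    by (subst (asm) add) (use G0 \<open>\<epsilon> \<le> 1\<close> N in \<open>auto simp del: ennreal_1\<close>)
  then have a: "?G * (exp (- N) * (1 / (8 * N)) ^ CARD('m)) \<le> \<epsilon>" by linarith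
  \<comment> \<open>The constant is 16^2 * 8 * 12^2. The factor \<open>(24 * N) ^ CARD('m)\<close>
    below joins the volume of the cube of side 1 / (8 N) with the lower bound exp (- N) of the
    exponential, through e <= 3.\<close>
  have g: "?G = c u * c v * (norm d)\<^sup>2 * (inner u v)\<^sup>2 / (294912 * N\<^sup>2)"
    using N by (simp add: power_divide power_mult_distrib power2_eq_square[of N])
  have k: "1 / (24 * N) ^ CARD('m) \<le> exp (- N) * (1 / (8 * N)) ^ CARD('m)"
  proof -
    have "exp N = exp 1 ^ CARD('m)" by (simp add: N_def exp_of_nat_mult[symmetric])
    also have "\<dots> \<le> 3 ^ CARD('m)" using exp_le by (intro power_mono) auto
    finally have "(1 / 3) ^ CARD('m) \<le> exp (- N)" by (simp add: exp_minus power_one_over inverse_eq_divide frac_le)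
    then have "(1 / 3) ^ CARD('m) * (1 / (8 * N)) ^ CARD('m) \<le> exp (- N) * (1 / (8 * N)) ^ CARD('m)"
      using N by (intro mult_right_mono) auto
    moreover have "(1 / 3) ^ CARD('m) * (1 / (8 * N)) ^ CARD('m) = (1 / 3 * (1 / (8 * N))) ^ CARD('m)"
      by (rule power_mult_distrib[symmetric])
    moreover have "1 / 3 * (1 / (8 * N)) = 1 / (24 * N)" by simp
    ultimately show ?thesis by (simp only: power_one_over)
  qed
  have "c u * c v * (norm d)\<^sup>2 * (inner u v)\<^sup>2 / (294912 * N\<^sup>2) * (1 / (24 * N) ^ CARD('m)) \<le> \<epsilon>"
    using order_trans[OF mult_left_mono[OF k G0] a] unfolding g .
  moreover have "0 < 294912 * N\<^sup>2 * (24 * N) ^ CARD('m)" using N by auto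
  ultimately have "c u * c v * (norm d)\<^sup>2 * (inner u v)\<^sup>2 \<le> \<epsilon> * (294912 * N\<^sup>2 * (24 * N) ^ CARD('m))"
    by (simp add: pos_divide_le_eq)
  then show ?thesis
    by (simp only: d_def N_def mult.commute[of \<epsilon>])
qed

end

subsection \<open>Cones in one dimension more\<close>

lemma prod_Basis_cart:
  fixes z :: "real ^ 'm::finite"
  shows "(\<Prod>b\<in>Basis. z \<bullet> b) = (\<Prod>i\<in>UNIV. z $ i)"
proof -
  have B: "Basis = range (\<lambda>i. axis i 1 :: real ^ 'm)" by (auto simp: Basis_vec_def)
  have inj: "inj (\<lambda>i. axis i 1 :: real ^ 'm)" by (auto simp: inj_def axis_eq_axis)
  show ?thesis unfolding B by (simp add: prod.reindex[OF inj] inner_axis)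
qed

section \<open>Exponential integrals in an orthonormal frame\<close>

lemma lborel_distr_orthonormal:
  fixes v :: "'m::{finite,wellorder} \<Rightarrow> real ^ 'm::_"
  assumes v: "\<And>i j. inner (v i) (v j) = (if i = j then 1 else 0)"
  shows "distr lborel borel (\<lambda>y. \<chi> i. inner (v i) y) = lborel"
proof (rule lborel_eqI[symmetric])
  let ?R = "\<lambda>y :: real ^ 'm::_. \<chi> i. inner (v i) y"
  have lin: "linear ?R" by (intro linearI) (auto simp: vec_eq_iff inner_add_right)
  have nrm: "norm (?R y) = norm y" for y
  proof -
    have "(norm (?R y))\<^sup>2 = (\<Sum>k\<in>UNIV. (inner (v k) y)\<^sup>2)"
      unfolding power2_norm_eq_inner by (subst inner_vec_def) (simp add: power2_eq_square)
    then show ?thesis using orthonormal_parseval[OF v, of y] by simp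
  qed
  have orth: "orthogonal_transformation ?R"
    using lin nrm by (simp add: orthogonal_transformation)
  define Q where "Q = inv ?R"
  have Q: "orthogonal_transformation Q"
    unfolding Q_def by (rule orthogonal_transformation_inv[OF orth])
  have [measurable]: "?R \<in> borel_measurable borel"
    by (rule borel_measurable_continuous_onI) (intro continuous_intros)
  fix l u :: "real ^ 'm::_" assume lu: "\<And>b. b \<in> Basis \<Longrightarrow> l \<bullet> b \<le> u \<bullet> b"
  have "?R -` box l u = Q ` box l u"
    unfolding Q_def by (rule bij_vimage_eq_inv_image[OF orthogonal_transformation_bij[OF orth]])
  then have "emeasure (distr lborel borel ?R) (box l u) = emeasure lborel (Q ` box l u)"
    by (simp add: emeasure_distr)
  also have "Q ` box l u \<in> sets borel"
    using \<open>?R -` box l u = Q ` box l u\<close> measurable_sets_borel[of ?R borel "box l u"] by simp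
  then have "emeasure lborel (Q ` box l u) = emeasure lebesgue (Q ` box l u)" by simp
  also have "\<dots> = ennreal (measure lebesgue (Q ` box l u))"
    using measurable_orthogonal_image[OF Q, of "box l u"] by (simp add: emeasure_eq_measure2)
  also have "measure lebesgue (Q ` box l u) = measure lebesgue (box l u)"
    by (rule measure_orthogonal_image[OF Q]) simp
  also have "ennreal \<dots> = emeasure lborel (box l u)"
    by (simp add: emeasure_eq_measure2[symmetric])
  finally show "emeasure (distr lborel borel ?R) (box l u) = (\<Prod>b\<in>Basis. (u - l) \<bullet> b)"
    using lu by simp
qed simp

text \<open>Rotating the frame to the coordinate axes turns the integrand into a product of
  exponential densities of rate 1.\<close>

lemma nn_integral_exp_orthant:
  fixes v :: "'m::{finite,wellorder} \<Rightarrow> real ^ 'm::_"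
  assumes v: "\<And>i j. inner (v i) (v j) = (if i = j then 1 else 0)"
  shows "(\<integral>\<^sup>+y. ennreal (exp (- (\<Sum>i\<in>UNIV. inner (v i) y))) * indicator {y. \<forall>i. inner (v i) y \<ge> 0} y \<partial>lborel) = 1"
proof -
  let ?R = "\<lambda>y :: real ^ 'm::_. \<chi> i. inner (v i) y"
  let ?f = "\<lambda>s :: real ^ 'm::_. \<Prod>i\<in>UNIV. ennreal (exponential_density 1 (s $ i))"
  have [measurable]: "?R \<in> borel_measurable borel"
    by (rule borel_measurable_continuous_onI) (intro continuous_intros)
  have "ennreal (exp (- (\<Sum>i\<in>UNIV. inner (v i) y))) * indicator {y. \<forall>i. inner (v i) y \<ge> 0} y = ?f (?R y)" for y
  proof (cases "\<forall>i. inner (v i) y \<ge> 0")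
    case True
    then show ?thesis
      by (simp add: exponential_density_def prod_ennreal exp_sum[symmetric] sum_negf not_less[symmetric])
  next
    case False
    then have "\<exists>i. exponential_density 1 (inner (v i) y) = 0" by (auto simp: exponential_density_def not_le)
    then have "?f (?R y) = 0"
      by (intro prod_zero) auto
    then show ?thesis using False by simp
  qed
  then have "(\<integral>\<^sup>+y. ennreal (exp (- (\<Sum>i\<in>UNIV. inner (v i) y))) * indicator {y. \<forall>i. inner (v i) y \<ge> 0} y \<partial>lborel)
      = (\<integral>\<^sup>+y. ?f (?R y) \<partial>lborel)" by simp
  also have "\<dots> = (\<integral>\<^sup>+s. ?f s \<partial>distr lborel borel ?R)"
    by (subst nn_integral_distr) auto
  also have "\<dots> = (\<integral>\<^sup>+s. ?f s \<partial>lborel)" by (simp only: lborel_distr_orthonormal[OF v])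
  also have "\<dots> = (\<Prod>i\<in>(UNIV :: 'm set). \<integral>\<^sup>+t. exponential_density 1 t \<partial>lborel)"
    by (rule nn_integral_lborel_prod_cart) auto
  also have "(\<integral>\<^sup>+t. exponential_density 1 t \<partial>lborel) = 1"
    using prob_space.emeasure_space_1[OF prob_space_exponential_density[of 1]] by (simp add: emeasure_density)
  finally show ?thesis by simp
qed

text \<open>On the rotated box the exponential is at least its value at the upper corner
  \<open>b\<close>. The lemma serves to bound the mass of a cap from below.\<close>

lemma nn_integral_exp_rotated_box_ge:
  fixes v :: "'m::{finite,wellorder} \<Rightarrow> real ^ 'm::_"
  assumes v: "\<And>i j. inner (v i) (v j) = (if i = j then 1 else 0)"
    and ab: "\<And>i. a i \<le> b i"
    and D: "\<And>y. (\<And>i. a i < inner (v i) y \<and> inner (v i) y < b i) \<Longrightarrow> y \<in> D"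
  shows "ennreal (exp (- (\<Sum>i\<in>UNIV. b i)) * (\<Prod>i\<in>UNIV. b i - a i))
    \<le> (\<integral>\<^sup>+y. ennreal (exp (- (\<Sum>i\<in>UNIV. inner (v i) y))) * indicator D y \<partial>lborel)"
proof -
  let ?R = "\<lambda>y :: real ^ 'm::_. \<chi> i. inner (v i) y"
  let ?B = "box (\<chi> i. a i) (\<chi> i. b i) :: (real ^ 'm::_) set"
  have [measurable]: "?R \<in> borel_measurable borel"
    by (rule borel_measurable_continuous_onI) (intro continuous_intros)
  have Basis: "Basis = range (\<lambda>i. axis i 1 :: real ^ 'm::_)" by (auto simp: Basis_vec_def)
  have inj: "inj (\<lambda>i. axis i 1 :: real ^ 'm::_)" by (auto simp: inj_def axis_eq_axis)
  have "emeasure lborel ?B = ennreal (\<Prod>i\<in>UNIV. b i - a i)"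
    using ab by (subst emeasure_lborel_box) (auto simp: Basis prod.reindex[OF inj] inner_axis)
  moreover have "(\<Prod>i\<in>UNIV. b i - a i) \<ge> 0" using ab by (intro prod_nonneg) auto
  ultimately have "ennreal (exp (- (\<Sum>i\<in>UNIV. b i)) * (\<Prod>i\<in>UNIV. b i - a i))
      = ennreal (exp (- (\<Sum>i\<in>UNIV. b i))) * emeasure lborel ?B"
    by (simp add: ennreal_mult)
  also have "emeasure lborel ?B = emeasure (distr lborel borel ?R) ?B"
    by (simp only: lborel_distr_orthonormal[OF v])
  also have "\<dots> = emeasure lborel (?R -` ?B)" by (simp add: emeasure_distr)
  also have "ennreal (exp (- (\<Sum>i\<in>UNIV. b i))) * \<dots>
      = (\<integral>\<^sup>+y. ennreal (exp (- (\<Sum>i\<in>UNIV. b i))) * indicator (?R -` ?B) y \<partial>lborel)"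
    using measurable_sets_borel[of ?R borel ?B] by (simp add: nn_integral_cmult_indicator)
  also have "\<dots> \<le> (\<integral>\<^sup>+y. ennreal (exp (- (\<Sum>i\<in>UNIV. inner (v i) y))) * indicator D y \<partial>lborel)"
  proof (intro nn_integral_mono)
    fix y
    show "ennreal (exp (- (\<Sum>i\<in>UNIV. b i))) * indicator (?R -` ?B) y
      \<le> ennreal (exp (- (\<Sum>i\<in>UNIV. inner (v i) y))) * indicator D y"
    proof (cases "y \<in> ?R -` ?B")
      case True
      then have y: "a i < inner (v i) y" "inner (v i) y < b i" for i by (auto simp: mem_box_cart)
      then have "y \<in> D" by (intro D) auto
      moreover have "(\<Sum>i\<in>UNIV. inner (v i) y) \<le> (\<Sum>i\<in>UNIV. b i)"
        using y by (intro sum_mono) (auto simp: less_imp_le)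
      ultimately show ?thesis using True by (simp add: ennreal_leI)
    qed simp
  qed
  finally show ?thesis .
qed

section \<open>Splitting a vector into a height, indexed by \<open>None\<close>, and a horizontal
  part\<close>

definition lift_dir :: "'n option \<Rightarrow> ('n::finite) lift_index"
  where "lift_dir = (SOME f. bij f)"

lemma bij_lift_dir: "bij (lift_dir :: 'n option \<Rightarrow> ('n::finite) lift_index)"
proof -
  have "CARD('n option) = CARD('n lift_index)" by (simp add: card_lift_index)
  then have "\<exists>f :: 'n option \<Rightarrow> 'n lift_index. bij f"
    using finite_same_card_bij[of "UNIV :: 'n option set" "UNIV :: 'n lift_index set"] by auto
  then show ?thesis unfolding lift_dir_def by (rule someI_ex)
qed

lemma sum_lift_index:
  "(\<Sum>k\<in>UNIV. g k) = g (lift_dir None) + (\<Sum>i\<in>(UNIV :: ('n::finite) set). g (lift_dir (Some i)))"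
proof -
  have "(\<Sum>k\<in>UNIV. g k) = (\<Sum>p\<in>(UNIV :: 'n option set). g (lift_dir p))"
    using sum.reindex_bij_betw[OF bij_lift_dir, of g] by simp
  then show ?thesis by (simp add: UNIV_option_conv sum.reindex)
qed

lemma prod_lift_index:
  "(\<Prod>k\<in>UNIV. g k) = g (lift_dir None) * (\<Prod>i\<in>(UNIV :: ('n::finite) set). g (lift_dir (Some i)))"
proof -
  have "(\<Prod>k\<in>UNIV. g k) = (\<Prod>p\<in>(UNIV :: 'n option set). g (lift_dir p))"
    using prod.reindex_bij_betw[OF bij_lift_dir, of g] by simp
  then show ?thesis by (simp add: UNIV_option_conv prod.reindex)
qed

definition lift_vec :: "real \<Rightarrow> real ^ 'n::finite \<Rightarrow> real ^ 'n lift_index"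
  where "lift_vec a x = (\<chi> k. case inv lift_dir k of None \<Rightarrow> a | Some i \<Rightarrow> x $ i)"

lemma lift_vec_nth [simp]:
  "lift_vec a x $ lift_dir None = a" "lift_vec a x $ lift_dir (Some i) = x $ i"
  by (simp_all add: lift_vec_def bij_lift_dir[THEN bij_is_inj, THEN inv_f_f])

lemma inner_lift_vec: "inner (lift_vec a x) (lift_vec b y) = a * b + inner x y"
  by (simp add: inner_vec_def sum_lift_index)

lemma lift_vec_eqI: "(\<And>p. y $ lift_dir p = z $ lift_dir p) \<Longrightarrow> y = z"
  using bij_lift_dir[THEN bij_is_surj] by (metis surjD vec_eq_iff)

lemma lift_vec_scaleR: "r *\<^sub>R lift_vec a x = lift_vec (r * a) (r *\<^sub>R x)"
  by (rule lift_vec_eqI) (case_tac p, auto)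

lemma lift_vec_sum: "(\<Sum>i\<in>I. lift_vec (a i) (x i)) = lift_vec (\<Sum>i\<in>I. a i) (\<Sum>i\<in>I. x i)"
  by (rule lift_vec_eqI) (case_tac p, auto)

lemma lift_vec_cases: obtains a x where "y = lift_vec a x"
proof
  show "y = lift_vec (y $ lift_dir None) (\<chi> i. y $ lift_dir (Some i))"
    by (rule lift_vec_eqI) (case_tac p, auto)
qed

lemma lift_vec_eq_iff: "lift_vec a x = lift_vec b y \<longleftrightarrow> a = b \<and> x = y"
proof
  assume *: "lift_vec a x = lift_vec b y"
  show "a = b \<and> x = y"
    using arg_cong[OF *, of "\<lambda>z. z $ lift_dir None"] arg_cong[OF *, of "\<lambda>z. z $ lift_dir (Some i)" for i]
    by (auto simp: vec_eq_iff)
qed simp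

lemma lift_vec_measurable [measurable]: "(\<lambda>(a, x). lift_vec a x) \<in> borel_measurable borel"
proof (rule borel_measurable_continuous_onI)
  have "continuous_on UNIV (\<lambda>p :: real \<times> (real ^ 'n). \<chi> k. case inv lift_dir k of None \<Rightarrow> fst p | Some i \<Rightarrow> snd p $ i)"
  proof (intro continuous_on_vec_lambda)
    fix k :: "'n lift_index"
    show "continuous_on UNIV (\<lambda>p :: real \<times> (real ^ 'n). case inv lift_dir k of None \<Rightarrow> fst p | Some i \<Rightarrow> snd p $ i)"
      by (cases "inv lift_dir k") (auto intro!: continuous_intros)
  qed
  then show "continuous_on UNIV (\<lambda>(a, x). lift_vec a (x :: real ^ 'n))"
    by (simp add: lift_vec_def[abs_def] case_prod_beta')
qed

lemma lborel_distr_lift_vec: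
  "distr (lborel \<Otimes>\<^sub>M lborel) borel (\<lambda>(a, x :: real ^ 'n::finite). lift_vec a x) = lborel"
proof (rule lborel_eqI[symmetric])
  fix l u :: "real ^ 'n lift_index" assume lu: "\<And>b. b \<in> Basis \<Longrightarrow> l \<bullet> b \<le> u \<bullet> b"
  have lu': "l $ k \<le> u $ k" for k
    using lu[of "axis k 1"] by (simp add: inner_axis axis_in_Basis_iff)
  obtain l0 l1 where l: "l = lift_vec l0 l1" by (rule lift_vec_cases)
  obtain u0 u1 where u: "u = lift_vec u0 u1" by (rule lift_vec_cases)
  have le0: "l0 \<le> u0" and le1: "l1 $ i \<le> u1 $ i" for i
    using lu'[of "lift_dir None"] lu'[of "lift_dir (Some i)"] by (auto simp: l u)
  have all: "(\<forall>k. P k) \<longleftrightarrow> P (lift_dir None) \<and> (\<forall>i. P (lift_dir (Some i)))" for P :: "'n lift_index \<Rightarrow> bool"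
  proof -
    have "(\<forall>k. P k) \<longleftrightarrow> (\<forall>p. P (lift_dir p))"
      using surj_f_inv_f[OF bij_lift_dir[THEN bij_is_surj]] by metis
    then show ?thesis by (simp add: split_option_all)
  qed
  have pre: "(\<lambda>(a, x). lift_vec a x) -` box l u = {l0<..<u0} \<times> box l1 u1"
    by (auto simp: mem_box_cart all l u)
  have "emeasure (distr (lborel \<Otimes>\<^sub>M lborel) borel (\<lambda>(a, x). lift_vec a x)) (box l u)
      = emeasure (lborel \<Otimes>\<^sub>M lborel) ({l0<..<u0} \<times> box l1 u1)"
    by (subst emeasure_distr) (auto simp: pre lborel_prod)
  also have "\<dots> = ennreal (u0 - l0) * ennreal (\<Prod>b\<in>Basis. (u1 - l1) \<bullet> b)"
  proof -
    have "emeasure lborel (box l1 u1) = ennreal (\<Prod>b\<in>Basis. (u1 - l1) \<bullet> b)"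
      using le1 by (intro emeasure_lborel_box) (auto simp: Basis_vec_def inner_axis)
    then show ?thesis using le0 by (subst lborel.emeasure_pair_measure_Times) auto
  qed
  also have "\<dots> = ennreal ((u0 - l0) * (\<Prod>i\<in>UNIV. (u1 - l1) $ i))"
    unfolding prod_Basis_cart using le0 le1 by (intro ennreal_mult[symmetric] prod_nonneg) auto
  also have "(u0 - l0) * (\<Prod>i\<in>UNIV. (u1 - l1) $ i) = (\<Prod>b\<in>Basis. (u - l) \<bullet> b)"
    unfolding prod_Basis_cart by (simp add: prod_lift_index l u)
  finally show "emeasure (distr (lborel \<Otimes>\<^sub>M lborel) borel (\<lambda>(a, x). lift_vec a x)) (box l u)
      = (\<Prod>b\<in>Basis. (u - l) \<bullet> b)" .
qed simp

text \<open>The cone over \<open>sqrt n *\<^sub>R A\<close>; with this scaling the lift of \<open>{x. inner x u \<le> 1}\<close> is the half-space whose inner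
  normal is the unit vector \<open>lift_unit u\<close> below.\<close>

definition lift_cone :: "(real ^ 'n::finite) set \<Rightarrow> (real ^ 'n lift_index) set"
  where "lift_cone A = {lift_vec t x | t x. t > 0 \<and> (sqrt (real CARD('n)) / t) *\<^sub>R x \<in> A}"

lemma lift_vec_in_lift_cone:
  fixes x :: "real ^ 'n::finite"
  shows "lift_vec t x \<in> lift_cone A \<longleftrightarrow> t > 0 \<and> (sqrt (real CARD('n)) / t) *\<^sub>R x \<in> A"
  by (auto simp: lift_cone_def lift_vec_eq_iff)

lemma lift_cone_borel:
  fixes A :: "(real ^ 'n::finite) set"
  assumes [measurable]: "A \<in> sets borel"
  shows "lift_cone A \<in> sets borel"
proof -
  have [measurable]: "(\<lambda>y :: real ^ 'n lift_index. (\<chi> i. y $ lift_dir (Some i)) :: real ^ 'n) \<in> borel_measurable borel"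
    "(\<lambda>y :: real ^ 'n lift_index. y $ lift_dir None) \<in> borel_measurable borel"
    by (rule borel_measurable_continuous_onI, intro continuous_intros)+
  have "lift_cone A = {y \<in> space borel. 0 < y $ lift_dir None
      \<and> (sqrt (real CARD('n)) / y $ lift_dir None) *\<^sub>R (\<chi> i. y $ lift_dir (Some i)) \<in> A}"
  proof (rule set_eqI)
    fix y :: "real ^ 'n lift_index"
    show "y \<in> lift_cone A \<longleftrightarrow> y \<in> {y \<in> space borel. 0 < y $ lift_dir None
      \<and> (sqrt (real CARD('n)) / y $ lift_dir None) *\<^sub>R (\<chi> i. y $ lift_dir (Some i)) \<in> A}"
      by (cases y rule: lift_vec_cases) (simp add: lift_vec_in_lift_cone)
  qed
  also have "\<dots> \<in> sets borel" by measurable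
  finally show ?thesis .
qed

text \<open>The slice of \<open>lift_cone A\<close> at height \<open>t\<close> is \<open>A\<close>
  scaled by t / sqrt n, so that integrating over the heights produces this factor. Its value is left
  implicit and is pinned down by \<open>slice_const_hull_body\<close>.\<close>

definition slice_const :: "'n::finite itself \<Rightarrow> ennreal"
  where "slice_const _ = (\<integral>\<^sup>+t. ennreal (exp (- sqrt (real CARD('n) + 1) * t) * (t / sqrt (real CARD('n))) ^ CARD('n)) * indicator {0<..} t \<partial>lborel)"

lemma emeasure_lborel_vimage_scaleR:
  fixes A :: "'a::euclidean_space set"
  assumes "s > 0" and [measurable]: "A \<in> sets borel"
  shows "emeasure lborel ((\<lambda>x. s *\<^sub>R x) -` A) = ennreal ((1 / s) ^ DIM('a)) * emeasure lborel A"
proof -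
  have "emeasure lborel A = emeasure (density (distr lborel borel (\<lambda>x. 0 + s *\<^sub>R x)) (\<lambda>_. \<bar>s\<bar> ^ DIM('a))) A"
    using lborel_affine[of s "0 :: 'a"] assms(1) by simp
  also have "\<dots> = ennreal (s ^ DIM('a)) * emeasure lborel ((\<lambda>x. s *\<^sub>R x) -` A)"
    using assms(1) by (simp add: emeasure_density nn_integral_cmult emeasure_distr)
  finally have "ennreal ((1 / s) ^ DIM('a)) * emeasure lborel A
      = ennreal ((1 / s) ^ DIM('a) * s ^ DIM('a)) * emeasure lborel ((\<lambda>x. s *\<^sub>R x) -` A)"
    using assms(1) by (simp add: ennreal_mult mult.assoc)
  also have "(1 / s) ^ DIM('a) * s ^ DIM('a) = 1"
    using assms(1) by (simp add: power_one_over)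
  finally show ?thesis by simp
qed

lemma nn_integral_lift_cone:
  fixes A :: "(real ^ 'n::finite) set"
  assumes A [measurable]: "A \<in> sets borel"
  shows "(\<integral>\<^sup>+y. ennreal (exp (- sqrt (real CARD('n) + 1) * inner (lift_vec 1 0) y)) * indicator (lift_cone A) y \<partial>lborel)
    = slice_const TYPE('n) * emeasure lborel A"
proof -
  let ?s = "sqrt (real CARD('n))" and ?w = "\<lambda>t. ennreal (exp (- sqrt (real CARD('n) + 1) * t))"
  have s: "?s > 0" by simp
  let ?F = "\<lambda>y. ennreal (exp (- sqrt (real CARD('n) + 1) * inner (lift_vec 1 0) y)) * indicator (lift_cone A) y"
  let ?G = "\<lambda>(t, x). ?w t * (indicator {0<..} t * indicator ((\<lambda>x. (?s / t) *\<^sub>R x) -` A) x)"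
  have FG: "?F (lift_vec t x) = ?G (t, x)" for t and x :: "real ^ 'n"
    by (auto simp: inner_lift_vec lift_vec_in_lift_cone indicator_def)
  have G_eq: "?G = (\<lambda>p. ?w (fst p) * indicator {p. fst p > 0 \<and> (?s / fst p) *\<^sub>R snd p \<in> A} p)"
    by (auto simp: indicator_def fun_eq_iff)
  have Gm [measurable]: "?G \<in> borel_measurable (lborel \<Otimes>\<^sub>M lborel)"
    unfolding G_eq by measurable
  have [measurable]: "lift_cone A \<in> sets borel" by (rule lift_cone_borel[OF A])
  have "(\<integral>\<^sup>+y. ?F y \<partial>lborel) = (\<integral>\<^sup>+y. ?F y \<partial>distr (lborel \<Otimes>\<^sub>M lborel) borel (\<lambda>(a, x). lift_vec a x))"
    by (simp only: lborel_distr_lift_vec)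
  also have "\<dots> = (\<integral>\<^sup>+p. ?F (case p of (a, x) \<Rightarrow> lift_vec a x) \<partial>(lborel \<Otimes>\<^sub>M lborel))"
    by (subst nn_integral_distr) (auto simp: lborel_prod)
  also have "\<dots> = (\<integral>\<^sup>+p. ?G p \<partial>(lborel \<Otimes>\<^sub>M lborel))"
    using FG by (intro nn_integral_cong) auto
  also have "\<dots> = (\<integral>\<^sup>+t. \<integral>\<^sup>+x. ?G (t, x) \<partial>lborel \<partial>lborel)"
    by (rule lborel.nn_integral_fst[symmetric, OF Gm])
  also have "\<dots> = (\<integral>\<^sup>+t. ennreal (exp (- sqrt (real CARD('n) + 1) * t) * (t / ?s) ^ CARD('n)) * indicator {0<..} t * emeasure lborel A \<partial>lborel)"
  proof (intro nn_integral_cong)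
    fix t :: real
    show "(\<integral>\<^sup>+x. ?G (t, x) \<partial>lborel) = ennreal (exp (- sqrt (real CARD('n) + 1) * t) * (t / ?s) ^ CARD('n)) * indicator {0<..} t * emeasure lborel A"
    proof (cases "t > 0")
      case True
      have [measurable]: "(\<lambda>x. (?s / t) *\<^sub>R x) -` A \<in> sets borel"
        using measurable_sets_borel[of "\<lambda>x. (?s / t) *\<^sub>R x" borel A] by simp
      have "(\<integral>\<^sup>+x. ?G (t, x) \<partial>lborel) = ?w t * emeasure lborel ((\<lambda>x. (?s / t) *\<^sub>R x) -` A)"
        using True by (simp add: nn_integral_cmult_indicator)
      also have "\<dots> = ?w t * (ennreal ((t / ?s) ^ CARD('n)) * emeasure lborel A)"
        using True s by (subst emeasure_lborel_vimage_scaleR) auto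
      finally show ?thesis using True s by (simp add: ennreal_mult mult.assoc)
    qed simp
  qed
  also have "\<dots> = slice_const TYPE('n) * emeasure lborel A"
    unfolding slice_const_def by (rule nn_integral_multc) measurable
  finally show ?thesis .
qed

text \<open>The proportion of height to horizontal part is the one for which unit vectors with inner
  product -1/n, as between contact points of a regular simplex, get orthogonal lifts.\<close>

definition lift_unit :: "real ^ 'n::finite \<Rightarrow> real ^ 'n lift_index"
  where "lift_unit u = lift_vec (1 / sqrt (real CARD('n) + 1)) (- (sqrt (real CARD('n)) / sqrt (real CARD('n) + 1)) *\<^sub>R u)"

lemma inner_lift_unit:
  fixes u v :: "real ^ 'n::finite"
  shows "inner (lift_unit u) (lift_unit v) = (1 + real CARD('n) * inner u v) / (real CARD('n) + 1)"
  by (simp add: lift_unit_def inner_lift_vec add_divide_distrib)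

lemma inner_lift_unit_axis:
  fixes u :: "real ^ 'n::finite"
  shows "inner (lift_unit u) (lift_vec 1 0) = 1 / sqrt (real CARD('n) + 1)"
  by (simp add: lift_unit_def inner_lift_vec)

lemma inner_lift_unit_lift_vec:
  fixes u :: "real ^ 'n::finite"
  assumes "t > 0"
  shows "inner (lift_unit u) (lift_vec t x)
    = t / sqrt (real CARD('n) + 1) * (1 - inner ((sqrt (real CARD('n)) / t) *\<^sub>R x) u)"
  using assms by (simp add: lift_unit_def inner_lift_vec inner_commute field_simps)

subsection \<open>Regular simplices\<close>

text \<open>This Gram matrix determines the contact points of a regular circumscribed simplex up to
  an isometry. The index type \<open>'n option\<close> supplies n + 1 labels and is matched with the
  lifted coordinates by \<open>lift_dir\<close>.\<close>

locale simplex_normals =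
  fixes p :: "'n::finite option \<Rightarrow> real ^ 'n"
  assumes gram: "inner (p a) (p b) = (if a = b then 1 else - 1 / real CARD('n))"
begin

lemma norm_p: "norm (p a) = 1"
  using gram[of a a] by (simp add: norm_eq_sqrt_inner)

lemma inj_p: "inj p"
proof (rule injI, rule ccontr)
  fix a b assume "p a = p b" "a \<noteq> b"
  then have "1 = - 1 / real CARD('n)" using gram[of a a] gram[of a b] by simp
  then show False by (simp add: field_simps)
qed

lemma orthonormal_lift_unit:
  "inner (lift_unit (p (inv lift_dir k))) (lift_unit (p (inv lift_dir l))) = (if k = l then 1 else 0)"
proof (cases "k = l")
  case True
  then show ?thesis by (simp add: inner_lift_unit gram)
next
  case False
  then have "inv lift_dir k \<noteq> inv lift_dir l"
    using bij_imp_bij_inv[OF bij_lift_dir] by (auto dest!: bij_is_inj injD)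
  then show ?thesis using False by (simp add: inner_lift_unit gram)
qed

lemma sum_option_lift_index: "(\<Sum>k\<in>UNIV. g (inv lift_dir k)) = (\<Sum>a\<in>(UNIV :: 'n option set). g a)"
  by (rule sum.reindex_bij_betw[OF bij_imp_bij_inv[OF bij_lift_dir]])

lemma parseval_lift:
  "(\<Sum>a\<in>UNIV. (t - sqrt (real CARD('n)) * inner (p a) x)\<^sup>2) = (real CARD('n) + 1) * (t\<^sup>2 + (norm x)\<^sup>2)"
proof -
  let ?N = "real CARD('n) + 1"
  have eq: "(inner (lift_unit (p a)) (lift_vec t x))\<^sup>2 = (t - sqrt (real CARD('n)) * inner (p a) x)\<^sup>2 / ?N" for a
  proof -
    have "inner (lift_unit (p a)) (lift_vec t x) = (t - sqrt (real CARD('n)) * inner (p a) x) / sqrt ?N"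
      by (simp add: lift_unit_def inner_lift_vec diff_divide_distrib)
    then show ?thesis by (simp add: power_divide)
  qed
  have "(\<Sum>a\<in>UNIV. (inner (lift_unit (p a)) (lift_vec t x))\<^sup>2) = (norm (lift_vec t x))\<^sup>2"
    using orthonormal_parseval[OF orthonormal_lift_unit, of "lift_vec t x"]
    by (simp add: sum_option_lift_index[of "\<lambda>a. (inner (lift_unit (p a)) (lift_vec t x))\<^sup>2"])
  also have "\<dots> = t\<^sup>2 + (norm x)\<^sup>2"
    by (simp add: power2_norm_eq_inner inner_lift_vec power2_eq_square[of t])
  finally show ?thesis by (simp add: eq sum_divide_distrib[symmetric] field_simps)
qed

lemma parseval_p: "real CARD('n) * (\<Sum>a\<in>UNIV. (inner (p a) x)\<^sup>2) = (real CARD('n) + 1) * (norm x)\<^sup>2"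
  using parseval_lift[of 0 x] by (simp add: power_mult_distrib sum_distrib_left)

lemma sum_p: "(\<Sum>a\<in>UNIV. p a) = 0"
proof -
  have "inner (p b) (\<Sum>a\<in>UNIV. p a) = 0" for b
  proof -
    have "inner (p b) (\<Sum>a\<in>UNIV. p a) = inner (p b) (p b) + (\<Sum>a\<in>UNIV - {b}. inner (p b) (p a))"
      unfolding inner_sum_right by (rule sum.remove) auto
    also have "(\<Sum>a\<in>UNIV - {b}. inner (p b) (p a)) = (\<Sum>a\<in>UNIV - {b}. - 1 / real CARD('n))"
      by (intro sum.cong) (auto simp: gram)
    also have "\<dots> = - 1" by (simp add: card_Diff_singleton)
    finally show ?thesis by (simp add: gram)
  qed
  then have "inner (\<Sum>a\<in>UNIV. p a) (\<Sum>a\<in>UNIV. p a) = 0"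
    by (subst inner_sum_left) simp
  then show ?thesis by simp
qed

lemma frame_p_inner:
  "real CARD('n) * (\<Sum>a\<in>UNIV. inner (p a) x * inner (p a) y) = (real CARD('n) + 1) * inner x y"
proof -
  let ?S = "\<lambda>x. \<Sum>a\<in>UNIV. (inner (p a) x)\<^sup>2"
  have "?S (x + y) = ?S x + ?S y + 2 * (\<Sum>a\<in>UNIV. inner (p a) x * inner (p a) y)"
    by (simp add: inner_add_right power2_sum sum.distrib sum_distrib_left mult.assoc)
  moreover have "(norm (x + y))\<^sup>2 = (norm x)\<^sup>2 + (norm y)\<^sup>2 + 2 * inner x y"
    by (simp add: power2_norm_eq_inner inner_add_left inner_add_right inner_commute)
  ultimately show ?thesis
    using parseval_p[of x] parseval_p[of y] parseval_p[of "x + y"] by (simp add: algebra_simps)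
qed

lemma frame_p: "(\<Sum>a\<in>UNIV. inner (p a) x *\<^sub>R p a) = ((real CARD('n) + 1) / real CARD('n)) *\<^sub>R x"
proof -
  have "inner (\<Sum>a\<in>UNIV. inner (p a) x *\<^sub>R p a) y = inner (((real CARD('n) + 1) / real CARD('n)) *\<^sub>R x) y" for y
    using frame_p_inner[of x y] by (simp add: inner_sum_left field_simps)
  then show ?thesis using vector_eq_rdot by blast
qed

section \<open>The simplex with given unit normals: vertices, facets, contact points\<close>

definition hull_body :: "(real ^ 'n) set"
  where "hull_body = {x. \<forall>a. inner x (p a) \<le> 1}"

definition vertex :: "'n option \<Rightarrow> real ^ 'n"
  where "vertex a = - real CARD('n) *\<^sub>R p a"

lemma inner_vertex: "inner (vertex b) (p a) = (if a = b then - real CARD('n) else 1)"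
  by (simp add: vertex_def gram)

lemma inj_vertex: "inj vertex"
  using inj_p by (auto simp: inj_def vertex_def)

lemma hull_body_eq: "hull_body = convex hull (range vertex)"
proof
  have "convex hull_body"
    unfolding hull_body_def Collect_all_eq by (subst inner_commute) (intro convex_INT ballI convex_halfspace_le)
  moreover have "range vertex \<subseteq> hull_body"
    by (auto simp: hull_body_def inner_vertex)
  ultimately show "convex hull (range vertex) \<subseteq> hull_body" by (rule hull_minimal[rotated])
  show "hull_body \<subseteq> convex hull (range vertex)"
  proof
    fix x assume x: "x \<in> hull_body"
    \<comment> \<open>Barycentric coordinates: the distance of \<open>x\<close> from facet
      \<open>a\<close>, divided by the distance n + 1 of the opposite vertex from it.\<close>
    let ?l = "\<lambda>a. (1 - inner x (p a)) / (real CARD('n) + 1)"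
    have "(\<Sum>a\<in>UNIV. inner x (p a)) = 0" using sum_p by (simp add: inner_sum_right[symmetric])
    then have "(\<Sum>a\<in>UNIV. ?l a) = 1"
      by (simp add: sum_divide_distrib[symmetric] sum_subtractf)
    moreover have "?l a \<ge> 0" for a using x by (simp add: hull_body_def)
    ultimately have "(\<Sum>a\<in>UNIV. ?l a *\<^sub>R vertex a) \<in> convex hull (range vertex)"
      by (intro convex_sum) (auto simp: hull_inc)
    also have "(\<Sum>a\<in>UNIV. ?l a *\<^sub>R vertex a)
        = (real CARD('n) / (real CARD('n) + 1)) *\<^sub>R ((\<Sum>a\<in>UNIV. inner (p a) x *\<^sub>R p a) - (\<Sum>a\<in>UNIV. p a))"
      unfolding sum_subtractf[symmetric] scaleR_sum_right
    proof (intro sum.cong refl)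
      fix a
      have "inner (p a) x *\<^sub>R p a - p a = (inner (p a) x - 1) *\<^sub>R p a" by (simp add: scaleR_diff_left)
      moreover have "?l a * - real CARD('n) = real CARD('n) / (real CARD('n) + 1) * (inner (p a) x - 1)"
        by (simp add: inner_commute field_simps)
      ultimately show "?l a *\<^sub>R vertex a
          = (real CARD('n) / (real CARD('n) + 1)) *\<^sub>R (inner (p a) x *\<^sub>R p a - p a)"
        unfolding vertex_def by (simp only: scaleR_scaleR)
    qed
    also have "\<dots> = x" by (simp add: frame_p sum_p)
    finally show "x \<in> convex hull (range vertex)" .
  qed
qed

lemma card_range_vertex: "card (range vertex) = CARD('n) + 1"
  using card_image[OF inj_vertex] by simp

lemma vertex_affine_independent: "\<not> affine_dependent (range vertex)"
proof
  assume "affine_dependent (range vertex)"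
  then obtain U where U: "sum U (range vertex) = 0" "\<exists>v\<in>range vertex. U v \<noteq> 0"
    "(\<Sum>v\<in>range vertex. U v *\<^sub>R v) = 0"
    by (auto simp: affine_dependent_explicit_finite)
  have 1: "(\<Sum>a\<in>UNIV. U (vertex a)) = 0" using U(1) by (simp add: sum.reindex[OF inj_vertex])
  have 2: "(\<Sum>a\<in>UNIV. U (vertex a) *\<^sub>R vertex a) = 0" using U(3) by (simp add: sum.reindex[OF inj_vertex])
  have "U (vertex b) = 0" for b
  proof -
    have "0 = (\<Sum>a\<in>UNIV. U (vertex a) * inner (vertex a) (p b))"
      using arg_cong[OF 2, of "\<lambda>z. inner z (p b)"] by (simp add: inner_sum_left)
    also have "\<dots> = (\<Sum>a\<in>UNIV. U (vertex a) - (if a = b then (real CARD('n) + 1) * U (vertex b) else 0))"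
      by (intro sum.cong) (auto simp: inner_vertex algebra_simps)
    also have "\<dots> = - (real CARD('n) + 1) * U (vertex b)"
      using 1 by (simp add: sum_subtractf algebra_simps)
    finally show ?thesis by (simp add: add_nonneg_eq_0_iff)
  qed
  then show False using U(2) by auto
qed

lemma p_in_facet: "p a \<in> convex hull (range vertex - {vertex a})"
proof -
  have "p a = (\<Sum>b\<in>UNIV - {a}. (1 / real CARD('n)) *\<^sub>R vertex b)"
    using sum_p by (simp add: vertex_def sum_negf sum.remove[of UNIV a] add_eq_0_iff)
  also have "\<dots> \<in> convex hull (range vertex - {vertex a})"
    using inj_vertex by (intro convex_sum) (auto intro!: hull_inc simp: inj_def card_Diff_singleton)
  finally show ?thesis .
qed

lemma facet_in_hyperplane:
  assumes "x \<in> convex hull (range vertex - {vertex a})"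
  shows "inner x (p a) = 1"
proof -
  have "convex hull (range vertex - {vertex a}) \<subseteq> {x. inner (p a) x = 1}"
    by (intro hull_minimal convex_hyperplane) (auto simp: inner_vertex inner_commute[of "p a"])
  then show ?thesis using assms by (auto simp: inner_commute)
qed

lemma regular_simplex_hull_body: "regular_simplex hull_body"
  unfolding regular_simplex_def
proof
  show "int CARD('n) simplex hull_body"
    unfolding simplex_def using vertex_affine_independent card_range_vertex hull_body_eq by auto
  have "dist (vertex a) (vertex b) = sqrt (2 * real CARD('n) * (real CARD('n) + 1))" if "a \<noteq> b" for a b
  proof -
    have "(dist (vertex a) (vertex b))\<^sup>2 = 2 * real CARD('n) * (real CARD('n) + 1)"
      using that by (simp add: vertex_def dist_norm power2_norm_eq_inner inner_diff_left inner_diff_right gram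
          algebra_simps)
    then show ?thesis by (metis real_sqrt_unique zero_le_dist)
  qed
  note dist_vertex = this
  have "dist x y = sqrt (2 * real CARD('n) * (real CARD('n) + 1))"
    if xy: "x \<in> range vertex \<and> y \<in> range vertex \<and> x \<noteq> y" for x y
  proof -
    obtain a b where "x = vertex a" "y = vertex b" using xy by blast
    then show ?thesis using dist_vertex[of a b] xy by (cases "a = b") simp_all
  qed
  then show "\<exists>s. \<forall>x y. x extreme_point_of hull_body \<and> y extreme_point_of hull_body \<and> x \<noteq> y \<longrightarrow> dist x y = s"
    unfolding hull_body_eq extreme_point_of_convex_hull_affine_independent[OF vertex_affine_independent]
    by (intro exI[of _ "sqrt (2 * real CARD('n) * (real CARD('n) + 1))"] allI impI)
qed

lemma circumscribed_hull_body: "circumscribed hull_body"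
  unfolding circumscribed_def
proof (intro conjI allI impI)
  show "cball 0 1 \<subseteq> hull_body"
  proof
    fix x :: "real ^ 'n" assume "x \<in> cball 0 1"
    then have "inner x (p a) \<le> 1" for a
      using norm_cauchy_schwarz[of x "p a"] norm_p[of a] by simp
    then show "x \<in> hull_body" by (simp add: hull_body_def)
  qed
next
  fix F assume "F facet_of hull_body"
  then obtain a where F: "F = convex hull (range vertex - {vertex a})"
    unfolding hull_body_eq facet_of_convex_hull_affine_independent[OF vertex_affine_independent] by auto
  show "tangent_to_unit_ball F"
    unfolding tangent_to_unit_ball_def F
    using p_in_facet[of a] facet_in_hyperplane[of _ a] norm_p[of a] gram[of a a]
    by (intro bexI[of _ "p a"]) (auto simp: inner_diff_left)
qed

lemma contact_points_hull_body: "contact_points hull_body = range p"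
proof
  have eq: "hull_body = (\<Inter>a. {x. inner (p a) x \<le> 1})" by (auto simp: hull_body_def inner_commute)
  have closed: "closed hull_body" unfolding eq by (intro closed_INT ballI closed_halfspace_le)
  show "contact_points hull_body \<subseteq> range p"
  proof
    fix x assume "x \<in> contact_points hull_body"
    then have x: "x \<in> hull_body" "x \<notin> interior hull_body" "norm x = 1"
      using closed by (auto simp: contact_points_def frontier_def)
    have "open (\<Inter>a. {x. inner (p a) x < 1})" by (intro open_INT ballI open_halfspace_lt) auto
    then have "(\<Inter>a. {x. inner (p a) x < 1}) \<subseteq> interior hull_body"
      by (intro interior_maximal) (auto simp: eq less_imp_le)
    then obtain a where "inner (p a) x \<ge> 1" using x(2) by (force simp: not_less)
    then have "(norm (x - p a))\<^sup>2 \<le> 0"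
      using x(3) norm_p[of a]
      by (simp add: power2_norm_eq_inner inner_diff_left inner_diff_right inner_commute norm_eq_1)
    then show "x \<in> range p" by simp
  qed
  show "range p \<subseteq> contact_points hull_body"
  proof
    fix x assume "x \<in> range p"
    then obtain a where x: "x = p a" by auto
    have "- 1 \<le> (0 :: real)" "0 \<le> 1 / real CARD('n)" by auto
    then have "- 1 \<le> 1 / real CARD('n)" by linarith
    then have "p a \<in> hull_body" by (simp add: hull_body_def gram)
    moreover have "p a \<notin> interior hull_body"
    proof
      assume "p a \<in> interior hull_body"
      moreover have "interior hull_body \<subseteq> interior {x. inner (p a) x \<le> 1}"
        by (rule interior_mono) (auto simp: eq)
      moreover have "p a \<noteq> 0" using norm_p[of a] by auto
      ultimately have "inner (p a) (p a) < 1" by (auto simp: interior_halfspace_le)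
      then show False by (simp add: gram)
    qed
    ultimately show "x \<in> contact_points hull_body"
      using x norm_p[of a] closure_subset[of hull_body] by (auto simp: contact_points_def frontier_def)
  qed
qed

end

text \<open>Equal edge lengths determine the Gram matrix of the vertices about their centroid
  \<open>g\<close>, and the negative vertices, normalized, are then simplex normals
  \<open>p\<close>. Tangency puts every facet at distance 1 from the origin, which forces
  \<open>g = 0\<close> and circumradius n.\<close>

lemma regular_simplex_circumscribed_normals:
  fixes T :: "(real ^ 'n::finite) set"
  assumes reg: "regular_simplex T" and circ: "circumscribed T"
  obtains p :: "'n option \<Rightarrow> real ^ 'n" where "simplex_normals p" "T = simplex_normals.hull_body p"
proof -
  let ?n = "real CARD('n)"
  have n: "?n > 0" by simp
  obtain C where C: "\<not> affine_dependent C" "int (card C) = int CARD('n) + 1" "T = convex hull C"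
    using reg by (auto simp: regular_simplex_def simplex_def)
  have finC: "finite C" using C(1) by (rule aff_independent_finite)
  have "card C = CARD('n option)" using C(2) by simp
  then obtain c where c: "bij_betw c (UNIV :: 'n option set) C"
    using finite_same_card_bij[OF finite_class.finite_UNIV finC] by metis
  have rC: "C = range c" and injc: "inj c" using c by (auto simp: bij_betw_def)
  obtain s where "\<And>x y. x \<in> C \<Longrightarrow> y \<in> C \<Longrightarrow> x \<noteq> y \<Longrightarrow> dist x y = s"
    using reg C extreme_point_of_convex_hull_affine_independent[OF C(1)] by (auto simp: regular_simplex_def)
  then have s: "dist (c a) (c b) = s" if "a \<noteq> b" for a b
    using that injc by (auto simp: rC inj_def)
  have s0: "s > 0"
    using s[of None "Some undefined"] injc zero_less_dist_iff[of "c None" "c (Some undefined)"] by (auto simp: inj_def)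
  define g where "g = (1 / (?n + 1)) *\<^sub>R (\<Sum>a\<in>UNIV. c a)"
  define q where "q a = c a - g" for a
  have sum_q: "(\<Sum>a\<in>UNIV. q a) = 0"
  proof -
    have "(\<Sum>a\<in>(UNIV :: 'n option set). g) = (?n + 1) *\<^sub>R g"
      by (simp only: sum_constant_scaleR) (simp add: add.commute)
    also have "\<dots> = (\<Sum>a\<in>UNIV. c a)" using n by (simp add: g_def)
    finally show ?thesis by (simp add: q_def sum_subtractf)
  qed
  define W where "W = (\<Sum>b\<in>UNIV. inner (q b) (q b))"
  have dist_q: "inner (q a) (q a) + inner (q b) (q b) - 2 * inner (q a) (q b) = (if a = b then 0 else s\<^sup>2)" for a b
  proof -
    have "(dist (c a) (c b))\<^sup>2 = inner (q a - q b) (q a - q b)"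
      by (simp add: q_def dist_norm power2_norm_eq_inner)
    also have "\<dots> = inner (q a) (q a) + inner (q b) (q b) - 2 * inner (q a) (q b)"
      by (simp add: inner_diff_left inner_diff_right inner_commute)
    finally show ?thesis using s[of a b] by (cases "a = b") auto
  qed
  \<comment> \<open>Summation over the second vertex removes the mixed products, because the
    \<open>q b\<close> sum to 0; hence all \<open>q a\<close> have the same norm.\<close>
  have row: "(?n + 1) * inner (q a) (q a) + W = ?n * s\<^sup>2" for a
  proof -
    have "(\<Sum>b\<in>UNIV. inner (q a) (q a) + inner (q b) (q b) - 2 * inner (q a) (q b)) = (\<Sum>b\<in>UNIV. if a = b then 0 else s\<^sup>2)"
      by (simp only: dist_q)
    also have "\<dots> = ?n * s\<^sup>2" by (simp add: sum.remove[of UNIV a] card_Diff_singleton)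
    also have "(\<Sum>b\<in>UNIV. inner (q a) (q a) + inner (q b) (q b) - 2 * inner (q a) (q b))
        = (?n + 1) * inner (q a) (q a) + W"
      using sum_q by (simp add: sum_subtractf sum.distrib W_def sum_distrib_left[symmetric] inner_sum_right[symmetric])
    finally show ?thesis .
  qed
  define Q where "Q = (?n * s\<^sup>2 - W) / (?n + 1)"
  have Qa: "inner (q a) (q a) = Q" for a
    using row[of a] by (simp add: Q_def field_simps)
  have "W = (?n + 1) * Q" by (simp add: W_def Qa algebra_simps)
  then have Qs: "2 * (?n + 1) * Q = ?n * s\<^sup>2" using row[of None] unfolding Qa by (simp add: algebra_simps)
  have "2 * (?n + 1) * Q > 0" unfolding Qs using s0 n by simp
  then have Q0: "Q > 0" using n by (simp add: zero_less_mult_iff)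
  have Qab: "inner (q a) (q b) = - Q / ?n" if "a \<noteq> b" for a b
  proof -
    have s2: "s\<^sup>2 = 2 * Q - 2 * inner (q a) (q b)" using dist_q[of a b] that by (simp add: Qa)
    have "2 * ?n * inner (q a) (q b) = 2 * ?n * Q - ?n * s\<^sup>2" unfolding s2 by (simp add: algebra_simps)
    also have "\<dots> = - 2 * Q" using Qs by (simp add: algebra_simps)
    finally show ?thesis using n by (simp add: field_simps)
  qed
  define r where "r = sqrt Q"
  have r: "r > 0" "r * r = Q" using Q0 by (auto simp: r_def)
  define p where "p a = (- 1 / r) *\<^sub>R q a" for a
  have "simplex_normals p"
  proof
    fix a b :: "'n option"
    show "inner (p a) (p b) = (if a = b then 1 else - 1 / real CARD('n))"
    proof -
      have "inner (p a) (p b) = inner (q a) (q b) / (r * r)" by (simp add: p_def)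
      then show ?thesis using r(2) Q0 Qa[of b] Qab[of a b] by (cases "a = b") simp_all
    qed
  qed
  then interpret simplex_normals p .
  have qp: "q a = - r *\<^sub>R p a" for a using r by (simp add: p_def)
  have gp_eq: "1 - inner g (p a) = r / ?n" for a
  proof -
    have "2 \<le> card C" using C(2) zero_less_card_finite[where 'a='n] by linarith
    moreover have "\<exists>u. u \<in> C \<and> convex hull (C - {c a}) = convex hull (C - {u})"
      by (rule exI[of _ "c a"]) (simp add: rC)
    ultimately have "convex hull (C - {c a}) facet_of T"
      unfolding C(3) by (intro iffD2[OF facet_of_convex_hull_affine_independent_alt[OF C(1)]] conjI)
    from circ[unfolded circumscribed_def, THEN conjunct2, rule_format, OF this]
    have "tangent_to_unit_ball (convex hull (C - {c a}))" .
    then obtain v where v1: "v \<in> convex hull (C - {c a}) \<inter> sphere 0 1"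
      and v2: "\<forall>x\<in>convex hull (C - {c a}). inner (x - v) v = 0"
      unfolding tangent_to_unit_ball_def by blast
    have v: "norm v = 1" using v1 by simp
    have cb: "inner (c b) v = 1" if "b \<noteq> a" for b
    proof -
      have "c b \<in> convex hull (C - {c a})" using that injc by (intro hull_inc) (auto simp: rC inj_def)
      from bspec[OF v2 this] v show ?thesis by (simp add: inner_diff_left dot_square_norm)
    qed
    have "0 \<in> T" using circ by (auto simp: circumscribed_def)
    \<comment> \<open>The origin lies in the simplex, so the vertex opposite the facet must lie
      strictly on the origin's side of the tangent hyperplane; this settles the sign of
      \<open>h\<close>.\<close>
    have ca: "inner (c a) v < 1"
    proof (rule ccontr)
      assume "\<not> inner (c a) v < 1"
      then have "inner v (c b) \<ge> 1" for b using cb[of b] by (cases "b = a") (auto simp: inner_commute)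
      then have "convex hull C \<subseteq> {x. inner v x \<ge> 1}"
        by (intro hull_minimal convex_halfspace_ge) (auto simp: rC)
      then show False using \<open>0 \<in> T\<close> C(3) by auto
    qed
    define h where "h = 1 - inner g v"
    have hb: "inner (q b) v = h" if "b \<noteq> a" for b using cb[OF that] by (simp add: q_def h_def inner_diff_left)
    have "(\<Sum>b\<in>UNIV. inner (q b) v) = 0" using sum_q by (simp add: inner_sum_left[symmetric])
    then have ha: "inner (q a) v = - ?n * h"
      by (simp add: sum.remove[of UNIV a] hb card_Diff_singleton)
    have "h > 0"
    proof -
      obtain b where b: "b \<noteq> a" by (cases a) auto
      have "inner (q a) v < inner (q b) v" using ca cb[OF b] by (simp add: q_def inner_diff_left)
      then have "0 < (?n + 1) * h" by (simp add: ha hb[OF b] algebra_simps)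
      then show ?thesis using n by (simp add: zero_less_mult_iff)
    qed
    have pv: "inner (p b) v = (if b = a then ?n * h / r else - h / r)" for b
      using ha hb by (simp add: p_def)
    \<comment> \<open>The inner products with \<open>v\<close> agree for all \<open>b\<close> other
      than \<open>a\<close>, and the constant part drops out of the expansion as the
      \<open>p b\<close> sum to 0. So \<open>v\<close> is a positive multiple of \<open>p a\<close>,
      and both are unit vectors.\<close>
    have "((?n + 1) / ?n) *\<^sub>R v = (\<Sum>b\<in>UNIV. inner (p b) v *\<^sub>R p b)" by (rule frame_p[symmetric])
    also have "\<dots> = (\<Sum>b\<in>UNIV. (- h / r) *\<^sub>R p b + (if b = a then ((?n + 1) * h / r) *\<^sub>R p a else 0))"
    proof (intro sum.cong refl)
      fix b
      have coef: "?n * h / r = - h / r + (?n + 1) * h / r"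
        by (simp add: add_divide_distrib[symmetric] algebra_simps)
      show "inner (p b) v *\<^sub>R p b = (- h / r) *\<^sub>R p b + (if b = a then ((?n + 1) * h / r) *\<^sub>R p a else 0)"
        unfolding pv coef by (cases "b = a") (simp_all add: scaleR_left_distrib scaleR_left_diff_distrib)
    qed
    also have "\<dots> = ((?n + 1) * h / r) *\<^sub>R p a"
      unfolding sum.distrib scaleR_sum_right[symmetric] sum_p by simp
    finally have eq: "((?n + 1) / ?n) *\<^sub>R v = ((?n + 1) * h / r) *\<^sub>R p a" .
    have n1: "?n + 1 \<noteq> 0" using n by linarith
    have "v = (?n / (?n + 1)) *\<^sub>R (((?n + 1) / ?n) *\<^sub>R v)" using n n1 by simp
    also have "\<dots> = (?n * h / r) *\<^sub>R p a" unfolding eq using n1 by simp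
    finally have vp: "v = (?n * h / r) *\<^sub>R p a" .
    have "norm v = ?n * h / r"
      unfolding vp using norm_p[of a] \<open>h > 0\<close> r by simp
    then have nh: "?n * h / r = 1" using v by (simp only:)
    have "v = p a" using vp unfolding nh by simp
    moreover have "?n * h = r" using nh r(1) by (simp add: divide_eq_eq split: if_splits)
    then have "h = r / ?n" using n by (simp add: nonzero_eq_divide_eq mult.commute)
    ultimately show ?thesis using h_def by simp
  qed
  have ga: "inner g (p a) = 1 - r / ?n" for a using gp_eq[of a] by simp
  \<comment> \<open>Since \<open>inner g (p a)\<close> does not depend on \<open>a\<close> and the
    normals sum to 0, it is 0; that yields \<open>r = n\<close> and then
    \<open>g = 0\<close>.\<close>
  have "0 = inner g (\<Sum>a\<in>UNIV. p a)" by (simp add: sum_p)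
  also have "\<dots> = (\<Sum>a\<in>(UNIV :: 'n option set). 1 - r / ?n)" by (simp only: inner_sum_right ga)
  also have "\<dots> = (?n + 1) * (1 - r / ?n)" by (simp only: sum_constant) simp
  finally have "1 - r / ?n = 0" using n by (metis add_pos_pos less_irrefl mult_eq_0_iff zero_less_one)
  then have rn: "r = ?n" using n by (simp add: eq_divide_eq)
  then have "inner (p a) g = 0" for a using gp_eq[of a] n by (simp add: inner_commute[of g])
  then have "((?n + 1) / ?n) *\<^sub>R g = 0" using frame_p[of g] by simp
  then have "g = 0" using n by (simp add: add_nonneg_eq_0_iff)
  then have "c a = vertex a" for a using qp[of a] by (simp add: q_def vertex_def rn)
  then have "C = range vertex" by (auto simp: rC)
  then have "T = hull_body" by (simp add: C(3) hull_body_eq)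
  then show ?thesis using that \<open>simplex_normals p\<close> by blast
qed

subsection \<open>Finite frames\<close>

text \<open>Between heavy vectors the hypothesis holds without weights. A maximal almost orthogonal
  set \<open>R\<close> of heavy vectors comes close to every heavy vector. Were it not spanning, a
  unit vector orthogonal to \<open>R\<close> would receive less than 1/2 from the heavy vectors and
  at most 1/2 from the light ones, while the frame gives 1. So \<open>R\<close> has at least as many
  elements as the dimension.\<close>

lemma (in unit_frame) near_orthonormal_selection:
  assumes m: "card J \<le> m" and \<delta>: "\<And>u v. u \<in> J \<Longrightarrow> v \<in> J \<Longrightarrow> c u * c v * (norm (u - v))\<^sup>2 * (inner u v)\<^sup>2 \<le> \<delta>"
    and small: "32 * (real m)\<^sup>2 * real CARD('m) * \<delta> < 1"
  obtains w :: "'m \<Rightarrow> real ^ 'm" where "range w \<subseteq> J" "\<And>a b. a \<noteq> b \<Longrightarrow> \<bar>inner (w a) (w b)\<bar> \<le> 2 * real m * sqrt \<delta>"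
proof -
  have "J \<noteq> {}" using sum_weights by auto
  then have m1: "m \<ge> 1" using m fin by (metis One_nat_def Suc_leI card_gt_0_iff le_trans)
  then have m0: "real m > 0" by simp
  obtain u0 where "u0 \<in> J" using \<open>J \<noteq> {}\<close> by blast
  then have d0: "\<delta> \<ge> 0" using \<delta>[of u0 u0] by simp
  \<comment> \<open>Dividing by two weights of at least 1 / (2 m) each.\<close>
  define d where "d = 4 * (real m)\<^sup>2 * \<delta>"
  have d: "d \<ge> 0" "8 * real CARD('m) * d < 1" using d0 small by (auto simp: d_def mult_ac)
  define H where "H = {u \<in> J. c u \<ge> 1 / (2 * real m)}"
  have HJ: "H \<subseteq> J" and finH: "finite H" using fin by (auto simp: H_def)
  have pair: "(norm (u - v))\<^sup>2 * (inner u v)\<^sup>2 \<le> d" if "u \<in> H" "v \<in> H" for u v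
  proof -
    have "1 / (2 * real m) * (1 / (2 * real m)) * ((norm (u - v))\<^sup>2 * (inner u v)\<^sup>2)
        \<le> c u * c v * ((norm (u - v))\<^sup>2 * (inner u v)\<^sup>2)"
      using that m0 by (intro mult_right_mono mult_mono) (auto simp: H_def c_pos less_imp_le)
    also have "\<dots> \<le> \<delta>" using \<delta>[of u v] that HJ by (auto simp: mult.assoc)
    finally have "((norm (u - v))\<^sup>2 * (inner u v)\<^sup>2) / (4 * (real m)\<^sup>2) \<le> \<delta>" by (simp add: power2_eq_square)
    then show ?thesis using m0 by (simp add: d_def divide_le_eq mult_ac)
  qed
  define \<R> where "\<R> = {R. R \<subseteq> H \<and> pairwise (\<lambda>u v. (inner u v)\<^sup>2 \<le> d) R}"
  have "finite \<R>" using finH by (auto simp: \<R>_def)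
  moreover have "\<R> \<noteq> {}" by (auto simp: \<R>_def intro!: exI[of _ "{}"])
  ultimately obtain R where R: "R \<in> \<R>" and max: "\<And>R'. R' \<in> \<R> \<Longrightarrow> R \<subseteq> R' \<Longrightarrow> R = R'"
    using finite_has_maximal[of \<R>] by auto
  have RH: "R \<subseteq> H" and Rp: "pairwise (\<lambda>u v. (inner u v)\<^sup>2 \<le> d) R" using R by (auto simp: \<R>_def)
  have near: "\<exists>r\<in>R. (norm (u - r))\<^sup>2 \<le> 4 * d" if u: "u \<in> H" for u
  proof (cases "u \<in> R")
    case True
    then show ?thesis using d(1) by (intro bexI[of _ u]) auto
  next
    case False
    then have "insert u R \<notin> \<R>" using max[of "insert u R"] by auto
    then obtain r where r: "r \<in> R" "(inner u r)\<^sup>2 > d"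
      using u RH Rp by (auto simp: \<R>_def pairwise_insert inner_commute not_le)
    let ?x = "inner u r"
    have rH: "r \<in> H" using r(1) RH by auto
    have "norm u = 1" "norm r = 1" using u rH HJ unit by auto
    then have n2: "(norm (u - r))\<^sup>2 = 2 - 2 * ?x"
      by (simp add: power2_norm_eq_inner inner_diff_left inner_diff_right inner_commute norm_eq_1)
    \<comment> \<open>The other possibility is excluded: it makes the distance of \<open>u\<close>
      and \<open>r\<close> at least 1, and the pair bound would then make them almost
      orthogonal.\<close>
    have "?x > 1 / 2"
    proof (rule ccontr)
      assume "\<not> ?x > 1 / 2"
      then have "1 * ?x\<^sup>2 \<le> (norm (u - r))\<^sup>2 * ?x\<^sup>2" unfolding n2 by (intro mult_right_mono) auto
      then show False using pair[OF u rH] r(2) by linarith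
    qed
    then have "(1 / 2)\<^sup>2 \<le> ?x\<^sup>2" by (intro power_mono) auto
    then have "(norm (u - r))\<^sup>2 * (1 / 2)\<^sup>2 \<le> (norm (u - r))\<^sup>2 * ?x\<^sup>2" by (intro mult_left_mono) auto
    then have "(norm (u - r))\<^sup>2 \<le> 4 * d" using pair[OF u rH] by (simp add: power2_eq_square)
    then show ?thesis using r(1) by blast
  qed
  have "span R = UNIV"
  proof (rule ccontr)
    assume "span R \<noteq> UNIV"
    then obtain x0 where x0: "x0 \<noteq> 0" "\<And>y. y \<in> span R \<Longrightarrow> orthogonal x0 y"
      using orthogonal_to_subspace_exists_gen[of R UNIV] by auto
    define x where "x = x0 /\<^sub>R norm x0"
    have x: "norm x = 1" "\<And>r. r \<in> R \<Longrightarrow> inner r x = 0"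
      using x0 by (auto simp: x_def orthogonal_def inner_commute span_base)
    have sq: "(inner u x)\<^sup>2 \<le> 1" if "u \<in> J" for u
      using Cauchy_Schwarz_ineq2[of u x] unit[OF that] x(1) by (simp add: abs_square_le_1)
    have "(inner u x)\<^sup>2 \<le> 4 * d" if u: "u \<in> H" for u
    proof -
      obtain r where r: "r \<in> R" "(norm (u - r))\<^sup>2 \<le> 4 * d" using near[OF u] by blast
      have "\<bar>inner u x\<bar> \<le> norm (u - r)"
        using Cauchy_Schwarz_ineq2[of "u - r" x] x r(1) by (simp add: inner_diff_left)
      then have "(inner u x)\<^sup>2 \<le> (norm (u - r))\<^sup>2" by (simp add: abs_le_square_iff[symmetric])
      then show ?thesis using r(2) by linarith
    qed
    then have "(\<Sum>u\<in>H. c u * (inner u x)\<^sup>2) \<le> (\<Sum>u\<in>H. c u * (4 * d))"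
      using HJ c_pos by (intro sum_mono mult_left_mono) (auto simp: less_imp_le)
    also have "\<dots> \<le> (\<Sum>u\<in>J. c u * (4 * d))"
      using HJ c_pos d fin by (intro sum_mono2) (auto simp: less_imp_le)
    also have "\<dots> = real CARD('m) * (4 * d)" by (simp only: sum_distrib_right[symmetric] sum_weights)
    also have "\<dots> < 1 / 2" using d(2) by simp
    finally have heavy: "(\<Sum>u\<in>H. c u * (inner u x)\<^sup>2) < 1 / 2" .
    have "(\<Sum>u\<in>J - H. c u * (inner u x)\<^sup>2) \<le> (\<Sum>u\<in>J - H. 1 / (2 * real m) * 1)"
      using sq by (intro sum_mono mult_mono) (auto simp: H_def c_pos less_imp_le)
    also have "\<dots> = real (card (J - H)) / (2 * real m)" by simp
    also have "\<dots> \<le> real m / (2 * real m)"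
      using m card_mono[OF fin, of "J - H"] by (intro divide_right_mono) auto
    also have "\<dots> = 1 / 2" using m0 by simp
    finally have "(\<Sum>u\<in>J. c u * (inner u x)\<^sup>2) < 1"
      using heavy sum.subset_diff[OF HJ fin, of "\<lambda>u. c u * (inner u x)\<^sup>2"] by linarith
    then show False using frame_norm[of x] x(1) by simp
  qed
  then have "CARD('m) \<le> card R"
    using dim_le_card[of R R] finite_subset[OF RH finH] dim_span[of R] by (simp add: dim_UNIV)
  then obtain w :: "'m \<Rightarrow> real ^ 'm" where w: "range w \<subseteq> R" "inj w"
    using card_le_inj[of "UNIV :: 'm set" R] finite_subset[OF RH finH] by auto
  show ?thesis
  proof (rule that[of w])
    show "range w \<subseteq> J" using w(1) RH HJ by blast
    fix a b :: 'm assume "a \<noteq> b"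
    then have "w a \<noteq> w b" using w(2) by (auto dest: injD)
    moreover have "w a \<in> R" "w b \<in> R" using w(1) by auto
    ultimately have "(inner (w a) (w b))\<^sup>2 \<le> d" using Rp by (simp add: pairwise_def)
    then have "sqrt ((inner (w a) (w b))\<^sup>2) \<le> sqrt d" by (rule real_sqrt_le_mono)
    then show "\<bar>inner (w a) (w b)\<bar> \<le> 2 * real m * sqrt \<delta>"
      using m0 by (simp add: d_def real_sqrt_mult)
  qed
qed

section \<open>The support of a measure and its reduction to finitely many vectors\<close>

lemma supp_closed:
  fixes \<mu> :: "(real ^ 'n) measure"
  assumes "sets \<mu> = sets sphere_borel"
  shows "supp \<mu> \<subseteq> sphere 0 1" "compact (supp \<mu>)"
proof -
  have sp: "space \<mu> = sphere 0 1"
    using sets_eq_imp_space_eq[OF assms] by (simp add: sphere_borel_def space_restrict_space)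
  then show "supp \<mu> \<subseteq> sphere 0 1" by (auto simp: supp_def)
  let ?F = "{U. open U \<and> emeasure \<mu> (U \<inter> space \<mu>) = 0}"
  have eq: "supp \<mu> = sphere 0 1 - \<Union>?F"
    by (auto simp: supp_def sp zero_less_iff_neq_zero)
  have "open (\<Union>?F)" by (intro open_Union) auto
  then show "compact (supp \<mu>)" unfolding eq by (intro compact_diff) auto
qed

text \<open>By Lindelof's theorem the union of all null open sets is already a countable union of
  such sets.\<close>

lemma AE_in_supp:
  fixes \<mu> :: "(real ^ 'n) measure"
  assumes sets: "sets \<mu> = sets sphere_borel"
  shows "AE u in \<mu>. u \<in> supp \<mu>"
proof -
  have sp: "space \<mu> = sphere 0 1"
    using sets_eq_imp_space_eq[OF sets] by (simp add: sphere_borel_def space_restrict_space)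
  let ?F = "{U. open U \<and> emeasure \<mu> (U \<inter> space \<mu>) = 0}"
  obtain F' where F': "F' \<subseteq> ?F" "countable F'" "\<Union>F' = \<Union>?F"
    using Lindelof[of ?F] by blast
  have "U \<inter> space \<mu> \<in> null_sets \<mu>" if "U \<in> F'" for U
  proof -
    have U: "open U" "emeasure \<mu> (U \<inter> space \<mu>) = 0" using that F'(1) by auto
    have "sphere 0 1 \<inter> U \<in> sets sphere_borel"
      unfolding sphere_borel_def sets_restrict_space using U(1) by (intro imageI) simp
    then have "U \<inter> space \<mu> \<in> sets \<mu>" unfolding sets sp by (simp only: Int_commute)
    then show ?thesis using U(2) by (rule null_setsI[rotated])
  qed
  then have "(\<Union>U\<in>F'. U \<inter> space \<mu>) \<in> null_sets \<mu>"
    using F'(2) by (intro null_sets_UN') auto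
  moreover have "{u \<in> space \<mu>. u \<notin> supp \<mu>} \<subseteq> (\<Union>U\<in>F'. U \<inter> space \<mu>)"
  proof
    fix u assume "u \<in> {u \<in> space \<mu>. u \<notin> supp \<mu>}"
    then have u: "u \<in> space \<mu>" "u \<in> \<Union>?F" by (auto simp: supp_def zero_less_iff_neq_zero)
    then have "u \<in> \<Union>F'" by (simp only: F'(3))
    then show "u \<in> (\<Union>U\<in>F'. U \<inter> space \<mu>)" using u(1) by auto
  qed
  ultimately show ?thesis by (rule AE_I')
qed

text \<open>The pair (Id / n, 0) is the mean of (\<open>tensor_square u\<close>, \<open>u\<close>)
  under \<mu>. A hyperplane separating it from the convex hull of the image of the support would
  contradict this mean, so it lies in the hull. Caratheodory's theorem in the space of matrices and
  vectors, of dimension n^2 + n, gives the number of vectors.\<close>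

lemma isotropic_centred_finite_frame:
  fixes \<mu> :: "(real ^ 'n) measure"
  assumes sets: "sets \<mu> = sets sphere_borel" and cen: "centred \<mu>" and iso: "isotropic \<mu>"
  obtains J c where "finite J" "J \<subseteq> supp \<mu>" "card J \<le> CARD('n)\<^sup>2 + CARD('n) + 1"
    "\<And>u. u \<in> J \<Longrightarrow> c u > 0" "(\<Sum>u\<in>J. c u) = real CARD('n)" "(\<Sum>u\<in>J. c u *\<^sub>R u) = 0"
    "\<And>x. (\<Sum>u\<in>J. (c u * inner u x) *\<^sub>R u) = x"
proof -
  let ?n = "real CARD('n)"
  have n: "?n > 0" by simp
  have sp: "space \<mu> = sphere 0 1"
    using sets_eq_imp_space_eq[OF sets] by (simp add: sphere_borel_def space_restrict_space)
  have I: "has_bochner_integral \<mu> tensor_square (mat 1)" using iso by (simp add: isotropic_def)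
  have I0: "has_bochner_integral \<mu> (\<lambda>u. u) 0" using cen by (simp add: centred_def)
  \<comment> \<open>The trace of the isotropy condition shows that \<mu> has total mass n.\<close>
  have "has_bochner_integral \<mu> (\<lambda>u. inner (mat 1) (tensor_square u)) (inner (mat 1 :: real ^ 'n ^ 'n) (mat 1))"
    by (rule has_bochner_integral_bounded_linear[OF bounded_linear_inner_right I])
  moreover have "inner (mat 1 :: real ^ 'n ^ 'n) (mat 1) = ?n"
    by (simp add: inner_vec_def mat_def if_distrib cong: if_cong)
  moreover have tr: "inner (mat 1) (tensor_square u) = (norm u)\<^sup>2" for u :: "real ^ 'n"
    unfolding power2_norm_eq_inner
    by (simp add: inner_vec_def mat_def tensor_square_def if_distrib[of "\<lambda>x. x * _"] cong: if_cong)
  ultimately have N: "has_bochner_integral \<mu> (\<lambda>u. (norm u)\<^sup>2) ?n" by simp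
  then have one: "has_bochner_integral \<mu> (\<lambda>u. 1 :: real) ?n"
    by (subst (asm) has_bochner_integral_cong[OF refl, of \<mu> _ "\<lambda>u. 1"]) (auto simp: sp)
  define \<phi> where "\<phi> u = (tensor_square u, u)" for u :: "real ^ 'n"
  have cont: "continuous_on A \<phi>" for A
    unfolding \<phi>_def tensor_square_def by (intro continuous_intros)
  let ?P = "\<phi> ` supp \<mu>"
  let ?z = "((1 / ?n) *\<^sub>R mat 1, 0) :: (real ^ 'n ^ 'n) \<times> (real ^ 'n)"
  have "?z \<in> convex hull ?P"
  proof (rule ccontr)
    assume notin: "?z \<notin> convex hull ?P"
    have "compact ?P" using supp_closed(2)[OF sets] cont by (rule compact_continuous_image[rotated])
    then have "closed (convex hull ?P)" by (intro compact_imp_closed compact_convex_hull)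
    then obtain a b where ab: "inner a ?z < b" "\<And>x. x \<in> convex hull ?P \<Longrightarrow> inner a x > b"
      using separating_hyperplane_closed_point[OF convex_convex_hull _ notin] by blast
    let ?f = "\<lambda>u. inner (fst a) (tensor_square u) + inner (snd a) u"
    have f: "has_bochner_integral \<mu> ?f (inner (fst a) (mat 1) + inner (snd a) 0)"
      by (intro has_bochner_integral_add has_bochner_integral_bounded_linear[OF bounded_linear_inner_right] I I0)
    have "has_bochner_integral \<mu> (\<lambda>u. b * 1) (b * ?n)"
      by (intro has_bochner_integral_mult_right one)
    note b = this
    have "integral\<^sup>L \<mu> (\<lambda>u. b * 1) \<le> integral\<^sup>L \<mu> ?f"
    proof (rule integral_mono_AE)
      show "integrable \<mu> (\<lambda>u. b * 1)" "integrable \<mu> ?f"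
        using b f by (auto simp only: has_bochner_integral_iff)
      show "AE u in \<mu>. b * 1 \<le> ?f u"
        using AE_in_supp[OF sets]
      proof eventually_elim
        case (elim u)
        then have "\<phi> u \<in> convex hull ?P" by (intro hull_inc) auto
        from ab(2)[OF this] show ?case by (simp add: \<phi>_def inner_prod_def)
      qed
    qed
    then have "b * ?n \<le> inner (fst a) (mat 1) + inner (snd a) 0"
      using b f by (simp only: has_bochner_integral_integral_eq)
    moreover have "?n * inner a ?z < ?n * b" using ab(1) n by (rule mult_strict_left_mono)
    ultimately show False by (simp add: inner_prod_def mult.commute)
  qed
  then obtain S w where S: "finite S" "S \<subseteq> ?P" "card S \<le> DIM((real ^ 'n ^ 'n) \<times> (real ^ 'n)) + 1"
    "\<forall>x\<in>S. 0 \<le> w x" "sum w S = 1" "(\<Sum>v\<in>S. w v *\<^sub>R v) = ?z"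
    unfolding convex_hull_caratheodory by blast
  have S_eq: "v = \<phi> (snd v)" if "v \<in> S" for v using that S(2) by (auto simp: \<phi>_def)
  have inj: "inj_on snd S" by (rule inj_on_inverseI[where g = \<phi>]) (simp add: S_eq[symmetric])
  \<comment> \<open>Caratheodory allows zero coefficients, but a frame has positive weights.\<close>
  define S' where "S' = {v \<in> S. w v > 0}"
  have S': "S' \<subseteq> S" "finite S'" using S(1) by (auto simp: S'_def)
  have inj': "inj_on snd S'" using inj S'(1) by (rule inj_on_subset)
  have red: "(\<Sum>v\<in>S'. w v *\<^sub>R g v) = (\<Sum>v\<in>S. w v *\<^sub>R g v)" for g :: "_ \<Rightarrow> 'z::real_vector"
    using S(1,4) by (intro sum.mono_neutral_left) (auto simp: S'_def less_le)
  have red1: "(\<Sum>v\<in>S'. w v) = 1"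
    using red[of "\<lambda>_. 1 :: real"] S(5) by simp
  have v_eq: "v = \<phi> (snd v)" if "v \<in> S'" for v using that S'(1) S_eq by blast
  let ?J = "snd ` S'" and ?c = "\<lambda>u. ?n * w (\<phi> u)"
  have sumJ: "(\<Sum>u\<in>?J. ?c u *\<^sub>R g u) = ?n *\<^sub>R (\<Sum>v\<in>S'. w v *\<^sub>R g (snd v))" for g :: "_ \<Rightarrow> 'z::real_vector"
  proof -
    have "(\<Sum>u\<in>?J. ?c u *\<^sub>R g u) = (\<Sum>v\<in>S'. ?c (snd v) *\<^sub>R g (snd v))"
      using inj' by (simp add: sum.reindex)
    also have "\<dots> = (\<Sum>v\<in>S'. ?n *\<^sub>R (w v *\<^sub>R g (snd v)))"
      using v_eq by (intro sum.cong) auto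
    finally show ?thesis by (simp add: scaleR_sum_right)
  qed
  have fst_sum: "(\<Sum>v\<in>S'. w v *\<^sub>R fst v) = (1 / ?n) *\<^sub>R mat 1"
    using arg_cong[OF S(6), of fst] unfolding red by (simp add: fst_sum)
  have snd_sum: "(\<Sum>v\<in>S'. w v *\<^sub>R snd v) = 0"
    using arg_cong[OF S(6), of snd] unfolding red by (simp add: snd_sum)
  show ?thesis
  proof (rule that[of ?J ?c])
    show "finite ?J" using S'(2) by simp
    show "?J \<subseteq> supp \<mu>" using S'(1) S(2) by (auto simp: \<phi>_def)
    have "card ?J \<le> card S" using card_image_le[OF S'(2), of snd] card_mono[OF S(1) S'(1)] by linarith
    then show "card ?J \<le> CARD('n)\<^sup>2 + CARD('n) + 1" using S(3) by (simp add: power2_eq_square)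
    show "?c u > 0" if "u \<in> ?J" for u
      using that v_eq n by (auto simp: S'_def)
    show "(\<Sum>u\<in>?J. ?c u) = ?n" using sumJ[of "\<lambda>_. 1 :: real"] red1 by simp
    show "(\<Sum>u\<in>?J. ?c u *\<^sub>R u) = 0" using sumJ[of "\<lambda>u. u"] snd_sum by simp
    fix x :: "real ^ 'n"
    have "(\<Sum>u\<in>?J. (?c u * inner u x) *\<^sub>R u) = (\<Sum>u\<in>?J. ?c u *\<^sub>R (inner u x *\<^sub>R u))" by simp
    also have "\<dots> = ?n *\<^sub>R (\<Sum>v\<in>S'. w v *\<^sub>R (inner (snd v) x *\<^sub>R snd v))" by (rule sumJ)
    also have "(\<Sum>v\<in>S'. w v *\<^sub>R (inner (snd v) x *\<^sub>R snd v)) = (\<Sum>v\<in>S'. w v *\<^sub>R fst v) *v x"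
    proof -
      have ts: "inner u x *\<^sub>R u = tensor_square u *v x" for u
        by (simp add: vec_eq_iff tensor_square_def matrix_vector_mult_def inner_vec_def sum_distrib_left mult_ac)
      have "(\<Sum>v\<in>S'. w v *\<^sub>R (inner (snd v) x *\<^sub>R snd v)) = (\<Sum>v\<in>S'. (w v *\<^sub>R fst v) *v x)"
      proof (intro sum.cong refl)
        fix v assume "v \<in> S'"
        then have "fst v = tensor_square (snd v)" using v_eq[of v] by (metis \<phi>_def fst_conv)
        then show "w v *\<^sub>R (inner (snd v) x *\<^sub>R snd v) = (w v *\<^sub>R fst v) *v x"
          by (simp add: ts scaleR_matrix_vector_assoc[symmetric])
      qed
      also have "\<dots> = (\<Sum>v\<in>S'. w v *\<^sub>R fst v) *v x"
        by (induction S' rule: infinite_finite_induct) (auto simp: matrix_vector_mult_add_rdistrib)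
      finally show ?thesis .
    qed
    also have "?n *\<^sub>R ((\<Sum>v\<in>S'. w v *\<^sub>R fst v) *v x) = x"
      unfolding fst_sum by (simp add: scaleR_matrix_vector_assoc[symmetric])
    finally show "(\<Sum>u\<in>?J. (?c u * inner u x) *\<^sub>R u) = x" .
  qed
qed

lemma inj_lift_unit: "inj (lift_unit :: real ^ 'n::finite \<Rightarrow> _)"
proof (rule injI)
  fix u v :: "real ^ 'n" assume "lift_unit u = lift_unit v"
  then show "u = v" by (simp add: lift_unit_def lift_vec_eq_iff)
qed

text \<open>In block form, the height entry of the lifted frame operator is 1 because of the total
  mass, the mixed entries vanish because the vectors are centred, and the horizontal block is the
  isotropy condition. The factor (n + 1) / n makes both diagonal blocks come out right.\<close>

lemma unit_frame_axis_lift_unit: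
  fixes J :: "(real ^ 'n::finite) set"
  assumes fin: "finite J" and unit: "J \<subseteq> sphere 0 1" and pos: "\<And>u. u \<in> J \<Longrightarrow> c u > 0"
    and one: "(\<Sum>u\<in>J. c u) = real CARD('n)" and cen: "(\<Sum>u\<in>J. c u *\<^sub>R u) = 0"
    and iso: "\<And>x. (\<Sum>u\<in>J. (c u * inner u x) *\<^sub>R u) = x"
  shows "unit_frame_axis (lift_unit ` J)
    (\<lambda>U. (real CARD('n) + 1) / real CARD('n) * c (inv lift_unit U)) (lift_vec 1 0)"
proof
  let ?n = "real CARD('n)" and ?N = "real CARD('n) + 1"
  have n: "?n > 0" by simp
  show "finite (lift_unit ` J)" using fin by simp
  show "?N / ?n * c (inv lift_unit U) > 0" if "U \<in> lift_unit ` J" for U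
    using that pos by (auto simp: inv_f_f[OF inj_lift_unit])
  show "norm U = 1" if U: "U \<in> lift_unit ` J" for U
  proof -
    obtain u where u: "U = lift_unit u" "norm u = 1" using U unit by auto
    have "inner U U = (1 + ?n * 1) / ?N" unfolding u(1) inner_lift_unit using u(2) by (simp add: norm_eq_1)
    then show ?thesis by (simp add: norm_eq_1 add.commute)
  qed
  show "norm (lift_vec 1 0 :: real ^ 'n lift_index) = 1" by (simp add: norm_eq_1 inner_lift_vec)
  show "inner U (lift_vec 1 0) = 1 / sqrt (real CARD('n lift_index))" if "U \<in> lift_unit ` J" for U
    using that by (auto simp: inner_lift_unit_axis card_lift_index)
  show "(\<Sum>U\<in>lift_unit ` J. (?N / ?n * c (inv lift_unit U) * inner U y) *\<^sub>R U) = y" for y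
  proof -
    obtain t x where y: "y = lift_vec t x" by (rule lift_vec_cases)
    let ?s = "sqrt ?n" and ?S = "sqrt ?N"
    have ss: "?s * ?s = ?n" "?S * ?S = ?N" by auto
    have S0: "?S \<noteq> 0" "?s \<noteq> 0" by auto
    have cu: "(\<Sum>u\<in>J. c u * inner u x) = 0"
      using arg_cong[OF cen, of "\<lambda>z. inner z x"] by (simp add: inner_sum_left)
    have "(\<Sum>U\<in>lift_unit ` J. (?N / ?n * c (inv lift_unit U) * inner U y) *\<^sub>R U)
        = (\<Sum>u\<in>J. (?N / ?n * c u * inner (lift_unit u) y) *\<^sub>R lift_unit u)"
      using inj_lift_unit by (subst sum.reindex) (auto simp: inv_f_f[OF inj_lift_unit] inj_on_def)
    also have "\<dots> = (\<Sum>u\<in>J. lift_vec ((1 / ?n) * (t * c u - ?s * (c u * inner u x)))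
        ((- t / ?s) *\<^sub>R (c u *\<^sub>R u) + (c u * inner u x) *\<^sub>R u))"
    proof (intro sum.cong refl)
      fix u
      have i: "inner (lift_unit u) y = (t - ?s * inner u x) / ?S"
        by (simp add: y lift_unit_def inner_lift_vec diff_divide_distrib)
      have 1: "?N / ?n * c u * ((t - ?s * inner u x) / ?S) * (1 / ?S) = (1 / ?n) * (t * c u - ?s * (c u * inner u x))"
      proof -
        have "?N / ?n * c u * ((t - ?s * inner u x) / ?S) * (1 / ?S)
            = (?N / (?S * ?S)) * (1 / ?n) * (t * c u - ?s * (c u * inner u x))"
        proof -
          have "A / n' * k * ((t' - s' * i) / S') * (1 / S') = (A / (S' * S')) * (1 / n') * (t' * k - s' * (k * i))"
            for A n' k t' s' i S' :: real
            by (simp add: divide_inverse algebra_simps)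
          then show ?thesis .
        qed
        then show ?thesis using ss(2) by simp
      qed
      have 2: "?N / ?n * c u * ((t - ?s * inner u x) / ?S) * (- (?s / ?S)) = - t / ?s * c u + c u * inner u x"
      proof -
        have "?N / ?n * c u * ((t - ?s * inner u x) / ?S) * (- (?s / ?S))
            = (?N / ?n * c u * ((t - ?s * inner u x) / ?S) * (1 / ?S)) * (- ?s)" by simp
        also have "\<dots> = (1 / (?s * ?s)) * (t * c u - ?s * (c u * inner u x)) * (- ?s)"
          unfolding 1 ss(1) ..
        also have "\<dots> = - t / ?s * c u + c u * inner u x"
        proof -
          have "(1 / (s' * s')) * (t' * k - s' * (k * i)) * (- s') = - t' / s' * k + k * i"
            if "s' \<noteq> 0" for k t' s' i :: real
            using that by (simp add: field_simps)
          then show ?thesis using S0(2) .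
        qed
        finally show ?thesis .
      qed
      show "(?N / ?n * c u * inner (lift_unit u) y) *\<^sub>R lift_unit u
          = lift_vec ((1 / ?n) * (t * c u - ?s * (c u * inner u x)))
              ((- t / ?s) *\<^sub>R (c u *\<^sub>R u) + (c u * inner u x) *\<^sub>R u)"
        unfolding i unfolding lift_unit_def lift_vec_scaleR scaleR_scaleR 1 2 scaleR_left_distrib ..
    qed
    also have "\<dots> = lift_vec ((1 / ?n) * (t * (\<Sum>u\<in>J. c u) - ?s * (\<Sum>u\<in>J. c u * inner u x)))
        ((- t / ?s) *\<^sub>R (\<Sum>u\<in>J. c u *\<^sub>R u) + (\<Sum>u\<in>J. (c u * inner u x) *\<^sub>R u))"
      unfolding lift_vec_sum
      by (simp only: sum.distrib sum_distrib_left[symmetric] sum_subtractf scaleR_sum_right)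
    also have "\<dots> = y" using n by (simp add: one cen cu iso y)
    finally show ?thesis .
  qed
qed

subsection \<open>Stability of the regular simplex\<close>

lemma inner_sum_sum:
  "inner (\<Sum>a\<in>A. x a) (\<Sum>b\<in>B. y b) = (\<Sum>a\<in>A. \<Sum>b\<in>B. inner (x a) (y b))"
  by (subst inner_sum_left) (simp only: inner_sum_right)

context simplex_normals
begin

text \<open>The map \<open>L\<close> sends \<open>p a\<close> to \<open>w a\<close> minus the barycentre of the \<open>w b\<close>; its orthogonal polar factor \<open>Q\<close>, read off
  from an eigenbasis of \<open>L\<^sup>T L\<close>, carries \<open>p\<close> to the exact simplex.\<close>

lemma nearby_simplex_normals:
  fixes w :: "'n option \<Rightarrow> real ^ 'n"
  assumes w: "\<And>a. norm (w a) = 1" and h: "\<And>a b. a \<noteq> b \<Longrightarrow> \<bar>inner (w a) (w b) + 1 / real CARD('n)\<bar> \<le> h"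
    and small: "(real CARD('n))\<^sup>2 * h \<le> 1 / 2"
  obtains p' where "simplex_normals p'" "\<And>a. norm (p' a - w a) \<le> (real CARD('n))\<^sup>2 * h + sqrt h"
proof -
  let ?n = "real CARD('n)" and ?N = "real CARD('n) + 1"
  have n: "?n > 0" by simp
  have n1: "?n \<ge> 1" using zero_less_card_finite[where 'a='n] by linarith
  have h0: "h \<ge> 0" using h[of None "Some undefined"] by simp
  define E where "E a b = inner (w a) (w b) - inner (p a) (p b)" for a b
  have E: "\<bar>E a b\<bar> \<le> h" for a b
    using h[of a b] h0 w[of a] by (cases "a = b") (auto simp: E_def gram norm_eq_1)
  define L where "L x = (?n / ?N) *\<^sub>R (\<Sum>a\<in>UNIV. inner (p a) x *\<^sub>R w a)" for x
  define f where "f x = (?n / ?N) *\<^sub>R (\<Sum>a\<in>UNIV. inner (w a) (L x) *\<^sub>R p a)" for x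
  have linL: "linear L"
    unfolding L_def by (intro linearI) (auto simp: inner_add_right scaleR_left_distrib sum.distrib scaleR_right_distrib
        scaleR_sum_right mult_ac)
  have linf: "linear f"
    unfolding f_def
    by (intro linearI) (auto simp: linear_add[OF linL] linear_scale[OF linL] inner_add_right scaleR_left_distrib
        sum.distrib scaleR_right_distrib scaleR_sum_right mult_ac)
  have fL: "inner (f x) y = inner (L x) (L y)" for x y
    by (simp add: f_def L_def[of y] inner_sum_left inner_sum_right inner_commute[of "L x"] mult_ac)
  obtain e l where e: "\<And>i j :: 'n. inner (e i) (e j) = (if i = j then 1 else 0 :: real)"
    and eig: "\<And>i. f (e i) = l i *\<^sub>R e i"
    using selfadjoint_diagonalization[of f] linf fL by (metis inner_commute)
  have Le: "inner (L (e i)) (L (e j)) = (if i = j then l i else 0)" for i j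
    by (simp add: fL[symmetric] eig e)
  \<comment> \<open>With \<open>p\<close> in place of \<open>w\<close> the map would be the
    identity, so only the Gram errors \<open>E\<close> remain. There are (n + 1)^2 of them, which
    the factor (n / (n + 1))^2 reduces to n^2.\<close>
  have L_near: "\<bar>(norm (L x))\<^sup>2 - (norm x)\<^sup>2\<bar> \<le> ?n\<^sup>2 * h * (norm x)\<^sup>2" for x
  proof -
    have px: "\<bar>inner (p a) x\<bar> \<le> norm x" for a
      using Cauchy_Schwarz_ineq2[of "p a" x] norm_p[of a] by simp
    have quad: "(norm ((?n / ?N) *\<^sub>R (\<Sum>a\<in>UNIV. inner (p a) x *\<^sub>R v a)))\<^sup>2
        = (?n / ?N)\<^sup>2 * (\<Sum>a\<in>UNIV. \<Sum>b\<in>UNIV. inner (p a) x * inner (p b) x * inner (v a) (v b))" for v :: "'n option \<Rightarrow> real ^ 'n"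
    proof -
      have "inner (r *\<^sub>R S) (r *\<^sub>R S) = r\<^sup>2 * inner S S" for r and S :: "real ^ 'n"
        by (simp add: power2_eq_square)
      then show ?thesis
        unfolding power2_norm_eq_inner by (simp only: inner_sum_sum) (simp add: mult.assoc mult.left_commute)
    qed
    have "x = (?n / ?N) *\<^sub>R (\<Sum>a\<in>UNIV. inner (p a) x *\<^sub>R p a)"
      unfolding frame_p using n by simp
    then have "(norm x)\<^sup>2 = (?n / ?N)\<^sup>2 * (\<Sum>a\<in>UNIV. \<Sum>b\<in>UNIV. inner (p a) x * inner (p b) x * inner (p a) (p b))"
      using quad[of p] by simp
    then have "(norm (L x))\<^sup>2 - (norm x)\<^sup>2
        = (?n / ?N)\<^sup>2 * (\<Sum>a\<in>UNIV. \<Sum>b\<in>UNIV. inner (p a) x * inner (p b) x * E a b)"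
      unfolding L_def quad E_def by (simp add: right_diff_distrib sum_subtractf)
    also have "\<bar>\<dots>\<bar> \<le> (?n / ?N)\<^sup>2 * (\<Sum>a\<in>(UNIV :: 'n option set). \<Sum>b\<in>(UNIV :: 'n option set). norm x * norm x * h)"
      unfolding abs_mult
    proof (intro mult_mono order_trans[OF sum_abs] sum_mono)
      fix a b
      show "\<bar>inner (p a) x * inner (p b) x * E a b\<bar> \<le> norm x * norm x * h"
        unfolding abs_mult by (intro mult_mono px E) auto
    qed auto
    also have "(\<Sum>a\<in>(UNIV :: 'n option set). \<Sum>b\<in>(UNIV :: 'n option set). norm x * norm x * h)
        = ?N * (?N * (norm x * norm x * h))" by (simp add: add.commute)
    also have "(?n / ?N)\<^sup>2 * (?N * (?N * (norm x * norm x * h))) = ?n\<^sup>2 * h * (norm x)\<^sup>2"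
    proof -
      have "(n' / N')\<^sup>2 * (N' * (N' * (a * a * h))) = n'\<^sup>2 * h * a\<^sup>2" if "N' \<noteq> 0" for n' N' a :: real
        using that by (simp add: field_simps power2_eq_square)
      moreover have "?N \<noteq> 0" using n by linarith
      ultimately show ?thesis by blast
    qed
    finally show ?thesis .
  qed
  have l_near: "\<bar>l i - 1\<bar> \<le> ?n\<^sup>2 * h" for i
    using L_near[of "e i"] Le[of i i] e[of i i] by (simp add: power2_norm_eq_inner)
  have l_pos: "l i > 0" for i using l_near[of i] small by linarith
  define Q where "Q x = (\<Sum>i\<in>UNIV. (inner (e i) x / sqrt (l i)) *\<^sub>R L (e i))" for x
  have e_sum: "x = (\<Sum>i\<in>UNIV. inner (e i) x *\<^sub>R e i)" for x
  proof -
    have "inner (e j) (x - (\<Sum>i\<in>UNIV. inner (e i) x *\<^sub>R e i)) = 0" for j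
      by (simp add: inner_diff_right inner_sum_right e if_distrib cong: if_cong)
    then have "(norm (x - (\<Sum>i\<in>UNIV. inner (e i) x *\<^sub>R e i)))\<^sup>2 = 0"
      using orthonormal_parseval[OF e, of "x - (\<Sum>i\<in>UNIV. inner (e i) x *\<^sub>R e i)"] by simp
    then show ?thesis by simp
  qed
  have comb: "inner (\<Sum>i\<in>UNIV. \<alpha> i *\<^sub>R L (e i)) (\<Sum>i\<in>UNIV. \<beta> i *\<^sub>R L (e i)) = (\<Sum>i\<in>UNIV. \<alpha> i * \<beta> i * l i)" for \<alpha> \<beta>
    by (simp add: inner_sum_left inner_sum_right Le if_distrib mult_ac cong: if_cong)
  have QQ: "inner (Q x) (Q y) = inner x y" for x y
  proof -
    have "inner (Q x) (Q y) = (\<Sum>i\<in>UNIV. inner (e i) x * inner (e i) y)"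
      unfolding Q_def comb
    proof (intro sum.cong refl)
      fix i
      have "sqrt (l i) * sqrt (l i) = l i" "sqrt (l i) \<noteq> 0" using l_pos[of i] by auto
      then show "inner (e i) x / sqrt (l i) * (inner (e i) y / sqrt (l i)) * l i = inner (e i) x * inner (e i) y"
        using l_pos[of i] by (simp add: field_simps)
    qed
    also have "\<dots> = inner x y" by (subst (2) e_sum) (simp add: inner_sum_left)
    finally show ?thesis .
  qed
  have QL: "norm (Q x - L x) \<le> ?n\<^sup>2 * h * norm x" for x
  proof -
    have "L x = (\<Sum>i\<in>UNIV. inner (e i) x *\<^sub>R L (e i))"
      by (subst e_sum) (simp add: linear_sum[OF linL] linear_scale[OF linL])
    then have "Q x - L x = (\<Sum>i\<in>UNIV. (inner (e i) x / sqrt (l i) - inner (e i) x) *\<^sub>R L (e i))"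
      by (simp add: Q_def sum_subtractf scaleR_left_diff_distrib)
    then have "(norm (Q x - L x))\<^sup>2 = (\<Sum>i\<in>UNIV. (inner (e i) x / sqrt (l i) - inner (e i) x)
        * (inner (e i) x / sqrt (l i) - inner (e i) x) * l i)"
      unfolding power2_norm_eq_inner by (simp only: comb)
    also have "\<dots> \<le> (\<Sum>i\<in>UNIV. (?n\<^sup>2 * h)\<^sup>2 * (inner (e i) x)\<^sup>2)"
    proof (intro sum_mono)
      fix i
      let ?s = "sqrt (l i)"
      have s: "?s > 0" "?s * ?s = l i" using l_pos[of i] by auto
      have "(inner (e i) x / ?s - inner (e i) x) * (inner (e i) x / ?s - inner (e i) x) * l i
          = (inner (e i) x / ?s - inner (e i) x) * (inner (e i) x / ?s - inner (e i) x) * (?s * ?s)"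
        by (simp only: s(2))
      also have "\<dots> = (1 - ?s)\<^sup>2 * (inner (e i) x)\<^sup>2"
        using s(1) by (simp add: field_simps power2_eq_square del: real_sqrt_mult_self)
      also have "\<dots> \<le> (?n\<^sup>2 * h)\<^sup>2 * (inner (e i) x)\<^sup>2"
      proof (intro mult_right_mono)
        have "\<bar>1 - ?s\<bar> * 1 \<le> \<bar>1 - ?s\<bar> * (1 + ?s)" using s(1) by (intro mult_left_mono) auto
        also have "\<dots> = \<bar>(1 - ?s) * (1 + ?s)\<bar>" using s(1) by (simp add: abs_mult)
        also have "(1 - ?s) * (1 + ?s) = 1 - l i" using s(2) by (simp add: algebra_simps)
        finally have "\<bar>1 - ?s\<bar> \<le> ?n\<^sup>2 * h" using l_near[of i] by (simp add: abs_minus_commute)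
        then show "(1 - ?s)\<^sup>2 \<le> (?n\<^sup>2 * h)\<^sup>2" using power_mono[of "\<bar>1 - ?s\<bar>" "?n\<^sup>2 * h" 2] by simp
      qed simp
      finally show "(inner (e i) x / ?s - inner (e i) x) * (inner (e i) x / ?s - inner (e i) x) * l i
        \<le> (?n\<^sup>2 * h)\<^sup>2 * (inner (e i) x)\<^sup>2" .
    qed
    also have "\<dots> = (?n\<^sup>2 * h * norm x)\<^sup>2"
      by (simp add: sum_distrib_left[symmetric] orthonormal_parseval[OF e] power_mult_distrib)
    finally show ?thesis using h0 by (intro power2_le_imp_le[of "norm (Q x - L x)"]) auto
  qed
  define s where "s = (\<Sum>a\<in>UNIV. w a)"
  have Lp: "L (p b) = w b - (1 / ?N) *\<^sub>R s" for b
  proof -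
    have "(\<Sum>a\<in>UNIV. inner (p a) (p b) *\<^sub>R w a)
        = (\<Sum>a\<in>UNIV. (- 1 / ?n) *\<^sub>R w a + (if a = b then (?N / ?n) *\<^sub>R w b else 0))"
    proof (intro sum.cong refl)
      fix a
      have "- 1 / ?n + ?N / ?n = 1" using n by (simp add: add_divide_distrib)
      then have "(- 1 / ?n) *\<^sub>R w b + (?N / ?n) *\<^sub>R w b = w b"
        by (simp only: scaleR_left_distrib[symmetric]) simp
      then show "inner (p a) (p b) *\<^sub>R w a = (- 1 / ?n) *\<^sub>R w a + (if a = b then (?N / ?n) *\<^sub>R w b else 0)"
        by (cases "a = b") (simp_all add: gram)
    qed
    also have "\<dots> = (- 1 / ?n) *\<^sub>R s + (?N / ?n) *\<^sub>R w b"
      unfolding sum.distrib s_def scaleR_sum_right[symmetric] by simp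
    finally have "L (p b) = (?n / ?N) *\<^sub>R ((- 1 / ?n) *\<^sub>R s + (?N / ?n) *\<^sub>R w b)" by (simp add: L_def)
    also have "\<dots> = w b - (1 / ?N) *\<^sub>R s" using n by (simp add: scaleR_right_distrib scaleR_right_diff_distrib)
    finally show ?thesis .
  qed
  \<comment> \<open>The exact Gram matrix has entry sum 0, so the squared norm of \<open>s\<close>
    is the sum of the errors. This is where the second square root is lost.\<close>
  have s_le: "norm s \<le> ?N * sqrt h"
  proof -
    have "(norm s)\<^sup>2 = (\<Sum>a\<in>UNIV. \<Sum>b\<in>UNIV. inner (p a) (p b) + E a b)"
      unfolding power2_norm_eq_inner s_def E_def by (simp add: inner_sum_sum)
    also have "\<dots> = inner (\<Sum>a\<in>UNIV. p a) (\<Sum>a\<in>UNIV. p a) + (\<Sum>a\<in>UNIV. \<Sum>b\<in>UNIV. E a b)"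
      by (simp only: sum.distrib inner_sum_sum)
    also have "\<dots> \<le> (\<Sum>a\<in>(UNIV :: 'n option set). \<Sum>b\<in>(UNIV :: 'n option set). h)"
    proof -
      have "E a b \<le> h" for a b using E[of a b] by linarith
      then show ?thesis by (simp only: sum_p inner_zero_left add_0_left) (intro sum_mono)
    qed
    also have "\<dots> = ?N * ?N * h" by (simp add: algebra_simps)
    also have "\<dots> = (?N * sqrt h)\<^sup>2"
      by (simp only: power_mult_distrib real_sqrt_pow2[OF h0] power2_eq_square[of ?N])
    finally have sq: "(norm s)\<^sup>2 \<le> (?N * sqrt h)\<^sup>2" .
    have "0 \<le> ?N * sqrt h" using h0 by simp
    with sq show ?thesis by (rule power2_le_imp_le)
  qed
  show ?thesis
  proof (rule that[of "\<lambda>a. Q (p a)"])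
    show "simplex_normals (\<lambda>a. Q (p a))"
      by (rule simplex_normals.intro) (simp only: QQ gram)
    fix a
    have "Q (p a) - w a = (Q (p a) - L (p a)) - (1 / ?N) *\<^sub>R s" by (simp add: Lp)
    then have "norm (Q (p a) - w a) \<le> norm (Q (p a) - L (p a)) + norm ((1 / ?N) *\<^sub>R s)"
      by (simp only: norm_triangle_ineq4)
    also have "norm (Q (p a) - L (p a)) \<le> ?n\<^sup>2 * h" using QL[of "p a"] norm_p[of a] by simp
    also have "norm ((1 / ?N) *\<^sub>R s) \<le> sqrt h" using s_le by (simp add: divide_le_eq mult.commute)
    finally show "norm (Q (p a) - w a) \<le> ?n\<^sup>2 * h + sqrt h" by simp
  qed
qed

end

text \<open>A vector with nonnegative coordinates and both sums equal to 1 is a basis vector. This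
  is the quantitative form, linear in the distance: \<open>sqrt (2 - 2 * z k0)\<close> is the
  distance of \<open>z\<close> from the basis vector \<open>k0\<close>, and a negative coordinate of
  comparable size must exist. The positive coordinates other than \<open>k0\<close> sum to half the
  squared distance plus the negative mass \<open>q\<close>, which is too little for the sum of
  squares unless \<open>q\<close> is large.\<close>

lemma sum_one_sum_squares_one:
  fixes z :: "'m::finite \<Rightarrow> real"
  assumes s1: "(\<Sum>k\<in>UNIV. z k) = 1" and s2: "(\<Sum>k\<in>UNIV. (z k)\<^sup>2) = 1" and n: "CARD('m) = Suc n" "n \<ge> 1"
  obtains k0 k where "z k0 \<le> 1" "z k0 > 0" "\<forall>a. a \<noteq> k0 \<longrightarrow> \<bar>z a\<bar> \<le> sqrt (2 - 2 * z k0)"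
    "sqrt (2 - 2 * z k0) \<le> 8 * real n * (- z k)"
proof -
  have fin: "finite (range z)" "range z \<noteq> {}" by auto
  obtain k0 where "Max (range z) = z k0" using Max_in[OF fin] by (rule rangeE)
  then have k0: "z k \<le> z k0" for k using Max_ge[OF fin(1)] by simp
  obtain k where "Min (range z) = z k" using Min_in[OF fin] by (rule rangeE)
  then have k: "z k \<le> z a" for a using Min_le[OF fin(1)] by simp
  have le1: "\<bar>z a\<bar> \<le> 1" for a
  proof -
    have "(z a)\<^sup>2 \<le> (\<Sum>k\<in>UNIV. (z k)\<^sup>2)" by (intro member_le_sum) auto
    then show ?thesis using s2 by (simp add: abs_square_le_1)
  qed
  have pos: "z k0 > 0"
  proof (rule ccontr)
    assume "\<not> z k0 > 0"
    then have "(\<Sum>k\<in>UNIV. z k) \<le> 0" using order_trans[OF k0] by (intro sum_nonpos) auto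
    then show False using s1 by simp
  qed
  define D where "D = sqrt (2 - 2 * z k0)"
  have D2: "D\<^sup>2 = 2 - 2 * z k0" and D0: "D \<ge> 0" using le1[of k0] by (auto simp: D_def)
  define A where "A = UNIV - {k0}"
  have A: "finite A" "card A = n" "k0 \<notin> A" by (auto simp: A_def n card_Diff_singleton)
  have sA1: "(\<Sum>a\<in>A. z a) = 1 - z k0" and sA2: "(\<Sum>a\<in>A. (z a)\<^sup>2) = 1 - (z k0)\<^sup>2"
    using sum.remove[of UNIV k0 z] sum.remove[of UNIV k0 "\<lambda>a. (z a)\<^sup>2"] s1 s2 by (auto simp: A_def)
  have sA2': "D\<^sup>2 / 2 \<le> (\<Sum>a\<in>A. (z a)\<^sup>2)" "(\<Sum>a\<in>A. (z a)\<^sup>2) \<le> D\<^sup>2"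
  proof -
    have "1 - (z k0)\<^sup>2 = (1 - z k0) * (1 + z k0)" by (simp add: power2_eq_square algebra_simps)
    moreover have "(1 - z k0) * 1 \<le> (1 - z k0) * (1 + z k0)"
      using le1[of k0] pos by (intro mult_left_mono) auto
    moreover have "(1 - z k0) * (1 + z k0) \<le> (1 - z k0) * 2"
      using le1[of k0] pos by (intro mult_left_mono) auto
    ultimately show "D\<^sup>2 / 2 \<le> (\<Sum>a\<in>A. (z a)\<^sup>2)" "(\<Sum>a\<in>A. (z a)\<^sup>2) \<le> D\<^sup>2" by (auto simp: sA2 D2)
  qed
  have each: "\<bar>z a\<bar> \<le> D" if "a \<noteq> k0" for a
  proof -
    have "(z a)\<^sup>2 \<le> (\<Sum>a\<in>A. (z a)\<^sup>2)" using A that by (intro member_le_sum) (auto simp: A_def)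
    then have "(z a)\<^sup>2 \<le> D\<^sup>2" using sA2' by linarith
    then show ?thesis using D0 abs_le_square_iff[of "z a" D] by simp
  qed
  define \<delta> where "\<delta> = max 0 (- z k)"
  have d: "\<delta> \<ge> 0" by (simp add: \<delta>_def)
  have da: "- \<delta> \<le> z a" for a
  proof -
    have "- \<delta> \<le> z k" by (simp add: \<delta>_def)
    then show ?thesis using k[of a] by linarith
  qed
  define P where "P = {a \<in> A. z a \<ge> 0}"
  define M where "M = A - P"
  have PM: "finite P" "finite M" "P \<subseteq> A" "M = A - P" "\<And>a. a \<in> P \<Longrightarrow> z a \<ge> 0" "\<And>a. a \<in> M \<Longrightarrow> z a < 0"
    using A by (auto simp: P_def M_def)
  define q where "q = (\<Sum>a\<in>M. - z a)"
  have q0: "q \<ge> 0" unfolding q_def using PM(6) by (intro sum_nonneg) (auto simp: less_imp_le)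
  have q: "q \<le> real n * \<delta>"
  proof -
    have "q \<le> (\<Sum>a\<in>M. \<delta>)" unfolding q_def
    proof (intro sum_mono)
      fix a show "- z a \<le> \<delta>" using da[of a] by linarith
    qed
    also have "\<dots> = real (card M) * \<delta>" by simp
    also have "\<dots> \<le> real n * \<delta>"
      using card_mono[of A M] A d by (intro mult_right_mono) (auto simp: M_def)
    finally show ?thesis .
  qed
  have sP: "(\<Sum>a\<in>P. z a) = D\<^sup>2 / 2 + q"
    using sum.subset_diff[OF PM(3) A(1), of z] sA1 by (simp add: q_def sum_negf M_def[symmetric] D2 diff_divide_distrib)
  have sq_le: "(\<Sum>a\<in>B. (f a)\<^sup>2) \<le> (\<Sum>a\<in>B. f a)\<^sup>2" if "finite B" "\<And>a. a \<in> B \<Longrightarrow> f a \<ge> 0" for B and f :: "'m \<Rightarrow> real"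
  proof -
    have "(\<Sum>a\<in>B. (f a)\<^sup>2) \<le> (\<Sum>a\<in>B. f a * (\<Sum>b\<in>B. f b))"
      unfolding power2_eq_square using that by (intro sum_mono mult_left_mono member_le_sum) auto
    then show ?thesis by (simp add: sum_distrib_right[symmetric] power2_eq_square)
  qed
  have "(\<Sum>a\<in>A. (z a)\<^sup>2) = (\<Sum>a\<in>M. (- z a)\<^sup>2) + (\<Sum>a\<in>P. (z a)\<^sup>2)"
    using sum.subset_diff[OF PM(3) A(1), of "\<lambda>a. (z a)\<^sup>2"] by (simp add: M_def)
  also have "\<dots> \<le> q\<^sup>2 + (D\<^sup>2 / 2 + q)\<^sup>2"
    unfolding q_def sP[symmetric, unfolded q_def] using PM by (intro add_mono sq_le) (auto simp: less_imp_le)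
  finally have main: "D\<^sup>2 / 2 \<le> q\<^sup>2 + (D\<^sup>2 / 2 + q)\<^sup>2" using sA2'(1) by linarith
  have "D \<le> 8 * (real n * \<delta>)"
  proof -
    have "D \<le> 8 * q"
    proof (rule ccontr)
      assume "\<not> D \<le> 8 * q"
      then have "q < D / 8" by simp
      have D2le: "D\<^sup>2 \<le> 2" using D2 pos by simp
      have Dle: "D \<le> 3 / 2"
      proof (rule ccontr)
        assume "\<not> D \<le> 3 / 2"
        then have "(3 / 2)\<^sup>2 < D\<^sup>2" by (intro power_strict_mono) auto
        then show False using D2le by (simp add: power2_eq_square)
      qed
      show False
      \<comment> \<open>For small \<open>D\<close> the term \<open>D\<^sup>2 / 2\<close> in
        \<open>main\<close> is negligible against \<open>D\<close>, and \<open>main\<close> itself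
        is violated. For large \<open>D\<close> this comparison fails, and another identity takes
        its place.\<close>
      proof (cases "D\<^sup>2 \<le> 1 / 2")
        case True
        have Dpos: "D > 0" using \<open>q < D / 8\<close> q0 by simp
        have "q\<^sup>2 \<le> (D / 8)\<^sup>2" using q0 \<open>q < D / 8\<close> by (intro power_mono) auto
        then have q2: "q\<^sup>2 \<le> D\<^sup>2 / 64" by (simp add: power_divide)
        have "(D\<^sup>2 / 2 + q)\<^sup>2 \<le> 2 * (D\<^sup>2 / 2)\<^sup>2 + 2 * q\<^sup>2"
          using zero_le_power2[of "D\<^sup>2 / 2 - q"] by (simp add: power2_eq_square algebra_simps)
        also have "(D\<^sup>2 / 2)\<^sup>2 = D\<^sup>2 * D\<^sup>2 / 4" by (simp add: power2_eq_square)
        also have "\<dots> \<le> D\<^sup>2 * (1 / 2) / 4" using True by (intro divide_right_mono mult_left_mono) auto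
        finally have "(D\<^sup>2 / 2 + q)\<^sup>2 \<le> D\<^sup>2 / 4 + D\<^sup>2 / 32" using q2 by linarith
        then have "D\<^sup>2 / 2 \<le> D\<^sup>2 / 64 + D\<^sup>2 / 4 + D\<^sup>2 / 32" using main q2 by linarith
        then show False using Dpos by simp
      next
        case False
        \<comment> \<open>As \<open>z k0\<close> is the largest coordinate, only negative
          coordinates contribute negative terms, each at least twice the coordinate.\<close>
        have neg: "(\<Sum>a\<in>UNIV. z a * (z k0 - z a)) = - D\<^sup>2 / 2"
          using s1 s2 by (simp add: right_diff_distrib sum_subtractf sum_distrib_right[symmetric] power2_eq_square[symmetric] D2)
        have "- (\<Sum>a\<in>UNIV. z a * (z k0 - z a)) \<le> (\<Sum>a\<in>M. (- z a) * 2)"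
        proof -
          have "(\<Sum>a\<in>M. z a * (z k0 - z a)) \<le> (\<Sum>a\<in>UNIV. z a * (z k0 - z a))"
            using k0 pos by (intro sum_mono2) (auto simp: M_def P_def A_def)
          moreover have "(\<Sum>a\<in>M. z a * 2) \<le> (\<Sum>a\<in>M. z a * (z k0 - z a))"
          proof (intro sum_mono mult_left_mono_neg)
            fix a assume "a \<in> M"
            then show "z a \<le> 0" using PM(6) by (auto simp: less_imp_le)
            show "z k0 - z a \<le> 2" using le1[of k0] le1[of a] by (simp add: abs_le_iff)
          qed
          ultimately show ?thesis by (simp add: sum_negf)
        qed
        also have "\<dots> = 2 * q" by (simp add: q_def sum_distrib_left mult.commute)
        finally have "D\<^sup>2 / 4 \<le> q" unfolding neg by simp
        moreover have "D / 8 \<le> D\<^sup>2 / 4"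
        proof -
          have "D \<ge> 1 / 2"
          proof (rule ccontr)
            assume "\<not> D \<ge> 1 / 2"
            then have "D\<^sup>2 \<le> (1 / 2)\<^sup>2" using D0 by (intro power_mono) auto
            then show False using False by (simp add: power2_eq_square)
          qed
          then have "D * (1 / 2) \<le> D * D" using D0 by (intro mult_left_mono) auto
          then show ?thesis by (simp add: power2_eq_square)
        qed
        ultimately show False using \<open>q < D / 8\<close> by linarith
      qed
    qed
    then show ?thesis using q by linarith
  qed
  then have "D \<le> 8 * real n * (- z k)"
  proof (cases "z k \<le> 0")
    case True
    then show ?thesis using \<open>D \<le> 8 * (real n * \<delta>)\<close> by (simp add: \<delta>_def)
  next
    case False
    \<comment> \<open>If all coordinates are positive, then \<delta> and therefore \<open>D\<close>
      are 0, and every coordinate other than \<open>k0\<close> vanishes, a contradiction.\<close>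
    then have lp: "z a > 0" for a using k[of a] by linarith
    then have "q = 0" using PM(6) lp by (auto simp: q_def M_def P_def less_imp_le)
    moreover have "D = 0" using \<open>D \<le> 8 * (real n * \<delta>)\<close> False D0 by (simp add: \<delta>_def)
    moreover obtain a where "a \<in> A" using A(2) n(2) by (metis card.empty ex_in_conv not_one_le_zero)
    ultimately show ?thesis using each[of a] lp[of a] by (auto simp: A_def)
  qed
  then show ?thesis using that[of k0 k] le1[of k0] pos each by (auto simp: D_def)
qed

section \<open>The cone over the simplex, its normalization, and caps\<close>

context simplex_normals
begin

lemma sum_lift_unit_height:
  "(\<Sum>k\<in>UNIV. inner (lift_unit (p (inv lift_dir k))) (lift_vec t x)) = sqrt (real CARD('n) + 1) * t"
proof -
  let ?n = "real CARD('n)" and ?N = "real CARD('n) + 1"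
  have "(\<Sum>k\<in>UNIV. inner (lift_unit (p (inv lift_dir k))) (lift_vec t x))
      = (\<Sum>a\<in>UNIV. t / sqrt ?N - sqrt ?n / sqrt ?N * inner (p a) x)"
    using sum_option_lift_index[of "\<lambda>a. inner (lift_unit (p a)) (lift_vec t x)"]
    by (simp add: lift_unit_def inner_lift_vec)
  also have "\<dots> = (\<Sum>a\<in>(UNIV :: 'n option set). t / sqrt ?N) - sqrt ?n / sqrt ?N * (\<Sum>a\<in>UNIV. inner (p a) x)"
    by (simp only: sum_subtractf sum_distrib_left)
  also have "(\<Sum>a\<in>UNIV. inner (p a) x) = 0" by (simp add: inner_sum_left[symmetric] sum_p)
  also have "(\<Sum>a\<in>(UNIV :: 'n option set). t / sqrt ?N) = ?N * (t / sqrt ?N)" by (simp add: add.commute)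
  also have "?N * (t / sqrt ?N) - sqrt ?n / sqrt ?N * 0 = sqrt ?N * t"
  proof -
    have "(S * S) * (t / S) = S * t" if "S \<noteq> 0" for S :: real using that by simp
    from this[of "sqrt ?N"] show ?thesis by simp
  qed
  finally show ?thesis .
qed

text \<open>The lifted normals sum to a positive multiple of the axis, so a point of the orthant has
  nonnegative height, and height 0 makes all its coordinates vanish. Only the apex is lost by
  demanding positive height.\<close>

lemma lift_cone_hull_body:
  "{y. \<forall>k. inner (lift_unit (p (inv lift_dir k))) y \<ge> 0} = insert 0 (lift_cone hull_body)"
proof (rule set_eqI)
  fix y :: "real ^ 'n lift_index"
  obtain t x where y: "y = lift_vec t x" by (rule lift_vec_cases)
  let ?v = "\<lambda>k. lift_unit (p (inv lift_dir k))"
  have all: "(\<forall>k. P (inv lift_dir k)) \<longleftrightarrow> (\<forall>a. P a)" for P :: "'n option \<Rightarrow> bool"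
    using bij_is_surj[OF bij_imp_bij_inv[OF bij_lift_dir]] by (metis surjD)
  show "y \<in> {y. \<forall>k. inner (?v k) y \<ge> 0} \<longleftrightarrow> y \<in> insert 0 (lift_cone hull_body)"
  proof (cases "t > 0")
    case True
    have "y \<noteq> 0"
    proof
      assume "y = 0"
      then have "y $ lift_dir None = 0" by simp
      then show False using True by (simp add: y)
    qed
    moreover have "(\<forall>k. inner (?v k) y \<ge> 0) \<longleftrightarrow> (\<forall>a. inner (lift_unit (p a)) y \<ge> 0)" by (rule all)
    moreover have "inner (lift_unit (p a)) y \<ge> 0 \<longleftrightarrow> inner ((sqrt (real CARD('n)) / t) *\<^sub>R x) (p a) \<le> 1" for a
      using True unfolding y inner_lift_unit_lift_vec[OF True] by (simp add: zero_le_mult_iff zero_le_divide_iff)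
    ultimately show ?thesis
      using True by (simp add: y lift_vec_in_lift_cone hull_body_def)
  next
    case False
    have "y = 0" if nonneg: "\<forall>k. inner (?v k) y \<ge> 0"
    proof -
      have "(\<Sum>k\<in>UNIV. inner (?v k) y) \<le> 0"
        using False by (simp add: y sum_lift_unit_height mult_nonneg_nonpos)
      then have "(\<Sum>k\<in>UNIV. inner (?v k) y) = 0"
        using nonneg by (intro antisym sum_nonneg) auto
      then have "inner (?v k) y = 0" for k
        using nonneg by (subst (asm) sum_nonneg_eq_0_iff) auto
      then have "(norm y)\<^sup>2 = 0"
        using orthonormal_parseval[OF orthonormal_lift_unit, of y] by simp
      then show "y = 0" by simp
    qed
    moreover have "y \<notin> lift_cone hull_body" using False by (simp add: y lift_vec_in_lift_cone)
    ultimately show ?thesis by auto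
  qed
qed

lemma closed_hull_body: "closed hull_body"
proof -
  have "hull_body = (\<Inter>a. {x. inner (p a) x \<le> 1})" by (auto simp: hull_body_def inner_commute)
  then show ?thesis by (simp add: closed_INT closed_halfspace_le)
qed

text \<open>Up to the apex the lifted cone is an orthant in an orthonormal frame, over which the
  exponential has integral 1. This identifies \<open>slice_const\<close> as the reciprocal of the
  volume of a regular circumscribed simplex.\<close>

lemma slice_const_hull_body: "slice_const TYPE('n) * emeasure lborel hull_body = 1"
proof -
  let ?v = "\<lambda>k. lift_unit (p (inv lift_dir k))"
  have height: "sqrt (real CARD('n) + 1) * inner (lift_vec 1 0) y = (\<Sum>k\<in>UNIV. inner (?v k) y)" for y
    by (cases y rule: lift_vec_cases) (simp add: sum_lift_unit_height inner_lift_vec)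
  have "slice_const TYPE('n) * emeasure lborel hull_body
      = (\<integral>\<^sup>+y. ennreal (exp (- sqrt (real CARD('n) + 1) * inner (lift_vec 1 0) y)) * indicator (lift_cone hull_body) y \<partial>lborel)"
    using closed_hull_body by (intro nn_integral_lift_cone[symmetric]) auto
  also have "\<dots> = (\<integral>\<^sup>+y. ennreal (exp (- (\<Sum>k\<in>UNIV. inner (?v k) y))) * indicator {y. \<forall>k. inner (?v k) y \<ge> 0} y \<partial>lborel)"
  proof (rule nn_integral_cong_AE)
    show "AE y in lborel. ennreal (exp (- sqrt (real CARD('n) + 1) * inner (lift_vec 1 0) y)) * indicator (lift_cone hull_body) y
        = ennreal (exp (- (\<Sum>k\<in>UNIV. inner (?v k) y))) * indicator {y. \<forall>k. inner (?v k) y \<ge> 0} y"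
      using AE_lborel_singleton[of 0]
    proof eventually_elim
      case (elim y)
      then show ?case unfolding lift_cone_hull_body by (simp add: height[symmetric] indicator_def)
    qed
  qed
  also have "\<dots> = 1" by (rule nn_integral_exp_orthant[OF orthonormal_lift_unit])
  finally show ?thesis .
qed

lemma hull_body_subset_cball: "hull_body \<subseteq> cball 0 (real CARD('n))"
  unfolding hull_body_eq by (intro hull_minimal convex_cball) (auto simp: vertex_def norm_p)

text \<open>The lifted unit normal of a cap has coordinates \<open>z k\<close> in the orthonormal frame of the simplex; the box used to
  bound the cap from below is thin only in the direction of the largest coordinate.\<close>

lemma cap_volume_ge:
  assumes n: "CARD('n) \<ge> 3" and u: "norm u = 1"
  obtains a where "ennreal (norm (lift_unit u - lift_unit (p a)) / (54 * (16 * (real CARD('n))\<^sup>2) ^ CARD('n)))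
    \<le> slice_const TYPE('n) * emeasure lborel (hull_body \<inter> {x. inner x u > 1})"
proof -
  let ?n = "real CARD('n)"
  have n0: "?n \<ge> 3" using n by simp
  define v where "v k = lift_unit (p (inv lift_dir k))" for k
  have v: "inner (v k) (v l) = (if k = l then 1 else 0)" for k l
    unfolding v_def by (rule orthonormal_lift_unit)
  define z where "z k = inner (v k) (lift_unit u)" for k
  have unit_u: "norm (lift_unit u) = 1" using u by (simp add: norm_eq_1 inner_lift_unit)
  have z1: "(\<Sum>k\<in>UNIV. z k) = 1"
    unfolding z_def v_def lift_unit_def[of u] sum_lift_unit_height by simp
  have z2: "(\<Sum>k\<in>UNIV. (z k)\<^sup>2) = 1"
    using orthonormal_parseval[OF v, of "lift_unit u"] unit_u by (simp add: z_def)
  have cN: "CARD('n lift_index) = Suc CARD('n)" by (simp add: card_lift_index)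
  have cn: "CARD('n) \<ge> 1" using n by linarith
  obtain k0 k where k: "z k0 \<le> 1" "z k0 > 0" "\<forall>a. a \<noteq> k0 \<longrightarrow> \<bar>z a\<bar> \<le> sqrt (2 - 2 * z k0)"
    "sqrt (2 - 2 * z k0) \<le> 8 * ?n * (- z k)"
    using sum_one_sum_squares_one[OF z1 z2 cN cn] .
  define D where "D = sqrt (2 - 2 * z k0)"
  have nsq: "(norm (lift_unit u - v k0))\<^sup>2 = 2 - 2 * z k0"
    using unit_u v[of k0 k0]
    by (simp add: power2_norm_eq_inner inner_diff_left inner_diff_right norm_eq_1 z_def inner_commute[of "lift_unit u" "v k0"])
  have Dn: "norm (lift_unit u - v k0) = D" unfolding D_def nsq[symmetric] by simp
  have D0: "D \<ge> 0" using k(1) by (simp add: D_def)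
  let ?B = "16 * ?n\<^sup>2"
  have B: "?B > 0" using n0 by simp
  show ?thesis
  proof (cases "D = 0")
    case True
    show ?thesis by (rule that[of "inv lift_dir k0"]) (use True Dn in \<open>simp add: v_def\<close>)
  next
    case False
    define \<delta> where "\<delta> = - z k"
    have d: "D \<le> 8 * ?n * \<delta>" using k(4) by (simp add: D_def \<delta>_def)
    have d0: "\<delta> > 0"
    proof (rule ccontr)
      assume "\<not> \<delta> > 0"
      then have "8 * ?n * \<delta> \<le> 0" by (intro mult_nonneg_nonpos) auto
      then show False using d D0 False by linarith
    qed
    have d1: "\<delta> \<le> 1"
    proof -
      have "(z k)\<^sup>2 \<le> (\<Sum>k\<in>UNIV. (z k)\<^sup>2)" by (intro member_le_sum) auto
      then show ?thesis using z2 by (simp add: \<delta>_def abs_square_le_1 abs_le_iff)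
    qed
    have kk0: "k \<noteq> k0" using d0 k(2) by (auto simp: \<delta>_def)
    define a where "a i = (if i = k then 1 else 0 :: real)" for i
    \<comment> \<open>Coordinate \<open>k\<close> exceeds 1 and contributes at most -\<delta> to the
      inner product with the lift of \<open>u\<close>. Coordinate \<open>k0\<close> contributes at
      most \<delta> / 4, and the remaining n - 1 together at most \<delta> / 2, because
      \<open>D\<close> is at most 8 n \<delta>. The inner product is thus negative on the whole box,
      which puts the box into the cone over the cap.\<close>
    define b where "b i = (if i = k then 2 else if i = k0 then \<delta> / 4 else 1 / ?B)" for i
    have ab: "a i \<le> b i" for i using d0 B by (simp add: a_def b_def)
    define I where "I = UNIV - {k, k0}"
    have I: "finite I" "card I = CARD('n) - 1" "k \<notin> I" "k0 \<notin> I"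
      using kk0 by (auto simp: I_def card_Diff_subset card_lift_index)
    have split: "(\<Sum>i\<in>UNIV. g i) = g k + g k0 + (\<Sum>i\<in>I. g i)" for g :: "_ \<Rightarrow> real"
    proof -
      have U: "UNIV = insert k (insert k0 I)" by (auto simp: I_def)
      show ?thesis unfolding U using I kk0 by (simp add: add.assoc)
    qed
    have split_prod: "(\<Prod>i\<in>UNIV. g i) = g k * g k0 * (\<Prod>i\<in>I. g i)" for g :: "_ \<Rightarrow> real"
    proof -
      have U: "UNIV = insert k (insert k0 I)" by (auto simp: I_def)
      show ?thesis unfolding U using I kk0 by (simp add: mult.assoc)
    qed
    have cardI: "real (card I) = ?n - 1" using I(2) n by (simp add: of_nat_diff)
    have box: "y \<in> lift_cone (hull_body \<inter> {x. inner x u > 1})"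
      if y: "\<And>i. a i < inner (v i) y \<and> inner (v i) y < b i" for y
    proof -
      have ypos: "inner (v i) y > 0" for i using y[of i] by (auto simp: a_def split: if_splits)
      have "y \<noteq> 0" using ypos[of k] by auto
      then have hb: "y \<in> lift_cone hull_body"
      proof -
        have "y \<in> {y. \<forall>k. inner (lift_unit (p (inv lift_dir k))) y \<ge> 0}"
          using ypos by (simp add: v_def less_imp_le)
        then show ?thesis unfolding lift_cone_hull_body using \<open>y \<noteq> 0\<close> by blast
      qed
      obtain t x where yt: "y = lift_vec t x" by (rule lift_vec_cases)
      have t: "t > 0" using hb by (simp add: yt lift_vec_in_lift_cone)
      have "inner (lift_unit u) y = (\<Sum>i\<in>UNIV. z i * inner (v i) y)"
      proof -
        let ?P = "\<lambda>x. \<Sum>i\<in>UNIV. (inner (v i) x)\<^sup>2"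
        have "?P (lift_unit u + y) = ?P (lift_unit u) + ?P y + 2 * (\<Sum>i\<in>UNIV. z i * inner (v i) y)"
          by (simp add: inner_add_right power2_sum sum.distrib sum_distrib_left mult.assoc z_def)
        moreover have "(norm (lift_unit u + y))\<^sup>2 = (norm (lift_unit u))\<^sup>2 + (norm y)\<^sup>2 + 2 * inner (lift_unit u) y"
          by (simp add: power2_norm_eq_inner inner_add_left inner_add_right inner_commute)
        ultimately show ?thesis unfolding orthonormal_parseval[OF v] by linarith
      qed
      also have "\<dots> = z k * inner (v k) y + z k0 * inner (v k0) y + (\<Sum>i\<in>I. z i * inner (v i) y)" by (rule split)
      also have "\<dots> < 0"
      proof -
        have "\<delta> * 1 \<le> \<delta> * inner (v k) y" using y[of k] d0 by (intro mult_left_mono) (auto simp: a_def)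
        moreover have "z k0 * inner (v k0) y \<le> 1 * (\<delta> / 4)"
          using y[of k0] ypos[of k0] kk0 k(1,2) by (intro mult_mono) (auto simp: b_def)
        moreover have "(\<Sum>i\<in>I. z i * inner (v i) y) \<le> (\<Sum>i\<in>I. D * (1 / ?B))"
        proof (intro sum_mono)
          fix i assume i: "i \<in> I"
          then have ii: "i \<noteq> k" "i \<noteq> k0" using I by auto
          have "z i * inner (v i) y \<le> D * inner (v i) y"
            using k(3)[rule_format, OF ii(2)] ypos[of i] by (intro mult_right_mono) (auto simp: D_def)
          also have "\<dots> \<le> D * (1 / ?B)" using y[of i] ii D0 by (intro mult_left_mono) (auto simp: b_def)
          finally show "z i * inner (v i) y \<le> D * (1 / ?B)" .
        qed
        moreover have "(\<Sum>i\<in>I. D * (1 / ?B)) \<le> \<delta> / 2"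
        proof -
          have "(\<Sum>i\<in>I. D * (1 / ?B)) = (?n - 1) * D / ?B" using cardI by simp
          also have "\<dots> \<le> ?n * (8 * ?n * \<delta>) / ?B"
            using d D0 n0 B by (intro divide_right_mono mult_mono) auto
          also have "\<dots> = \<delta> / 2" using n0 by (simp add: power2_eq_square field_simps)
          finally show ?thesis .
        qed
        moreover have "z k * inner (v k) y = - (\<delta> * inner (v k) y)" by (simp add: \<delta>_def)
        ultimately show ?thesis using d0 by linarith
      qed
      finally have "inner (lift_unit u) y < 0" .
      then have "1 - inner ((sqrt ?n / t) *\<^sub>R x) u < 0"
        unfolding yt inner_lift_unit_lift_vec[OF t] using t by (simp add: mult_less_0_iff zero_less_divide_iff divide_less_0_iff)
      then show ?thesis using hb by (simp add: yt lift_vec_in_lift_cone)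
    qed
    have "54 * ?B ^ CARD('n) > 0" using B by simp
    \<comment> \<open>The exponent is at most 3, and exp 3 <= 27. The box has n - 1 sides of length
      1 / \<open>?B\<close>; the one further factor \<open>?B\<close> absorbs the passage from
      \<delta> to \<open>D\<close>.\<close>
    have real_bound: "D / (54 * ?B ^ CARD('n)) \<le> exp (- (\<Sum>i\<in>UNIV. b i)) * (\<Prod>i\<in>UNIV. b i - a i)"
    proof -
      have "(\<Sum>i\<in>UNIV. b i) = 2 + \<delta> / 4 + (\<Sum>i\<in>I. b i)" unfolding split using kk0 by (simp add: b_def)
      also have "(\<Sum>i\<in>I. b i) = (\<Sum>i\<in>I. 1 / ?B)" using I by (intro sum.cong) (auto simp: b_def)
      also have "\<dots> = (?n - 1) / ?B" using cardI by simp
      also have "(?n - 1) / ?B \<le> ?n\<^sup>2 / ?B"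
      proof (rule divide_right_mono)
        have "?n * 1 \<le> ?n * ?n" using n0 by (intro mult_left_mono) auto
        then show "?n - 1 \<le> ?n\<^sup>2" unfolding power2_eq_square by linarith
      qed simp
      also have "?n\<^sup>2 / ?B = 1 / 16" using n0 by simp
      finally have "(\<Sum>i\<in>UNIV. b i) \<le> 3" using d1 by simp
      then have e3: "exp (- 3) \<le> exp (- (\<Sum>i\<in>UNIV. b i))" by simp
      have "exp (3 :: real) = exp 1 ^ 3" by (simp add: exp_of_nat_mult[symmetric])
      also have "\<dots> \<le> 3 ^ 3" using exp_le by (intro power_mono) auto
      finally have "1 / 27 \<le> exp (- 3 :: real)" by (simp add: exp_minus inverse_eq_divide frac_le)
      then have e: "1 / 27 \<le> exp (- (\<Sum>i\<in>UNIV. b i))" using e3 by linarith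
      have prod: "(\<Prod>i\<in>UNIV. b i - a i) = \<delta> / 4 * (1 / ?B) ^ (CARD('n) - 1)"
      proof -
        have "(\<Prod>i\<in>I. b i - a i) = (\<Prod>i\<in>I. 1 / ?B)" using I by (intro prod.cong) (auto simp: a_def b_def)
        then show ?thesis unfolding split_prod using kk0 I(2) by (simp add: a_def b_def)
      qed
      have Bp: "?B ^ CARD('n) = ?B * ?B ^ (CARD('n) - 1)" using n by (simp add: power_eq_if)
      have "D / (54 * ?B ^ CARD('n)) \<le> (8 * ?n * \<delta>) / (54 * ?B ^ CARD('n))"
        using d B by (intro divide_right_mono) auto
      also have "\<dots> = (8 * ?n * \<delta> / (54 * ?B)) * (1 / ?B) ^ (CARD('n) - 1)"
        unfolding Bp by (simp add: power_one_over)
      also have "\<dots> \<le> (1 / 27 * (\<delta> / 4)) * (1 / ?B) ^ (CARD('n) - 1)"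
      proof (rule mult_right_mono)
        have "8 * ?n * \<delta> / (54 * ?B) = \<delta> / (108 * ?n)" using n0 by (simp add: power2_eq_square field_simps)
        also have "\<dots> \<le> \<delta> / (108 * 1)" using n0 d0 by (intro divide_left_mono) auto
        finally show "8 * ?n * \<delta> / (54 * ?B) \<le> 1 / 27 * (\<delta> / 4)" by simp
      qed (use B in simp)
      also have "\<dots> = 1 / 27 * (\<Prod>i\<in>UNIV. b i - a i)" unfolding prod by simp
      also have "\<dots> \<le> exp (- (\<Sum>i\<in>UNIV. b i)) * (\<Prod>i\<in>UNIV. b i - a i)"
        using e ab by (intro mult_right_mono prod_nonneg) auto
      finally show ?thesis .
    qed
    have height: "sqrt (real CARD('n) + 1) * inner (lift_vec 1 0) y = (\<Sum>k\<in>UNIV. inner (v k) y)" for y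
      by (cases y rule: lift_vec_cases) (simp add: sum_lift_unit_height v_def inner_lift_vec)
    have borel: "hull_body \<inter> {x. inner x u > 1} \<in> sets borel"
      using closed_hull_body by auto
    have "ennreal (D / (54 * ?B ^ CARD('n))) \<le> ennreal (exp (- (\<Sum>i\<in>UNIV. b i)) * (\<Prod>i\<in>UNIV. b i - a i))"
      by (rule ennreal_leI[OF real_bound])
    also have "\<dots> \<le> (\<integral>\<^sup>+y. ennreal (exp (- (\<Sum>i\<in>UNIV. inner (v i) y))) * indicator (lift_cone (hull_body \<inter> {x. inner x u > 1})) y \<partial>lborel)"
      by (rule nn_integral_exp_rotated_box_ge[OF v ab box])
    also have "\<dots> = slice_const TYPE('n) * emeasure lborel (hull_body \<inter> {x. inner x u > 1})"
      unfolding nn_integral_lift_cone[OF borel, symmetric] by (simp add: height)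
    finally show ?thesis
      by (intro that[of "inv lift_dir k0"]) (simp add: Dn[unfolded v_def])
  qed
qed

end

subsection \<open>Distances on the sphere\<close>

text \<open>The chord is twice the sine of half the angle, and sin x >= x / 2 up to pi / 2. For the
  latter, cos >= 1 / 2 up to pi / 3, while beyond that sin x >= sqrt 3 / 2, which is larger than pi
  / 4.\<close>

lemma geodesic_dist_le_norm:
  fixes u v :: "real ^ 'n"
  assumes "norm u = 1" "norm v = 1"
  shows "geodesic_dist u v \<le> 2 * norm (u - v)"
proof -
  let ?\<theta> = "geodesic_dist u v"
  have i: "\<bar>inner u v\<bar> \<le> 1" using Cauchy_Schwarz_ineq2[of u v] assms by simp
  then have th: "0 \<le> ?\<theta>" "?\<theta> \<le> pi" and cos: "cos ?\<theta> = inner u v"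
    by (auto simp: geodesic_dist_def arccos_lbound arccos_ubound abs_le_iff)
  have half: "sin x \<ge> x / 2" if "0 \<le> x" "x \<le> pi / 2" for x :: real
  proof (cases "x \<le> pi / 3")
    case True
    define f where "f x = x / 2 - sin x" for x :: real
    have "f x \<le> f 0"
    proof (rule DERIV_nonpos_imp_nonincreasing[OF that(1)])
      fix y assume y: "0 \<le> y" "y \<le> x"
      have "cos (pi / 3) \<le> cos y" using y True pi_gt_zero by (intro cos_monotone_0_pi_le) auto
      then have "1 / 2 - cos y \<le> 0" by (simp add: cos_60)
      moreover have "(f has_real_derivative 1 / 2 - cos y) (at y)"
        unfolding f_def by (auto intro!: derivative_eq_intros)
      ultimately show "\<exists>d. (f has_real_derivative d) (at y) \<and> d \<le> 0" by blast
    qed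
    then have "x / 2 - sin x \<le> 0" by (simp add: f_def)
    then show ?thesis by simp
  next
    case False
    have "sin (pi / 3) \<le> sin x" using that False by (intro sin_monotone_2pi_le) auto
    moreover have "17 / 10 \<le> sqrt 3" by (intro real_le_rsqrt) (simp add: power2_eq_square)
    moreover have "pi < 32 / 10" using pi_approx by simp
    ultimately show ?thesis using that by (simp add: sin_60)
  qed
  have "(norm (u - v))\<^sup>2 = 2 - 2 * cos ?\<theta>"
    using assms by (simp add: cos power2_norm_eq_inner inner_diff_left inner_diff_right inner_commute norm_eq_1)
  also have "\<dots> = (2 * sin (?\<theta> / 2))\<^sup>2"
    using cos_double_sin[of "?\<theta> / 2"] by (simp add: power2_eq_square)
  finally have "sqrt ((norm (u - v))\<^sup>2) = sqrt ((2 * sin (?\<theta> / 2))\<^sup>2)" by (simp only:)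
  then have "norm (u - v) = \<bar>2 * sin (?\<theta> / 2)\<bar>" by (simp only: real_sqrt_abs abs_norm_cancel)
  moreover have "?\<theta> / 2 / 2 \<le> sin (?\<theta> / 2)" using th by (intro half) auto
  ultimately show ?thesis by simp
qed

lemma geodesic_dist_bounds:
  fixes u v :: "real ^ 'n"
  assumes "norm u = 1" "norm v = 1"
  shows "0 \<le> geodesic_dist u v" "geodesic_dist u v \<le> 4"
proof -
  have "\<bar>inner u v\<bar> \<le> 1" using Cauchy_Schwarz_ineq2[of u v] assms by simp
  then have "0 \<le> geodesic_dist u v" "geodesic_dist u v \<le> pi"
    by (auto simp: geodesic_dist_def arccos_lbound arccos_ubound abs_le_iff)
  then show "0 \<le> geodesic_dist u v" "geodesic_dist u v \<le> 4" using pi_less_4 by auto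
qed

lemma hausdorff_geodesic_le:
  fixes A B :: "(real ^ 'n) set"
  assumes A: "A \<subseteq> sphere 0 1" "A \<noteq> {}" and B: "B \<subseteq> sphere 0 1" "B \<noteq> {}"
    and AB: "\<And>x. x \<in> A \<Longrightarrow> \<exists>y\<in>B. geodesic_dist x y \<le> r" and BA: "\<And>y. y \<in> B \<Longrightarrow> \<exists>x\<in>A. geodesic_dist x y \<le> r"
  shows "hausdorff_geodesic A B \<le> r"
proof -
  have nonneg: "0 \<le> geodesic_dist x y" if "x \<in> A" "y \<in> B" for x y
    using that A B by (intro geodesic_dist_bounds) auto
  have 1: "(INF y\<in>B. geodesic_dist x y) \<le> r" if x: "x \<in> A" for x
  proof -
    obtain y where "y \<in> B" "geodesic_dist x y \<le> r" using AB[OF x] by blast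
    moreover have "bdd_below (geodesic_dist x ` B)" using nonneg[OF x] by (intro bdd_belowI2) auto
    ultimately show ?thesis by (meson cINF_lower order_trans)
  qed
  have 2: "(INF x\<in>A. geodesic_dist x y) \<le> r" if y: "y \<in> B" for y
  proof -
    obtain x where "x \<in> A" "geodesic_dist x y \<le> r" using BA[OF y] by blast
    moreover have "bdd_below ((\<lambda>x. geodesic_dist x y) ` A)" using nonneg[OF _ y] by (intro bdd_belowI2) auto
    ultimately show ?thesis by (meson cINF_lower order_trans)
  qed
  show ?thesis
    unfolding hausdorff_geodesic_def using A(2) B(2) 1 2 by (intro max.boundedI cSUP_least) auto
qed

text \<open>Everything is compared with powers of X = n^n >= 27 and with t, which will be the fourth
  root of \<epsilon>. The assumption on \<open>X ^ 70 * t\<close> makes \<open>X ^ i * t\<close>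
  small for all exponents that occur. Roughly, \<open>C\<close> is at most X^14, \<open>h\<close> at
  most X^9 t^2, \<beta> at most X^6 t, and the final distance at most X^15 t, well within the
  exponent 70.\<close>

lemma constant_bounds:
  fixes n :: nat and X t :: real
  assumes n: "n \<ge> 3" and X: "X = real n ^ n" and t: "0 \<le> t" "X ^ 70 * t < 4"
  defines "C \<equiv> 294912 * (real n + 1)\<^sup>2 * (24 * (real n + 1)) ^ (n + 1)" and "m \<equiv> n\<^sup>2 + n + 1"
  defines "h \<equiv> 4 * real m * sqrt (C * t ^ 4)"
  defines "\<beta> \<equiv> (real n)\<^sup>2 * h + sqrt h"
  shows "32 * (real m)\<^sup>2 * (real n + 1) * (C * t ^ 4) < 1"
    and "(real n)\<^sup>2 * h \<le> 1 / 2"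
    and "(real n)\<^sup>2 * \<beta> \<le> 1 / 2"
    and "4 * (54 * (16 * (real n)\<^sup>2) ^ n * (2 * (real n)\<^sup>2 * \<beta> + t ^ 4)) \<le> X ^ 70 * t"
    and "2 * \<beta> \<le> X ^ 70 * t" and "\<beta> \<ge> 0"
proof -
  let ?n = "real n"
  have n3: "?n \<ge> 3" using n by simp
  have X3: "?n ^ 3 \<le> X" unfolding X using n by (intro power_increasing) auto
  have "(3::real) ^ 3 \<le> ?n ^ 3" using n3 by (intro power_mono) auto
  then have X27: "X \<ge> 27" using X3 by simp
  have X0: "X > 0" "X \<ge> 1" using X27 by auto
  have pow: "X ^ i \<le> X ^ j" if "i \<le> j" for i j using that X0 by (intro power_increasing) auto
  have n2X: "?n\<^sup>2 \<le> X"
  proof -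
    have "?n ^ 2 \<le> ?n ^ 3" using n3 by (intro power_increasing) auto
    then show ?thesis using X3 by linarith
  qed
  have nX: "?n \<le> X"
  proof -
    have "?n ^ 1 \<le> ?n ^ 3" using n3 by (intro power_increasing) auto
    also note X3
    finally show ?thesis by (simp only: power_one_right)
  qed
  have sq: "27 * 27 \<le> X * X" using X27 by (intro mult_mono) auto
  then have X2: "729 \<le> X ^ 2" by (simp add: power2_eq_square)
  have "729 * 729 \<le> X ^ 2 * X ^ 2" using X2 by (intro mult_mono) auto
  then have X4: "294912 \<le> X ^ 4" by (simp add: power_add[symmetric])
  have nn: "3 * ?n \<le> ?n * ?n" using n3 by (intro mult_right_mono) auto
  have NX: "?n + 1 \<le> X"
  proof -
    have "?n + 1 \<le> ?n * ?n" using nn n3 by linarith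
    then show ?thesis using n2X by (simp add: power2_eq_square)
  qed
  have mX: "real m \<le> X"
  proof -
    have "real m = ?n * ?n + ?n + 1" by (simp add: m_def power2_eq_square)
    also have "\<dots> \<le> 3 * (?n * ?n)" using nn n3 by linarith
    also have "\<dots> \<le> ?n * (?n * ?n)" using n3 by (intro mult_right_mono) auto
    finally show ?thesis using X3 by (simp add: power3_eq_cube mult.assoc)
  qed
  have n5: "24 * (?n + 1) \<le> ?n ^ 5" "16 * ?n\<^sup>2 \<le> ?n ^ 5"
  proof -
    have n4: "(3::real) ^ 4 \<le> ?n ^ 4" using n3 by (intro power_mono) auto
    have "24 * (?n + 1) \<le> 81 * ?n" using n3 by simp
    also have "\<dots> \<le> ?n ^ 4 * ?n" using n4 n3 by (intro mult_right_mono) auto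
    finally show "24 * (?n + 1) \<le> ?n ^ 5" by (simp add: eval_nat_numeral)
    have "16 * ?n\<^sup>2 \<le> ?n ^ 3 * ?n\<^sup>2" using \<open>(3::real) ^ 3 \<le> ?n ^ 3\<close> by (intro mult_right_mono) auto
    then show "16 * ?n\<^sup>2 \<le> ?n ^ 5" by (simp add: power_add[symmetric])
  qed
  have Xn5: "(?n ^ 5) ^ n = X ^ 5" unfolding X by (simp add: power_mult[symmetric] mult.commute)
  have C0: "C \<ge> 0" by (simp add: C_def)
  have CX: "C \<le> X ^ 14"
  proof -
    have "(24 * (?n + 1)) ^ (n + 1) \<le> (?n ^ 5) ^ (n + 1)" using n5 by (intro power_mono) auto
    also have "\<dots> = X ^ 5 * (?n ^ 3 * ?n\<^sup>2)" by (simp add: Xn5 power_add[symmetric])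
    also have "\<dots> \<le> X ^ 5 * (X * X)" using X3 n2X X0 by (intro mult_left_mono mult_mono) auto
    finally have a: "(24 * (?n + 1)) ^ (n + 1) \<le> X ^ 7" by (simp add: eval_nat_numeral mult_ac)
    have b: "(?n + 1)\<^sup>2 \<le> X ^ 2" using NX by (intro power_mono) auto
    have "C \<le> X ^ 4 * X ^ 2 * X ^ 7" unfolding C_def
      using a b X4 X0 by (intro mult_mono) auto
    also have "\<dots> = X ^ 13" by (simp add: power_add[symmetric])
    also have "\<dots> \<le> X ^ 14" by (rule pow) simp
    finally show ?thesis .
  qed
  have h0: "h \<ge> 0" using C0 by (simp add: h_def)
  have hX: "h \<le> X ^ 9 * t\<^sup>2"
  proof -
    have "sqrt (C * t ^ 4) \<le> sqrt (X ^ 14 * t ^ 4)" using CX by (intro real_sqrt_le_mono mult_right_mono) auto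
    also have "X ^ 14 * t ^ 4 = (X ^ 7 * t\<^sup>2)\<^sup>2" by (simp add: power_mult_distrib power_mult[symmetric])
    also have "sqrt \<dots> = X ^ 7 * t\<^sup>2" using X0 by simp
    finally have a: "sqrt (C * t ^ 4) \<le> X ^ 7 * t\<^sup>2" .
    have "4 * real m \<le> X * X" using mX X27 by (intro mult_mono) auto
    then have "h \<le> (X * X) * (X ^ 7 * t\<^sup>2)"
      unfolding h_def using a by (rule mult_mono) (use X0 C0 in auto)
    then show ?thesis by (simp add: eval_nat_numeral mult_ac)
  qed
  have shX: "sqrt h \<le> X ^ 5 * t"
  proof -
    have "X ^ 9 * t\<^sup>2 \<le> X ^ 10 * t\<^sup>2" by (intro mult_right_mono pow) auto
    then have "h \<le> (X ^ 5 * t)\<^sup>2" using hX by (simp add: power_mult_distrib power_mult[symmetric])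
    then have "sqrt h \<le> sqrt ((X ^ 5 * t)\<^sup>2)" by (rule real_sqrt_le_mono)
    then show ?thesis using X0 t by simp
  qed
  have small: "X ^ i * t \<le> 1 / 8" if "i \<le> 20" for i
  proof -
    have "X ^ i * 27 ^ 2 * t \<le> X ^ i * X ^ 2 * t" using X2 X0 t by (intro mult_right_mono mult_left_mono) auto
    also have "\<dots> = X ^ (i + 2) * t" by (simp only: power_add)
    also have "\<dots> \<le> X ^ 70 * t" using that t by (intro mult_right_mono pow) auto
    finally have "X ^ i * t * 729 < 4" using t(2) by simp
    then show ?thesis by simp
  qed
  have t1: "t \<le> 1" using small[of 0] by simp
  have n2h: "?n\<^sup>2 * h \<le> X ^ 10 * t * t"
  proof -
    have "?n\<^sup>2 * h \<le> X * (X ^ 9 * t\<^sup>2)" using n2X hX h0 X0 by (intro mult_mono) auto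
    then show ?thesis by (simp add: power2_eq_square eval_nat_numeral mult_ac)
  qed
  have n2h': "X ^ 10 * t * t \<le> 1 / 8 * t" using small[of 10] t by (intro mult_right_mono) auto
  then show "?n\<^sup>2 * h \<le> 1 / 2" using n2h t1 by linarith
  show \<beta>0: "\<beta> \<ge> 0" using h0 by (simp add: \<beta>_def)
  have \<beta>X: "\<beta> \<le> X ^ 6 * t"
  proof -
    have "1 * t \<le> X ^ 5 * t" using t X0 by (intro mult_right_mono) auto
    then have "\<beta> \<le> 2 * (X ^ 5 * t)" unfolding \<beta>_def using n2h n2h' shX t by linarith
    also have "\<dots> \<le> X * (X ^ 5 * t)" using X27 t X0 by (intro mult_right_mono) auto
    finally show ?thesis by (simp add: eval_nat_numeral mult_ac)
  qed
  have n2\<beta>: "?n\<^sup>2 * \<beta> \<le> X ^ 7 * t"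
  proof -
    have "?n\<^sup>2 * \<beta> \<le> X * (X ^ 6 * t)" using n2X \<beta>X \<beta>0 X0 by (intro mult_mono) auto
    then show ?thesis by (simp add: eval_nat_numeral mult_ac)
  qed
  then show "?n\<^sup>2 * \<beta> \<le> 1 / 2" using small[of 7] by simp
  have "2 * \<beta> \<le> X * (X ^ 6 * t)" using \<beta>X \<beta>0 X27 by (intro mult_mono) auto
  also have "\<dots> = X ^ 7 * t" by (simp add: eval_nat_numeral mult_ac)
  also have "\<dots> \<le> X ^ 70 * t" using t by (intro mult_right_mono pow) auto
  finally show "2 * \<beta> \<le> X ^ 70 * t" .
  have t4: "t ^ 4 \<le> t"
  proof -
    have "t ^ 4 = t ^ 3 * t" by (simp add: eval_nat_numeral)
    also have "\<dots> \<le> 1 * t" using t t1 by (intro mult_right_mono power_le_one) auto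
    finally show ?thesis by simp
  qed
  have "4 * (54 * (16 * ?n\<^sup>2) ^ n * (2 * ?n\<^sup>2 * \<beta> + t ^ 4)) = 216 * ((16 * ?n\<^sup>2) ^ n * (2 * (?n\<^sup>2 * \<beta>) + t ^ 4))"
    by simp
  also have "\<dots> \<le> X ^ 2 * (X ^ 5 * (X ^ 8 * t))"
  proof (intro mult_mono)
    show "216 \<le> X ^ 2" using X2 by simp
    have "(16 * ?n\<^sup>2) ^ n \<le> (?n ^ 5) ^ n" using n5 by (intro power_mono) auto
    then show "(16 * ?n\<^sup>2) ^ n \<le> X ^ 5" by (simp only: Xn5)
    have "1 * t \<le> X ^ 7 * t" using t X0 by (intro mult_right_mono) auto
    then have "2 * (?n\<^sup>2 * \<beta>) + t ^ 4 \<le> 3 * (X ^ 7 * t)" using n2\<beta> t4 by linarith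
    also have "\<dots> \<le> X * (X ^ 7 * t)" using X27 t X0 by (intro mult_right_mono) auto
    finally show "2 * (?n\<^sup>2 * \<beta>) + t ^ 4 \<le> X ^ 8 * t" by (simp add: eval_nat_numeral mult_ac)
  qed (use X0 \<beta>0 t in auto)
  also have "\<dots> = X ^ 15 * t" by (simp add: mult.assoc[symmetric] power_add[symmetric])
  also have "\<dots> \<le> X ^ 70 * t" using t by (intro mult_right_mono pow) auto
  finally show "4 * (54 * (16 * ?n\<^sup>2) ^ n * (2 * ?n\<^sup>2 * \<beta> + t ^ 4)) \<le> X ^ 70 * t" .
  have "32 * (real m)\<^sup>2 * (?n + 1) * (C * t ^ 4) \<le> X ^ 2 * X ^ 2 * X * (X ^ 14 * t ^ 4)"
  proof (intro mult_mono)
    show "32 \<le> X ^ 2" using X2 by simp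
    show "(real m)\<^sup>2 \<le> X ^ 2" using mX by (intro power_mono) auto
  qed (use NX CX C0 X0 t in auto)
  also have "\<dots> = X ^ 19 * t ^ 4" by (simp add: mult_ac eval_nat_numeral)
  also have "\<dots> \<le> X ^ 19 * t" using t4 X0 by (intro mult_left_mono) auto
  also have "\<dots> < 1" using small[of 19] by simp
  finally show "32 * (real m)\<^sup>2 * (?n + 1) * (C * t ^ 4) < 1" .
qed

subsection \<open>The stability theorem\<close>

text \<open>Bounding hyperplanes are null sets. The comparison is made because
  \<open>open_cone\<close>, the domain of the transport, is cut out by strict inequalities.\<close>

lemma halfspace_inter_negligible_boundary:
  fixes J :: "(real ^ 'n::finite) set"
  assumes fin: "finite J" and J: "J \<subseteq> sphere 0 1"
  shows "emeasure lborel {x. \<forall>u\<in>J. inner x u \<le> 1} \<le> emeasure lborel {x. \<forall>u\<in>J. inner x u < 1}"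
proof -
  let ?Z = "{x. \<forall>u\<in>J. inner x u \<le> 1}" and ?Y = "{x. \<forall>u\<in>J. inner x u < 1}"
  have Z: "?Z = (\<Inter>u\<in>J. {x. inner u x \<le> 1})" and Y: "?Y = (\<Inter>u\<in>J. {x. inner u x < 1})"
    by (auto simp: inner_commute)
  have borel: "?Z \<in> sets borel" "?Y \<in> sets borel"
  proof -
    have "closed ?Z" unfolding Z by (intro closed_INT ballI closed_halfspace_le)
    then show "?Z \<in> sets borel" by simp
    have "open ?Y" unfolding Y using fin by (intro open_INT ballI open_halfspace_lt) auto
    then show "?Y \<in> sets borel" by simp
  qed
  let ?H = "\<Union>u\<in>J. {x. inner u x = 1}"
  have "negligible ?H"
    by (rule negligible_Union) (use fin J in \<open>auto intro!: negligible_hyperplane\<close>)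
  then have H: "?H \<in> null_sets lebesgue" by (simp add: negligible_iff_null_sets)
  have "emeasure lborel ?Z = emeasure lebesgue ?Z" using borel by simp
  also have "\<dots> \<le> emeasure lebesgue (?Y \<union> ?H)"
    using borel H by (intro emeasure_mono) (auto simp: inner_commute less_le null_sets_def)
  also have "\<dots> = emeasure lebesgue ?Y" using borel H by (intro emeasure_Un_null_set) auto
  also have "\<dots> = emeasure lborel ?Y" using borel by simp
  finally show ?thesis .
qed

lemma slice_const_finite_frame_le:
  fixes J :: "(real ^ 'n::finite) set"
  assumes finJ: "finite J" and J: "J \<subseteq> sphere 0 1" "J \<noteq> {}"
    and ax: "unit_frame_axis (lift_unit ` J) C (lift_vec 1 0)"
  shows "slice_const TYPE('n) * emeasure lborel {x. \<forall>u\<in>J. inner x u \<le> 1}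
    \<le> (\<integral>\<^sup>+y. ennreal (unit_frame_axis.cone_exp (lift_vec 1 0) y)
        * indicator (unit_frame_axis.open_cone (lift_unit ` J)) y \<partial>lborel)"
proof -
  interpret unit_frame_axis "lift_unit ` J" C "lift_vec 1 0" by (rule ax)
  let ?Y = "{x. \<forall>u\<in>J. inner x u < 1}"
  have "open (\<Inter>u\<in>J. {x. inner u x < 1})" using finJ by (intro open_INT ballI open_halfspace_lt) auto
  moreover have "?Y = (\<Inter>u\<in>J. {x. inner u x < 1})" by (auto simp: inner_commute)
  ultimately have borel: "?Y \<in> sets borel" by simp
  have sub: "lift_cone ?Y \<subseteq> open_cone"
  proof
    fix y assume y: "y \<in> lift_cone ?Y"
    obtain t x where yt: "y = lift_vec t x" by (rule lift_vec_cases)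
    have t: "t > 0" and x: "(sqrt (real CARD('n)) / t) *\<^sub>R x \<in> ?Y"
      using y by (auto simp: yt lift_vec_in_lift_cone)
    have "inner (lift_unit u) y > 0" if "u \<in> J" for u
    proof -
      have "1 - inner ((sqrt (real CARD('n)) / t) *\<^sub>R x) u > 0" using x that by simp
      then show ?thesis unfolding yt inner_lift_unit_lift_vec[OF t] using t by (intro mult_pos_pos divide_pos_pos) auto
    qed
    then show "y \<in> open_cone" by (auto simp: open_cone_def)
  qed
  have "slice_const TYPE('n) * emeasure lborel {x. \<forall>u\<in>J. inner x u \<le> 1} \<le> slice_const TYPE('n) * emeasure lborel ?Y"
    by (intro mult_left_mono halfspace_inter_negligible_boundary finJ J) auto
  also have "\<dots> = (\<integral>\<^sup>+y. ennreal (exp (- sqrt (real CARD('n) + 1) * inner (lift_vec 1 0) y)) * indicator (lift_cone ?Y) y \<partial>lborel)"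
    by (rule nn_integral_lift_cone[symmetric, OF borel])
  also have "\<dots> \<le> (\<integral>\<^sup>+y. ennreal (cone_exp y) * indicator open_cone y \<partial>lborel)"
  proof (intro nn_integral_mono mult_mono)
    fix y
    show "indicator (lift_cone ?Y) y \<le> (indicator open_cone y :: ennreal)"
      using sub by (auto simp: indicator_def)
    show "ennreal (exp (- sqrt (real CARD('n) + 1) * inner (lift_vec 1 0) y)) \<le> ennreal (cone_exp y)"
      by (simp add: cone_exp_def card_lift_index add.commute)
  qed auto
  finally show ?thesis .
qed

text \<open>Keeping only the finitely many constraints from \<open>J\<close> enlarges the body, so
  the lower volume bound passes to the frame, where almost every unit of mass is used up and pairs
  of lifts must be almost equal or orthogonal. Orthogonal lifts correspond to inner product
  -1/n.\<close>

lemma nearly_regular_subset_of_supp: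
  fixes \<mu> :: "(real ^ 'n) measure"
  assumes n: "CARD('n) \<ge> 3" and sets: "sets \<mu> = sets sphere_borel" and "centred \<mu>" "isotropic \<mu>"
    and vol: "ennreal (1 - \<epsilon>) \<le> slice_const TYPE('n) * emeasure lborel (Z_body \<mu>)" and eps: "\<epsilon> \<le> 1"
  defines "C \<equiv> 294912 * (real CARD('n) + 1)\<^sup>2 * (24 * (real CARD('n) + 1)) ^ (CARD('n) + 1)"
    and "m \<equiv> CARD('n)\<^sup>2 + CARD('n) + 1"
  assumes small: "32 * (real m)\<^sup>2 * (real CARD('n) + 1) * (C * \<epsilon>) < 1"
  obtains w :: "'n option \<Rightarrow> real ^ 'n" where "range w \<subseteq> supp \<mu>"
    "\<And>a b. a \<noteq> b \<Longrightarrow> \<bar>inner (w a) (w b) + 1 / real CARD('n)\<bar> \<le> 4 * real m * sqrt (C * \<epsilon>)"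
proof -
  let ?n = "real CARD('n)" and ?N = "real CARD('n) + 1"
  have n3: "?n \<ge> 3" using n by simp
  obtain J c where J: "finite J" "J \<subseteq> supp \<mu>" "card J \<le> m"
    and c: "\<And>u. u \<in> J \<Longrightarrow> c u > 0" "(\<Sum>u\<in>J. c u) = ?n" "(\<Sum>u\<in>J. c u *\<^sub>R u) = 0"
      "\<And>x. (\<Sum>u\<in>J. (c u * inner u x) *\<^sub>R u) = x"
    using isotropic_centred_finite_frame[OF sets \<open>centred \<mu>\<close> \<open>isotropic \<mu>\<close>] unfolding m_def by blast
  have Js: "J \<subseteq> sphere 0 1" using J(2) supp_closed(1)[OF sets] by blast
  have J0: "J \<noteq> {}" using c(2) n3 by auto
  define C' where "C' U = ?N / ?n * c (inv lift_unit U)" for U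
  have ax: "unit_frame_axis (lift_unit ` J) C' (lift_vec 1 0)"
    unfolding C'_def by (rule unit_frame_axis_lift_unit[OF J(1) Js c])
  interpret unit_frame_axis "lift_unit ` J" C' "lift_vec 1 0" by (rule ax)
  have N: "real CARD('n lift_index) = ?N" by (simp add: card_lift_index)
  have "emeasure lborel (Z_body \<mu>) \<le> emeasure lborel {x. \<forall>u\<in>J. inner x u \<le> 1}"
  proof (rule emeasure_mono)
    show "Z_body \<mu> \<subseteq> {x. \<forall>u\<in>J. inner x u \<le> 1}" using J(2) by (auto simp: Z_body_def)
    have "closed (\<Inter>u\<in>J. {x. inner u x \<le> 1})" by (intro closed_INT ballI closed_halfspace_le)
    moreover have "{x. \<forall>u\<in>J. inner x u \<le> 1} = (\<Inter>u\<in>J. {x. inner u x \<le> 1})" by (auto simp: inner_commute)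
    ultimately show "{x. \<forall>u\<in>J. inner x u \<le> 1} \<in> sets lborel" by simp
  qed
  then have "slice_const TYPE('n) * emeasure lborel (Z_body \<mu>)
      \<le> slice_const TYPE('n) * emeasure lborel {x. \<forall>u\<in>J. inner x u \<le> 1}"
    by (intro mult_left_mono) auto
  with vol slice_const_finite_frame_le[OF J(1) Js J0 ax]
  have vol': "ennreal (1 - \<epsilon>) \<le> (\<integral>\<^sup>+y. ennreal (cone_exp y) * indicator open_cone y \<partial>lborel)"
    by (meson order_trans)
  have pairs: "C' U * C' V * (norm (U - V))\<^sup>2 * (inner U V)\<^sup>2 \<le> C * \<epsilon>" if "U \<in> lift_unit ` J" "V \<in> lift_unit ` J" for U V
  proof -
    have "C' U * C' V * (norm (U - V))\<^sup>2 * (inner U V)\<^sup>2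
        \<le> 294912 * (real CARD('n lift_index))\<^sup>2 * (24 * real CARD('n lift_index)) ^ CARD('n lift_index) * \<epsilon>"
      using n by (intro pairs_equal_or_orthogonal[OF that _ vol' eps]) (simp add: card_lift_index)
    then show ?thesis unfolding N by (simp add: C_def card_lift_index)
  qed
  have "card (lift_unit ` J) \<le> m" using card_image_le[OF J(1), of lift_unit] J(3) by linarith
  moreover have "32 * (real m)\<^sup>2 * real CARD('n lift_index) * (C * \<epsilon>) < 1" using small by (simp only: N)
  ultimately obtain W :: "'n lift_index \<Rightarrow> real ^ 'n lift_index" where W: "range W \<subseteq> lift_unit ` J"
    "\<And>a b. a \<noteq> b \<Longrightarrow> \<bar>inner (W a) (W b)\<bar> \<le> 2 * real m * sqrt (C * \<epsilon>)"
    using near_orthonormal_selection[of m "C * \<epsilon>", OF _ pairs] by blast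
  have "\<forall>a. \<exists>u. u \<in> J \<and> W (lift_dir a) = lift_unit u" using W(1) by blast
  then obtain w where w: "\<And>a. w a \<in> J" "\<And>a. W (lift_dir a) = lift_unit (w a)" by metis
  show ?thesis
  proof (rule that[of w])
    show "range w \<subseteq> supp \<mu>" using w(1) J(2) by blast
    fix a b :: "'n option" assume "a \<noteq> b"
    then have "lift_dir a \<noteq> lift_dir b" using bij_lift_dir by (auto dest!: bij_is_inj injD)
    from W(2)[OF this] have "\<bar>(1 + ?n * inner (w a) (w b)) / ?N\<bar> \<le> 2 * real m * sqrt (C * \<epsilon>)"
      by (simp add: w(2) inner_lift_unit)
    then have "2 * \<bar>(1 + ?n * inner (w a) (w b)) / ?N\<bar> \<le> 4 * real m * sqrt (C * \<epsilon>)" by simp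
    \<comment> \<open>Undoing the lift multiplies by (n + 1) / n, which is at most 2.\<close>
    moreover have "\<bar>inner (w a) (w b) + 1 / ?n\<bar> \<le> 2 * \<bar>(1 + ?n * inner (w a) (w b)) / ?N\<bar>"
    proof -
      have "inner (w a) (w b) + 1 / ?n = (?N / ?n) * ((1 + ?n * inner (w a) (w b)) / ?N)"
      proof -
        have "i + 1 / n' = (n' + 1) / n' * ((1 + n' * i) / (n' + 1))" if "n' > 0" for i n' :: real
        proof -
          have "(n' + 1) / n' * ((1 + n' * i) / (n' + 1)) = (1 + n' * i) / n'" using that by simp
          then show ?thesis using that by (simp add: add_divide_distrib)
        qed
        then show ?thesis using n3 by simp
      qed
      then have "\<bar>inner (w a) (w b) + 1 / ?n\<bar> = (?N / ?n) * \<bar>(1 + ?n * inner (w a) (w b)) / ?N\<bar>"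
        using n3 by (simp only: abs_mult) simp
      also have "\<dots> \<le> 2 * \<bar>(1 + ?n * inner (w a) (w b)) / ?N\<bar>"
        using n3 by (intro mult_right_mono) (auto simp: divide_le_eq)
      finally show ?thesis .
    qed
    ultimately show "\<bar>inner (w a) (w b) + 1 / ?n\<bar> \<le> 4 * real m * sqrt (C * \<epsilon>)" by linarith
  qed
qed

context simplex_normals
begin

text \<open>Let \<open>M\<close> be the largest \<open>inner x (p a)\<close>. If it is positive,
  scaling and the circumradius n give norm x <= n M, so passing from \<open>w\<close> to
  \<open>p\<close> costs at most n M \<beta>; hence M <= 1 + n M \<beta>.\<close>

lemma scaled_subset_hull_body:
  assumes w: "\<And>a. norm (p a - w a) \<le> \<beta>" and x: "\<And>a. inner x (w a) \<le> 1"
    and \<beta>: "real CARD('n) * \<beta> < 1"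
  shows "(1 - real CARD('n) * \<beta>) *\<^sub>R x \<in> hull_body"
proof -
  let ?n = "real CARD('n)"
  have b0: "\<beta> \<ge> 0" using order_trans[OF norm_ge_zero w[of None]] .
  have fin: "finite (range (\<lambda>a. inner x (p a)))" "range (\<lambda>a. inner x (p a)) \<noteq> {}" by auto
  define M where "M = Max (range (\<lambda>a. inner x (p a)))"
  have M: "inner x (p a) \<le> M" for a unfolding M_def using fin by (intro Max_ge) auto
  obtain a0 where a0: "M = inner x (p a0)" using Max_in[OF fin] unfolding M_def[symmetric] by (rule rangeE)
  have xM: "norm x \<le> ?n * M \<or> M \<le> 0"
  proof (cases "M > 0")
    case True
    have "inner ((1 / M) *\<^sub>R x) (p a) \<le> 1" for a using M[of a] True by (simp add: divide_le_eq)
    then have "(1 / M) *\<^sub>R x \<in> hull_body" by (simp add: hull_body_def)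
    then have "norm ((1 / M) *\<^sub>R x) \<le> ?n" using hull_body_subset_cball by auto
    then show ?thesis using True by (simp add: divide_le_eq)
  qed auto
  have "inner ((1 - ?n * \<beta>) *\<^sub>R x) (p a) \<le> 1" for a
  proof (cases "M \<le> 0")
    case True
    then have "(1 - ?n * \<beta>) * inner x (p a) \<le> 0" using M[of a] \<beta> by (intro mult_nonneg_nonpos) auto
    then show ?thesis by simp
  next
    case False
    have "M = inner x (w a0) + inner x (p a0 - w a0)" by (simp add: a0 inner_diff_right)
    also have "\<dots> \<le> 1 + norm x * \<beta>"
      using x[of a0] norm_cauchy_schwarz[of x "p a0 - w a0"] mult_left_mono[OF w[of a0] norm_ge_zero[of x]] by linarith
    also have "\<dots> \<le> 1 + (?n * M) * \<beta>" using xM False b0 by (intro add_left_mono mult_right_mono) auto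
    finally have "(1 - ?n * \<beta>) * M \<le> 1" by (simp add: algebra_simps)
    moreover have "(1 - ?n * \<beta>) * inner x (p a) \<le> (1 - ?n * \<beta>) * M" using M[of a] \<beta> by (intro mult_left_mono) auto
    ultimately show ?thesis by simp
  qed
  then show ?thesis by (simp add: hull_body_def)
qed

text \<open>\<open>Z\<close> and the cap beyond \<open>u\<close> are disjoint, and both fit into the
  simplex enlarged by a factor whose n-th power is at most 1 + 2 n^2 \<beta>. Since \<open>Z\<close>
  already takes mass 1 - \<epsilon>, at most 2 n^2 \<beta> + \<epsilon> is left for the cap, and its
  mass bounds the distance.\<close>

lemma dist_contact_point_le:
  assumes n: "CARD('n) \<ge> 3" and u: "norm u = 1" and Z: "Z \<in> sets borel"
    and vol: "ennreal (1 - \<epsilon>) \<le> slice_const TYPE('n) * emeasure lborel Z" and eps: "0 \<le> \<epsilon>" "\<epsilon> \<le> 1"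
    and Zu: "\<And>x. x \<in> Z \<Longrightarrow> inner x u \<le> 1" and Zp: "\<And>x. x \<in> Z \<Longrightarrow> (1 - real CARD('n) * \<beta>) *\<^sub>R x \<in> hull_body"
    and \<beta>: "0 \<le> \<beta>" "(real CARD('n))\<^sup>2 * \<beta> \<le> 1 / 2"
  obtains a where "norm (u - p a) \<le> 2 * (54 * (16 * (real CARD('n))\<^sup>2) ^ CARD('n) * (2 * (real CARD('n))\<^sup>2 * \<beta> + \<epsilon>))"
proof -
  let ?n = "real CARD('n)" and ?\<kappa> = "slice_const TYPE('n)"
  have n3: "?n \<ge> 3" using n by simp
  let ?cap = "hull_body \<inter> {x. inner x u > 1}"
  let ?K = "54 * (16 * ?n\<^sup>2) ^ CARD('n)"
  have K: "?K > 0" using n3 by simp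
  obtain a where a: "ennreal (norm (lift_unit u - lift_unit (p a)) / ?K) \<le> ?\<kappa> * emeasure lborel ?cap"
    using cap_volume_ge[OF n u] .
  define D where "D = norm (lift_unit u - lift_unit (p a))"
  define q where "q = 1 - ?n * \<beta>"
  have nb: "?n * (?n * \<beta>) \<le> 1 / 2" using \<beta>(2) by (simp add: power2_eq_square mult.assoc)
  have nb1: "1 * (?n * \<beta>) \<le> ?n * (?n * \<beta>)" using \<beta>(1) n3 by (intro mult_right_mono) auto
  have q: "0 < q" "q \<le> 1" unfolding q_def using nb nb1 \<beta>(1) by (linarith, simp)
  have "- 1 \<le> - (?n * \<beta>)" using nb nb1 by linarith
  from Bernoulli_inequality[OF this, of "CARD('n)"] have qn: "1 - ?n * (?n * \<beta>) \<le> q ^ CARD('n)"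
    by (simp add: q_def)
  let ?y = "?n * (?n * \<beta>)"
  have y0: "0 \<le> ?y" using \<beta>(1) by simp
  have "(1 / q) ^ CARD('n) = 1 / q ^ CARD('n)" by (simp add: power_one_over)
  also have "\<dots> \<le> 1 / (1 - ?y)" using qn nb by (intro divide_left_mono) (auto intro!: mult_pos_pos q zero_less_power)
  also have "\<dots> \<le> 1 + 2 * ?y"
  proof -
    have "?y * ?y \<le> ?y * (1 / 2)" using y0 nb by (intro mult_left_mono) auto
    then have "1 \<le> (1 + 2 * ?y) * (1 - ?y)" by (simp add: algebra_simps)
    then show ?thesis using nb by (simp add: divide_le_eq)
  qed
  finally have qq: "(1 / q) ^ CARD('n) \<le> 1 + 2 * ?y" .
  have hb: "hull_body \<in> sets borel" using closed_hull_body by simp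
  have cap: "?cap \<in> sets borel" using hb by auto
  have pre: "(\<lambda>x. q *\<^sub>R x) -` hull_body \<in> sets borel"
    using measurable_sets_borel[OF _ hb, of "\<lambda>x. q *\<^sub>R x"] by simp
  have "emeasure lborel Z + emeasure lborel ?cap = emeasure lborel (Z \<union> ?cap)"
    using Z cap Zu by (intro plus_emeasure) (auto simp: not_le[symmetric])
  also have "\<dots> \<le> emeasure lborel ((\<lambda>x. q *\<^sub>R x) -` hull_body)"
  proof (rule emeasure_mono)
    have "q * inner x (p b) \<le> 1" if "x \<in> hull_body" for x b
    proof (cases "inner x (p b) \<le> 0")
      case True
      then have "q * inner x (p b) \<le> 0" using q by (intro mult_nonneg_nonpos) auto
      then show ?thesis by simp
    next
      case False
      then have "q * inner x (p b) \<le> 1 * 1" using q that by (intro mult_mono) (auto simp: hull_body_def)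
      then show ?thesis by simp
    qed
    then have "q *\<^sub>R x \<in> hull_body" if "x \<in> hull_body" for x using that by (simp add: hull_body_def)
    then show "Z \<union> ?cap \<subseteq> (\<lambda>x. q *\<^sub>R x) -` hull_body" using Zp by (auto simp: q_def)
  qed (use pre in simp)
  also have "\<dots> = ennreal ((1 / q) ^ CARD('n)) * emeasure lborel hull_body"
    using emeasure_lborel_vimage_scaleR[OF q(1) hb] by simp
  finally have "?\<kappa> * (emeasure lborel Z + emeasure lborel ?cap) \<le> ?\<kappa> * (ennreal ((1 / q) ^ CARD('n)) * emeasure lborel hull_body)"
    by (intro mult_left_mono) auto
  also have "\<dots> = ennreal ((1 / q) ^ CARD('n))" by (metis mult.left_commute mult.right_neutral slice_const_hull_body)
  finally have le: "?\<kappa> * emeasure lborel Z + ?\<kappa> * emeasure lborel ?cap \<le> ennreal ((1 / q) ^ CARD('n))"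
    by (simp add: distrib_left)
  have "ennreal ((1 - \<epsilon>) + D / ?K) = ennreal (1 - \<epsilon>) + ennreal (D / ?K)"
    using eps K by (intro ennreal_plus) (auto simp: D_def)
  also have "\<dots> \<le> ?\<kappa> * emeasure lborel Z + ?\<kappa> * emeasure lborel ?cap"
    using vol a unfolding D_def by (intro add_mono)
  also have "\<dots> \<le> ennreal ((1 / q) ^ CARD('n))" by (rule le)
  finally have "(1 - \<epsilon>) + D / ?K \<le> (1 / q) ^ CARD('n)" using q by (subst (asm) ennreal_le_iff) auto
  then have "D / ?K \<le> 2 * ?y + \<epsilon>" using qq by linarith
  then have DK: "D \<le> ?K * (2 * ?n\<^sup>2 * \<beta> + \<epsilon>)"
    using K by (simp add: divide_le_eq power2_eq_square mult_ac)
  \<comment> \<open>The lift multiplies squared distances by n / (n + 1), which is at least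
    1/4.\<close>
  have up: "norm (u - p a) \<le> 2 * D"
  proof -
    have uu: "inner u u = 1" "inner (p a) (p a) = 1" using u norm_p[of a] by (auto simp: norm_eq_1)
    have "(norm (u - p a))\<^sup>2 = 2 - 2 * inner u (p a)"
      by (simp add: power2_norm_eq_inner inner_diff_left inner_diff_right inner_commute[of "p a" u] uu)
    moreover have one: "(1 + ?n * 1) / (?n + 1) = 1" using n3 by (simp add: add.commute)
    have dbl: "1 - z - (z - 1) = 2 - 2 * z" for z :: real by simp
    have "D\<^sup>2 = 2 - 2 * ((1 + ?n * inner u (p a)) / (?n + 1))"
      unfolding D_def power2_norm_eq_inner inner_diff_left inner_diff_right inner_lift_unit
        inner_commute[of "p a" u] uu one by (rule dbl)
    moreover have "2 - 2 * i \<le> 4 * (2 - 2 * ((1 + n' * i) / (n' + 1)))" if "n' \<ge> 3" "i \<le> 1" for i n' :: real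
    proof -
      have eq: "2 - 2 * ((1 + n' * i) / (n' + 1)) = (n' / (n' + 1)) * (2 - 2 * i)" using that by (simp add: field_simps)
      have "(1 / 4) * (2 - 2 * i) \<le> (n' / (n' + 1)) * (2 - 2 * i)"
        using that by (intro mult_right_mono) (auto simp: field_simps)
      moreover have "A \<le> 4 * B" if "(1 / 4) * A \<le> B" for A B :: real using that by simp
      ultimately show ?thesis unfolding eq by blast
    qed
    moreover have "inner u (p a) \<le> 1" using norm_cauchy_schwarz[of u "p a"] u norm_p[of a] by simp
    ultimately have "(norm (u - p a))\<^sup>2 \<le> (2 * D)\<^sup>2" using n3 by (simp add: power_mult_distrib)
    then show ?thesis by (rule power2_le_imp_le) (simp add: D_def)
  qed
  show ?thesis
  proof (rule that[of a])
    show "norm (u - p a) \<le> 2 * (?K * (2 * ?n\<^sup>2 * \<beta> + \<epsilon>))" using up DK by linarith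
  qed
qed

lemma hausdorff_geodesic_contact_points_le:
  assumes "A \<subseteq> sphere 0 1" "A \<noteq> {}" "\<And>x. x \<in> A \<Longrightarrow> \<exists>a. norm (x - p a) \<le> r" "\<And>a. \<exists>x\<in>A. norm (x - p a) \<le> r"
  shows "hausdorff_geodesic A (supp (simplex_measure hull_body)) \<le> 2 * r"
  unfolding supp_simplex_measure[OF regular_simplex_hull_body circumscribed_hull_body] contact_points_hull_body
proof (rule hausdorff_geodesic_le)
  show "range p \<subseteq> sphere 0 1" "range p \<noteq> {}" by (auto simp: norm_p)
  have geo: "geodesic_dist x (p a) \<le> 2 * r" if "x \<in> A" "norm (x - p a) \<le> r" for x a
  proof -
    have "geodesic_dist x (p a) \<le> 2 * norm (x - p a)"
      using that assms(1) norm_p[of a] by (intro geodesic_dist_le_norm) auto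
    then show ?thesis using that(2) by linarith
  qed
  show "\<exists>y\<in>range p. geodesic_dist x y \<le> 2 * r" if "x \<in> A" for x
    using assms(3)[OF that] geo[OF that] by blast
  show "\<exists>x\<in>A. geodesic_dist x y \<le> 2 * r" if "y \<in> range p" for y
    using assms(4) geo that by blast
qed (use assms in auto)

end

theorem theorem1p5:
  fixes \<mu> :: "(real ^ 'n) measure" and T :: "(real ^ 'n) set" and \<epsilon> :: real
  assumes "CARD('n) \<ge> 3"
    and "sets \<mu> = sets sphere_borel"
    and "centred \<mu>" and "isotropic \<mu>"
    and "regular_simplex T" and "circumscribed T"
    and "0 \<le> \<epsilon>" and "\<epsilon> < 1"
    and "measure lebesgue (Z_body \<mu>) \<ge> (1 - \<epsilon>) * measure lebesgue T"
  shows "\<exists>S. regular_simplex S \<and> circumscribed S \<and>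
    hausdorff_geodesic (supp \<mu>) (supp (simplex_measure S))
      \<le> real CARD('n) ^ (70 * CARD('n)) * \<epsilon> powr (1 / 4)"
proof -
  let ?n = "real CARD('n)"
  define X where "X = ?n ^ CARD('n)"
  define t where "t = \<epsilon> powr (1 / 4)"
  have t0: "t \<ge> 0" by (simp add: t_def)
  have t4: "t ^ 4 = \<epsilon>"
    using \<open>0 \<le> \<epsilon>\<close> by (cases "\<epsilon> = 0") (auto simp: t_def powr_powr simp flip: powr_realpow)
  have X70: "real CARD('n) ^ (70 * CARD('n)) = X ^ 70" by (simp add: X_def power_mult[symmetric] mult.commute)
  have supp: "supp \<mu> \<subseteq> sphere 0 1" by (rule supp_closed(1)[OF assms(2)])
  have "\<exists>J c. J \<subseteq> supp \<mu> \<and> (\<Sum>u\<in>J. c u) = ?n"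
    by (rule isotropic_centred_finite_frame[OF assms(2-4)]) blast
  then have supp_ne: "supp \<mu> \<noteq> {}" by auto
  obtain p :: "'n option \<Rightarrow> real ^ 'n" where p: "simplex_normals p" and T: "T = simplex_normals.hull_body p"
    using regular_simplex_circumscribed_normals[OF assms(5,6)] .
  interpret P: simplex_normals p by (rule p)
  show ?thesis
  proof (cases "X ^ 70 * t < 4")
    case False
    \<comment> \<open>Angles are at most pi, hence below 4, so here the given simplex itself will
      do.\<close>
    have "hausdorff_geodesic (supp \<mu>) (supp (simplex_measure T)) \<le> X ^ 70 * t"
      unfolding supp_simplex_measure[OF assms(5,6)] unfolding T P.contact_points_hull_body
    proof (rule hausdorff_geodesic_le)
      have geo: "geodesic_dist x (p a) \<le> X ^ 70 * t" if "x \<in> supp \<mu>" for x a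
        using geodesic_dist_bounds(2)[of x "p a"] that supp P.norm_p[of a] False by auto
      show "\<exists>y\<in>range p. geodesic_dist x y \<le> X ^ 70 * t" if "x \<in> supp \<mu>" for x using geo[OF that] by blast
      show "\<exists>x\<in>supp \<mu>. geodesic_dist x y \<le> X ^ 70 * t" if "y \<in> range p" for y using geo that supp_ne by blast
    qed (use supp supp_ne P.norm_p in auto)
    then show ?thesis using assms(5,6) unfolding X70 t_def by blast
  next
    case True
    define C where "C = 294912 * (?n + 1)\<^sup>2 * (24 * (?n + 1)) ^ (CARD('n) + 1)"
    define m where "m = CARD('n)\<^sup>2 + CARD('n) + 1"
    define h where "h = 4 * real m * sqrt (C * \<epsilon>)"
    define \<beta> where "\<beta> = ?n\<^sup>2 * h + sqrt h"
    note bounds = constant_bounds[OF assms(1) X_def t0 True, unfolded t4, folded C_def m_def, folded h_def, folded \<beta>_def]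
    have Z: "Z_body \<mu> \<in> sets borel"
    proof -
      have "Z_body \<mu> = (\<Inter>u\<in>supp \<mu>. {x. inner u x \<le> 1})" by (auto simp: Z_body_def inner_commute)
      moreover have "closed (\<Inter>u\<in>supp \<mu>. {x. inner u x \<le> 1})" by (intro closed_INT ballI closed_halfspace_le)
      ultimately show ?thesis by simp
    qed
    have vol: "ennreal (1 - \<epsilon>) \<le> slice_const TYPE('n) * emeasure lborel (Z_body \<mu>)"
    proof -
      have Tb: "T \<in> sets borel" using P.closed_hull_body by (simp add: T)
      have "emeasure lborel T \<le> emeasure lborel (cball (0 :: real ^ 'n) ?n)"
        unfolding T using P.hull_body_subset_cball by (intro emeasure_mono) auto
      then have fin: "emeasure lborel T \<noteq> \<infinity>"
        using emeasure_lborel_cball_finite[of "0 :: real ^ 'n" ?n] by (auto simp: top_unique)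
      have "ennreal (1 - \<epsilon>) = ennreal (1 - \<epsilon>) * (slice_const TYPE('n) * emeasure lborel T)"
        unfolding T P.slice_const_hull_body by simp
      also have "\<dots> = slice_const TYPE('n) * ennreal ((1 - \<epsilon>) * measure lborel T)"
        using fin \<open>\<epsilon> < 1\<close> by (simp add: emeasure_eq_ennreal_measure ennreal_mult mult_ac)
      also have "\<dots> \<le> slice_const TYPE('n) * ennreal (measure lborel (Z_body \<mu>))"
      proof (intro mult_left_mono ennreal_leI)
        show "(1 - \<epsilon>) * measure lborel T \<le> measure lborel (Z_body \<mu>)"
          using assms(9) Tb Z by (simp add: measure_completion)
      qed simp
      \<comment> \<open>\<open>measure\<close> defaults to 0 on sets of infinite volume, so the
        inequality is right in that case too.\<close>
      also have "\<dots> \<le> slice_const TYPE('n) * emeasure lborel (Z_body \<mu>)"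
        unfolding measure_def by (intro mult_left_mono) (auto simp: ennreal_enn2real_if)
      finally show ?thesis .
    qed
    have small: "32 * (real m)\<^sup>2 * (?n + 1) * (C * \<epsilon>) < 1" by (rule bounds(1))
    obtain w :: "'n option \<Rightarrow> real ^ 'n" where w: "range w \<subseteq> supp \<mu>"
      "\<And>a b. a \<noteq> b \<Longrightarrow> \<bar>inner (w a) (w b) + 1 / ?n\<bar> \<le> h"
      using nearly_regular_subset_of_supp[OF assms(1-4) vol less_imp_le[OF assms(8)] small[unfolded C_def m_def]]
      unfolding h_def C_def m_def by blast
    have ws: "w a \<in> supp \<mu>" for a using w(1) by blast
    have w1: "norm (w a) = 1" for a using subsetD[OF supp ws[of a]] by simp
    have "\<exists>p'. simplex_normals p' \<and> (\<forall>a. norm (p' a - w a) \<le> \<beta>)"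
      unfolding \<beta>_def by (rule P.nearby_simplex_normals[where w = w, OF w1 w(2) bounds(2)]) blast+
    then obtain p' where p': "simplex_normals p'" and near: "\<And>a. norm (p' a - w a) \<le> \<beta>" by blast
    interpret S: simplex_normals p' by (rule p')
    define r where "r = 2 * (54 * (16 * ?n\<^sup>2) ^ CARD('n) * (2 * ?n\<^sup>2 * \<beta> + \<epsilon>))"
    have n\<beta>: "?n * \<beta> < 1"
    proof -
      have "1 * (?n * \<beta>) \<le> ?n * (?n * \<beta>)" using assms(1) bounds(6) by (intro mult_right_mono) auto
      moreover have "?n * (?n * \<beta>) \<le> 1 / 2" using bounds(3) by (simp only: power2_eq_square mult.assoc)
      ultimately show ?thesis by linarith
    qed
    have Zp: "(1 - ?n * \<beta>) *\<^sub>R x \<in> S.hull_body" if "x \<in> Z_body \<mu>" for x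
      using that ws by (intro S.scaled_subset_hull_body[OF near _ n\<beta>]) (auto simp: Z_body_def)
    have one: "\<exists>a. norm (u - p' a) \<le> max r \<beta>" if u: "u \<in> supp \<mu>" for u
    proof -
      have nu: "norm u = 1" using subsetD[OF supp u] by simp
      have Zu: "inner x u \<le> 1" if "x \<in> Z_body \<mu>" for x using that u by (simp add: Z_body_def)
      have "\<exists>a. norm (u - p' a) \<le> r"
        unfolding r_def
        by (rule S.dist_contact_point_le[OF assms(1) nu Z vol assms(7) less_imp_le[OF assms(8)] Zu Zp bounds(6) bounds(3)],
            assumption, assumption, rule exI)
      then show ?thesis by (auto simp: le_max_iff_disj)
    qed
    \<comment> \<open>This direction is immediate from the construction: each contact point is close
      to the support vector \<open>w a\<close> from which it was made. The opposite direction is the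
      one that uses caps.\<close>
    have two: "\<exists>u\<in>supp \<mu>. norm (u - p' a) \<le> max r \<beta>" for a
      using near[of a] ws[of a] by (intro bexI[of _ "w a"]) (auto simp: norm_minus_commute le_max_iff_disj)
    have "hausdorff_geodesic (supp \<mu>) (supp (simplex_measure S.hull_body)) \<le> 2 * max r \<beta>"
      by (rule S.hausdorff_geodesic_contact_points_le[OF supp supp_ne one two])
    also have "\<dots> \<le> X ^ 70 * t"
      using bounds(4,5) by (auto simp: r_def max_def)
    finally show ?thesis
      using S.regular_simplex_hull_body S.circumscribed_hull_body unfolding X70 t_def by blast
  qed
qed

end
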